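(* Let $G = T\cup C$ be a Halin graph, with characteristic tree $T$ and adjoint cycle $C$, and let $\Delta$ be the maximum degree of $G$. Then $$\chi'_s(G)\leq \left\lfloor\frac{3\Delta}{2}\right\rfloor+2.$$
   Context: All graphs are finite and simple. A proper edge coloring of a graph $G$ is an assignment of colors to the edges of $G$ such that no two adjacent edges (edges incident to a common vertex) receive the same color. A star edge coloring of $G$ is a proper edge coloring of $G$ such that no path with four edges and no cycle with four edges in $G$ is bicolored; that is, every path of length four and every cycle of length four in $G$ uses at least three different colors. The star chromatic index $\chi'_s(G)$ is the minimum integer $k$ such that $G$ admits a star edge coloring with $k$ colors. A Halin graph $G$ is a plane graph consisting of a tree $T$ and a cycle $C$, where each vertex of $T$ is either of degree $1$ in $T$ (a leaf) or of degree at least $3$ in $T$, and $C$ connects the leaves of $T$ (the vertices of $C$ are exactly the leaves of $T$) in such a way that $C$ is the boundary of the exterior face. The tree $T$ is called the characteristic tree and $C$ the adjoint cycle of $G$, and one writes $G = T\cup C$. *)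

theory Defs
  imports "HOL-Analysis.Analysis"
begin

datatype 'a sgraph = SGraph (verts: "'a set") (edges: "'a set set")

definition simple_graph :: "'a sgraph \<Rightarrow> bool" where
  "simple_graph G \<longleftrightarrow> finite (verts G) \<and> (\<forall>e\<in>edges G. e \<subseteq> verts G \<and> card e = 2)"

definition graph_union :: "'a sgraph \<Rightarrow> 'a sgraph \<Rightarrow> 'a sgraph" where
  "graph_union G H = SGraph (verts G \<union> verts H) (edges G \<union> edges H)"

definition vdegree :: "'a sgraph \<Rightarrow> 'a \<Rightarrow> nat" where
  "vdegree G v = card {e \<in> edges G. v \<in> e}"

definition max_degree :: "'a sgraph \<Rightarrow> nat" where
  "max_degree G = Max (vdegree G ` verts G)"

text \<open>Paths and cycles are given by the list of their vertices, so a path with \<open>k\<close> edges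
  has \<open>k + 1\<close> entries, and a cycle with \<open>k\<close> edges has \<open>k\<close> entries.\<close>

definition path_edges :: "'a list \<Rightarrow> 'a set set" where
  "path_edges p = {{p ! i, p ! Suc i} |i. Suc i < length p}"

definition cycle_edges :: "'a list \<Rightarrow> 'a set set" where
  "cycle_edges p = insert {last p, hd p} (path_edges p)"

definition is_path :: "'a sgraph \<Rightarrow> 'a list \<Rightarrow> bool" where
  "is_path G p \<longleftrightarrow> p \<noteq> [] \<and> distinct p \<and> set p \<subseteq> verts G \<and> path_edges p \<subseteq> edges G"

definition is_cycle :: "'a sgraph \<Rightarrow> 'a list \<Rightarrow> bool" where
  "is_cycle G p \<longleftrightarrow> length p \<ge> 3 \<and> distinct p \<and> set p \<subseteq> verts G \<and> cycle_edges p \<subseteq> edges G"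

definition connected_graph :: "'a sgraph \<Rightarrow> bool" where
  "connected_graph G \<longleftrightarrow> verts G \<noteq> {} \<and>
     (\<forall>u\<in>verts G. \<forall>v\<in>verts G. \<exists>p. is_path G p \<and> hd p = u \<and> last p = v)"

definition tree_graph :: "'a sgraph \<Rightarrow> bool" where
  "tree_graph T \<longleftrightarrow> simple_graph T \<and> connected_graph T \<and> \<not> (\<exists>p. is_cycle T p)"

definition cycle_graph :: "'a sgraph \<Rightarrow> bool" where
  "cycle_graph C \<longleftrightarrow>
     (\<exists>p. length p \<ge> 3 \<and> distinct p \<and> verts C = set p \<and> edges C = cycle_edges p)"

definition leaves :: "'a sgraph \<Rightarrow> 'a set" where
  "leaves T = {v \<in> verts T. vdegree T v = 1}"

definition proper_edge_coloring :: "'a sgraph \<Rightarrow> ('a set \<Rightarrow> 'c) \<Rightarrow> bool" where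
  "proper_edge_coloring G c \<longleftrightarrow>
     (\<forall>e\<in>edges G. \<forall>f\<in>edges G. e \<noteq> f \<and> e \<inter> f \<noteq> {} \<longrightarrow> c e \<noteq> c f)"

definition star_edge_coloring :: "'a sgraph \<Rightarrow> ('a set \<Rightarrow> 'c) \<Rightarrow> bool" where
  "star_edge_coloring G c \<longleftrightarrow> proper_edge_coloring G c \<and>
     (\<forall>p. is_path G p \<and> length p = 5 \<longrightarrow> card (c ` path_edges p) \<ge> 3) \<and>
     (\<forall>p. is_cycle G p \<and> length p = 4 \<longrightarrow> card (c ` cycle_edges p) \<ge> 3)"

definition star_edge_colorable :: "'a sgraph \<Rightarrow> nat \<Rightarrow> bool" where
  "star_edge_colorable G k \<longleftrightarrow>
     (\<exists>c :: 'a set \<Rightarrow> nat. c ` edges G \<subseteq> {..<k} \<and> star_edge_coloring G c)"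

definition star_chromatic_index :: "'a sgraph \<Rightarrow> nat" where
  "star_chromatic_index G = (LEAST k. star_edge_colorable G k)"

text \<open>The plane is \<^typ>\<open>complex\<close>.  A plane graph is a graph together with a crossing-free
  drawing: \<open>pos\<close> places the vertices and \<open>curve e\<close> is a simple arc, parametrised over
  \<open>{0..1}\<close>, joining the two ends of \<open>e\<close>.\<close>

definition plane_graph ::
  "'a sgraph \<Rightarrow> ('a \<Rightarrow> complex) \<Rightarrow> ('a set \<Rightarrow> real \<Rightarrow> complex) \<Rightarrow> bool" where
  "plane_graph G pos curve \<longleftrightarrow> simple_graph G \<and> inj_on pos (verts G) \<and>
     (\<forall>e\<in>edges G. arc (curve e) \<and>
        {pathstart (curve e), pathfinish (curve e)} = pos ` e \<and>
        path_image (curve e) \<inter> pos ` verts G = pos ` e) \<and>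
     (\<forall>e\<in>edges G. \<forall>f\<in>edges G. e \<noteq> f \<longrightarrow>
        path_image (curve e) \<inter> path_image (curve f) = pos ` (e \<inter> f))"

definition point_set ::
  "'a sgraph \<Rightarrow> ('a \<Rightarrow> complex) \<Rightarrow> ('a set \<Rightarrow> real \<Rightarrow> complex) \<Rightarrow> complex set" where
  "point_set G pos curve = pos ` verts G \<union> (\<Union>e\<in>edges G. path_image (curve e))"

text \<open>The drawing is compact, so its complement has exactly one unbounded component, and
  that component is \<^const>\<open>outside\<close> of the drawing.\<close>

definition exterior_face ::
  "'a sgraph \<Rightarrow> ('a \<Rightarrow> complex) \<Rightarrow> ('a set \<Rightarrow> real \<Rightarrow> complex) \<Rightarrow> complex set" where
  "exterior_face G pos curve = outside (point_set G pos curve)"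

definition halin_graph ::
  "'a sgraph \<Rightarrow> 'a sgraph \<Rightarrow> 'a sgraph \<Rightarrow> ('a \<Rightarrow> complex) \<Rightarrow> ('a set \<Rightarrow> real \<Rightarrow> complex) \<Rightarrow> bool"
where
  "halin_graph G T C pos curve \<longleftrightarrow>
     plane_graph G pos curve \<and> G = graph_union T C \<and>
     tree_graph T \<and> (\<forall>v\<in>verts T. vdegree T v = 1 \<or> vdegree T v \<ge> 3) \<and>
     cycle_graph C \<and> verts C = leaves T \<and>
     frontier (exterior_face G pos curve) = point_set C pos curve"

end

theory Submission imports Defs "HOL-Library.Sublist" begin

text \<open>
Let \<open>D\<close> be the maximum degree and \<open>q\<close> the cyclic list of leaves. The colour bound
\<open>3 * D div 2 + 2\<close> comes from splitting the colours: for \<open>D \<ge> 4\<close>, all but two of them colour the tree, and the rim,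
a cycle through the leaves, uses the remaining two and reuses some tree colours.

Two facts prepare the ground. A proper colouring is a star edge colouring if and only if no vertex \<open>m\<close> has
neighbours \<open>b\<close>, \<open>d\<close> such that the colour of \<open>{m, d}\<close> occurs at \<open>b\<close> and the colour of \<open>{m, b}\<close> occurs at \<open>d\<close>,
so only the colour sets at the vertices matter. And planarity enters just once: two disjoint paths of the tree cannot
have interleaving ends on the rim, because the first one cuts the inside of the rim into two parts (theta curve).
Hence the leaves beyond each tree edge are consecutive on the rim, and after rooting the tree at a leaf \<open>r\<close> it
becomes a datatype tree whose left-to-right leaf list, together with \<open>r\<close>, is the rim (\<open>halin_plane_rep\<close>). All
colour arguments are inductions over this datatype, and \<open>glue_star_edge_coloring\<close> says when a colouring of
the tree and a colouring of the rim fit together.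

The rim edges follow a cyclic word in the letters \<open>0, 1, 2\<close>, where neighbouring letters differ, the two
neighbours of each \<open>0\<close> differ and every three consecutive letters contain a \<open>0\<close>. Such a word is a product of blocks \<open>012\<close> and \<open>0102\<close>, and exists
for every length at least three other than five.

If \<open>D = 3\<close>, six colours are available and the tree is binary. The leaf edges take colours \<open>0, 1, 2\<close>, equal colours never
being consecutive on the rim, and the rim edges take \<open>3, 4, 5\<close> according to the word; these two sets being
disjoint, the rim does no harm. It remains to find a star edge colouring of the tree whose leaf edges have colours
below three and form a proper colouring around the rim. This is an induction on the tree with the colours
of the two neighbouring leaves as context; the statement has to be carried for three situations of the edge
above the subtree (\<open>high_extends\<close>, \<open>high_extends2\<close>, \<open>low_extends\<close>), with the few exceptions listed there.

If \<open>D \<ge> 4\<close>, the tree receives \<open>k = 3 * D div 2\<close> colours. Each inner vertex has a cyclic list of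
\<open>D\<close> colours starting with the colour of its parent edge. A child whose edge sits in slot \<open>j\<close> may use, of
this list, only the slots \<open>j, ..., j + h\<close> with \<open>h = (D - 1) div 2\<close>, and besides all colours outside the list; these
are \<open>D\<close> colours again. Two siblings cannot then see each other's colours, as this would need two forward
cyclic steps of length at most \<open>h\<close> each that lead back to the start, although \<open>2 * h < D\<close>. For leaves, the
same role is played by the set of colours which the rim must avoid there; it is small enough that any two consecutive
leaves leave a colour below \<open>k\<close> for the rim edge between them. Rim edges with letter \<open>0\<close> use that
colour, and the letters \<open>1, 2\<close> stand for two new colours.

Rims of length five belong to eleven small trees, coloured explicitly: five binary ones with six colours and six others with
seven.
\<close>

section \<open>Star edge colourings through pairs of adjacent edges\<close>

definition colors_at :: "'a sgraph \<Rightarrow> ('a set \<Rightarrow> 'c) \<Rightarrow> 'a \<Rightarrow> 'c set" where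
  "colors_at G c v = c ` {e \<in> edges G. v \<in> e}"

lemma path_edges_Cons2: "path_edges (x # y # p) = insert {x, y} (path_edges (y # p))"
proof -
  have "{i. Suc i < length (x # y # p)} = insert 0 (Suc ` {i. Suc i < length (y # p)})"
  proof (rule set_eqI)
    fix i show "i \<in> {i. Suc i < length (x # y # p)} \<longleftrightarrow> i \<in> insert 0 (Suc ` {i. Suc i < length (y # p)})"
      by (cases i) auto
  qed
  moreover have "path_edges q = (\<lambda>i. {q ! i, q ! Suc i}) ` {i. Suc i < length q}" for q :: "'a list"
    by (auto simp: path_edges_def)
  ultimately show ?thesis by (simp add: image_image)
qed

lemma path_edges_single [simp]: "path_edges [x] = {}"
  by (simp add: path_edges_def)

lemma path_edges_Nil [simp]: "path_edges [] = {}"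
  by (simp add: path_edges_def)

text \<open>The middle vertex \<open>m\<close> of a bicoloured path \<open>a b m d e\<close> has the forbidden pair of neighbours \<open>b\<close>, \<open>d\<close>.
A four-cycle is the case \<open>a = e\<close>.\<close>
lemma star_edge_coloringI:
  fixes c :: "'a set \<Rightarrow> 'c"
  assumes proper: "proper_edge_coloring G c"
    and pairs: "\<And>m b d. {m, b} \<in> edges G \<Longrightarrow> {m, d} \<in> edges G \<Longrightarrow> b \<noteq> d \<Longrightarrow>
      c {m, d} \<in> colors_at G c b \<Longrightarrow> c {m, b} \<in> colors_at G c d \<Longrightarrow> False"
  shows "star_edge_coloring G c"
proof -
  have key: "card {c {a, b}, c {b, m}, c {m, d}, c {d, e}} \<ge> 3"
    if E: "{a, b} \<in> edges G" "{b, m} \<in> edges G" "{m, d} \<in> edges G" "{d, e} \<in> edges G"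
      and ne: "a \<noteq> m" "b \<noteq> d" "m \<noteq> e" for a b m d e
  proof (rule ccontr)
    assume small: "\<not> ?thesis"
    have 1: "c {a, b} \<noteq> c {b, m}" "c {b, m} \<noteq> c {m, d}" "c {m, d} \<noteq> c {d, e}"
      using proper E ne unfolding proper_edge_coloring_def
      by (smt (verit, ccfv_threshold) disjoint_iff doubleton_eq_iff insertCI)+
    have "c {a, b} = c {m, d} \<and> c {b, m} = c {d, e}"
    proof (rule ccontr)
      assume "\<not> ?thesis"
      then consider "c {a, b} \<noteq> c {m, d}" | "c {b, m} \<noteq> c {d, e}" by blast
      then have "\<exists>S. S \<subseteq> {c {a, b}, c {b, m}, c {m, d}, c {d, e}} \<and> card S = 3"
      proof cases
        case 1
        show ?thesis by (rule exI[of _ "{c {a, b}, c {b, m}, c {m, d}}"]) (use 1 \<open>c {a, b} \<noteq> c {b, m}\<close> \<open>c {b, m} \<noteq> c {m, d}\<close> in auto)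
      next
        case 2
        show ?thesis by (rule exI[of _ "{c {b, m}, c {m, d}, c {d, e}}"]) (use 2 \<open>c {m, d} \<noteq> c {d, e}\<close> \<open>c {b, m} \<noteq> c {m, d}\<close> in auto)
      qed
      then show False using small
        by (metis card_mono finite.emptyI finite.insertI)
    qed
    moreover have "c {a, b} \<in> colors_at G c b" "c {d, e} \<in> colors_at G c d"
      using E by (auto simp: colors_at_def)
    ultimately show False using pairs[of m b d] E ne by (simp add: insert_commute)
  qed
  have "card (c ` path_edges p) \<ge> 3" if pp: "is_path G p" "length p = 5" for p
  proof -
    obtain a b m d e where p: "p = [a, b, m, d, e]"
      using pp(2) by (auto simp: numeral_eq_Suc length_Suc_conv)
    show ?thesis using pp(1) key[of a b m d e] unfolding p is_path_def
      by (simp add: path_edges_Cons2)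
  qed
  moreover have "card (c ` cycle_edges p) \<ge> 3" if pp: "is_cycle G p" "length p = 4" for p
  proof -
    obtain a b m d where p: "p = [a, b, m, d]"
      using pp(2) by (auto simp: numeral_eq_Suc length_Suc_conv)
    show ?thesis using pp(1) key[of a b m d a] unfolding p is_cycle_def cycle_edges_def
      by (auto simp: path_edges_Cons2 insert_commute)
  qed
  ultimately show ?thesis using proper by (auto simp: star_edge_coloring_def)
qed

section \<open>Tree paths of a plane graph do not cross inside the outer cycle\<close>

lemma path_edges_append:
  "path_edges (p @ y # q) = path_edges (p @ [y]) \<union> path_edges (y # q)"
proof (induction p rule: induct_list012)
  case 1 then show ?case by simp
next
  case (2 x) then show ?case by (simp add: path_edges_Cons2)
next
  case (3 x z p) then show ?case by (simp add: path_edges_Cons2)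
qed

lemma path_edges_subset: "e \<in> path_edges p \<Longrightarrow> e \<subseteq> set p"
  by (auto simp: path_edges_def)

lemma cycle_edges_subset: "p \<noteq> [] \<Longrightarrow> e \<in> cycle_edges p \<Longrightarrow> e \<subseteq> set p"
  using path_edges_subset[of e p] by (auto simp: cycle_edges_def)

lemma is_path_Cons2:
  "is_path G (x # y # p) \<longleftrightarrow> x \<in> verts G \<and> {x, y} \<in> edges G \<and> x \<notin> set (y # p) \<and> is_path G (y # p)"
  by (auto simp: is_path_def path_edges_Cons2)

lemma plane_graph_curves_meet:
  assumes "plane_graph G pos curve" "e \<in> edges G" "f \<in> edges G" "e \<noteq> f"
  shows "path_image (curve e) \<inter> path_image (curve f) = pos ` (e \<inter> f)"
  using assms by (simp add: plane_graph_def)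

text \<open>Consecutive edge curves share only the drawing of the common vertex, so they join to an arc.\<close>
lemma path_arc:
  assumes plane: "plane_graph G pos curve" and "is_path G p" "length p \<ge> 2"
  shows "\<exists>g. arc g \<and> path_image g = (\<Union>e\<in>path_edges p. path_image (curve e)) \<and>
    pathstart g = pos (hd p) \<and> pathfinish g = pos (last p)"
  using assms(2,3)
proof (induction p rule: induct_list012)
  case (3 x y p)
  have xy: "{x, y} \<in> edges G" "x \<noteq> y" "x \<in> verts G" "y \<in> verts G"
    using 3(3) by (auto simp: is_path_def path_edges_Cons2)
  have ce: "arc (curve {x, y})" "{pathstart (curve {x, y}), pathfinish (curve {x, y})} = {pos x, pos y}"
    using plane xy unfolding plane_graph_def by force+
  have "\<exists>g. arc g \<and> path_image g = path_image (curve {x, y}) \<and> pathstart g = pos x \<and> pathfinish g = pos y"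
  proof (cases "pathstart (curve {x, y}) = pos x")
    case True
    then show ?thesis using ce by (metis doubleton_eq_iff)
  next
    case False
    then have "pathstart (curve {x, y}) = pos y" "pathfinish (curve {x, y}) = pos x"
      using ce(2) by (auto simp: doubleton_eq_iff)
    then show ?thesis using ce(1)
      by (intro exI[of _ "reversepath (curve {x, y})"]) (auto simp: arc_reversepath)
  qed
  then obtain g1 where g1: "arc g1" "path_image g1 = path_image (curve {x, y})"
    "pathstart g1 = pos x" "pathfinish g1 = pos y" by blast
  show ?case
  proof (cases p)
    case Nil
    then show ?thesis using g1 by (auto simp: path_edges_Cons2)
  next
    case (Cons z r)
    have "is_path G (y # p)" "length (y # p) \<ge> 2"
      using 3(3) Cons by (auto simp: is_path_Cons2)
    from 3(2)[OF this] obtain g2 where g2: "arc g2"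
      "path_image g2 = (\<Union>e\<in>path_edges (y # p). path_image (curve e))"
      "pathstart g2 = pos y" "pathfinish g2 = pos (last (y # p))" by auto
    have "path_image g1 \<inter> path_image g2 \<subseteq> {pathstart g2}"
    proof
      fix u assume "u \<in> path_image g1 \<inter> path_image g2"
      then obtain f where f: "f \<in> path_edges (y # p)" "u \<in> path_image (curve f)"
        "u \<in> path_image (curve {x, y})" using g1 g2 by auto
      have "x \<notin> f" "f \<in> edges G"
        using f(1) path_edges_subset[of f "y # p"] 3(3) by (auto simp: is_path_def path_edges_Cons2)
      then have "path_image (curve {x, y}) \<inter> path_image (curve f) = pos ` ({x, y} \<inter> f)"
        using xy by (intro plane_graph_curves_meet[OF plane]) auto
      then show "u \<in> {pathstart g2}" using f \<open>x \<notin> f\<close> g2 by auto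
    qed
    then have "arc (g1 +++ g2)" using g1 g2 by (intro arc_join) auto
    then show ?thesis using g1 g2
      by (intro exI[of _ "g1 +++ g2"]) (auto simp: path_image_join path_edges_Cons2)
  qed
qed auto

lemma curves_inter:
  assumes plane: "plane_graph G pos curve" and E: "E1 \<subseteq> edges G" "E2 \<subseteq> edges G" "E1 \<inter> E2 = {}"
  shows "(\<Union>e\<in>E1. path_image (curve e)) \<inter> (\<Union>e\<in>E2. path_image (curve e)) \<subseteq> pos ` (\<Union>E1 \<inter> \<Union>E2)"
proof
  fix u assume "u \<in> (\<Union>e\<in>E1. path_image (curve e)) \<inter> (\<Union>e\<in>E2. path_image (curve e))"
  then obtain e f where ef: "e \<in> E1" "f \<in> E2" "u \<in> path_image (curve e) \<inter> path_image (curve f)" by blast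
  then have "path_image (curve e) \<inter> path_image (curve f) = pos ` (e \<inter> f)"
    using E by (intro plane_graph_curves_meet[OF plane]) auto
  then show "u \<in> pos ` (\<Union>E1 \<inter> \<Union>E2)" using ef by blast
qed

lemma finite_edges: "simple_graph G \<Longrightarrow> finite (edges G)"
  unfolding simple_graph_def by (meson finite_Pow_iff finite_subset PowI subsetI)

lemma compact_point_set:
  assumes "plane_graph G pos curve"
  shows "compact (point_set G pos curve)"
proof -
  have "simple_graph G" using assms by (simp add: plane_graph_def)
  then show ?thesis using assms finite_edges[of G] unfolding point_set_def plane_graph_def simple_graph_def
    by (intro compact_Un compact_UN) (auto intro!: finite_imp_compact compact_arc_image)
qed

text \<open>The outside of the rim is connected and meets the exterior face of the drawing. If it also contained a point of the
drawing, it would meet the frontier of the exterior face, which is the rim.\<close>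
lemma drawing_inside_rim:
  assumes plane: "plane_graph G pos curve"
    and sub: "point_set C pos curve \<subseteq> point_set G pos curve" and comp: "compact (point_set C pos curve)"
    and front: "frontier (exterior_face G pos curve) = point_set C pos curve"
  shows "point_set G pos curve - point_set C pos curve \<subseteq> inside (point_set C pos curve)"
proof
  let ?G = "point_set G pos curve" and ?C = "point_set C pos curve"
  fix z assume z: "z \<in> ?G - ?C"
  have "z \<notin> outside ?C"
  proof
    assume zo: "z \<in> outside ?C"
    have "connected (outside ?C)"
      using comp by (intro connected_outside) (auto simp: compact_imp_bounded)
    moreover have "outside ?C \<inter> outside ?G \<noteq> {}"
      using outside_mono[OF sub] outside_bounded_nonempty[of ?G] compact_point_set[OF plane]
      by (auto simp: compact_imp_bounded)
    moreover have "outside ?C - outside ?G \<noteq> {}"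
      using zo z outside_no_overlap[of ?G] by blast
    ultimately have "outside ?C \<inter> frontier (outside ?G) \<noteq> {}" by (rule connected_Int_frontier)
    then show False using front outside_no_overlap[of ?C] by (auto simp: exterior_face_def)
  qed
  then show "z \<in> inside ?C" using z inside_Un_outside[of ?C] by blast
qed

text \<open>An interior vertex of a path has two path edges, a leaf has one edge.\<close>
lemma path_interior_not_leaf:
  assumes T: "finite (edges T)" and p: "is_path T p" "v \<in> set p" "v \<noteq> hd p" "v \<noteq> last p"
  shows "v \<notin> leaves T"
proof
  assume "v \<in> leaves T"
  then have 1: "card {e \<in> edges T. v \<in> e} = 1" by (simp add: leaves_def vdegree_def)
  obtain i where i: "i < length p" "p ! i = v" using p(2) by (auto simp: in_set_conv_nth)
  have "i \<noteq> 0" using i p by (metis hd_conv_nth is_path_def)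
  moreover have "i \<noteq> length p - 1" using i p by (metis last_conv_nth is_path_def)
  ultimately obtain j where j: "i = Suc j" "Suc (Suc j) < length p" using i(1) by (cases i) auto
  let ?e = "{p ! j, p ! Suc j}" and ?f = "{p ! Suc j, p ! Suc (Suc j)}"
  have "?e \<in> path_edges p" "?f \<in> path_edges p" using j unfolding path_edges_def by auto
  then have "{?e, ?f} \<subseteq> {e \<in> edges T. v \<in> e}" using p(1) i j unfolding is_path_def by auto
  moreover have "p ! j \<noteq> p ! Suc (Suc j)" "p ! j \<noteq> p ! Suc j"
    using p(1) j by (auto simp: is_path_def nth_eq_iff_index_eq)
  then have "?e \<noteq> ?f" by (auto simp: doubleton_eq_iff)
  moreover have "finite {e \<in> edges T. v \<in> e}" using T by simp
  ultimately have "card {e \<in> edges T. v \<in> e} \<ge> card {?e, ?f}" "?e \<noteq> ?f"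
    by (metis card_mono, blast)
  then show False using 1 card_2_iff[of "{?e, ?f}"] by auto
qed

lemma cycle_edges_split:
  "cycle_edges (r # A @ x # B @ w # D) = path_edges (x # B @ [w]) \<union> path_edges (w # D @ r # A @ [x])"
proof -
  have 1: "path_edges (r # A @ x # B @ w # D) =
    path_edges (r # A @ [x]) \<union> path_edges (x # B @ [w]) \<union> path_edges (w # D)"
    using path_edges_append[of "r # A" x "B @ w # D"] path_edges_append[of "x # B" w D] by auto
  have "path_edges (q @ [u, v]) = insert {u, v} (path_edges (q @ [u]))" for q :: "'a list" and u v
    using path_edges_append[of q u "[v]"] by (auto simp: path_edges_Cons2)
  from this[of "butlast (w # D)" "last (w # D)" r]
  have 2: "path_edges ((w # D) @ [r]) = insert {last (w # D), r} (path_edges (w # D))"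
    by (metis append.assoc append_butlast_last_id append_Cons append_Nil list.distinct(1))
  have 3: "path_edges (w # D @ r # A @ [x]) = path_edges ((w # D) @ [r]) \<union> path_edges (r # A @ [x])"
    using path_edges_append[of "w # D" r "A @ [x]"] by simp
  show ?thesis unfolding cycle_edges_def 1 3 2 by auto
qed

lemma path_length_ge_2: "is_path G p \<Longrightarrow> hd p \<noteq> last p \<Longrightarrow> length p \<ge> 2"
  by (cases p; cases "tl p") (auto simp: is_path_def)

text \<open>The rim consists of two arcs from \<open>x\<close> to \<open>w\<close>, with \<open>z\<close> in one and \<open>r\<close> in the other. Together with
the drawing of \<open>P\<close>, which runs inside the rim, they form a theta curve. The drawing of \<open>Q\<close> without its ends is connected, avoids
the theta curve, and hence stays in one of the two regions into which \<open>P\<close> divides the inside. But each region has only one of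
\<open>z\<close>, \<open>r\<close> in its closure.\<close>
theorem tree_paths_do_not_cross:
  assumes halin: "halin_graph G T C pos curve"
    and cyc: "distinct (r # A @ x # B @ w # D)" "verts C = set (r # A @ x # B @ w # D)"
      "edges C = cycle_edges (r # A @ x # B @ w # D)"
    and inner: "\<And>e. e \<in> edges T \<Longrightarrow> \<not> e \<subseteq> leaves T"
    and P: "is_path T P" "hd P = x" "last P = w"
    and Q: "is_path T Q" "hd Q = z" "last Q = r" and z: "z \<in> set B"
    and disj: "set P \<inter> set Q = {}"
  shows False
proof -
  have plane: "plane_graph G pos curve" and G: "G = graph_union T C" and vC: "verts C = leaves T"
    and front: "frontier (exterior_face G pos curve) = point_set C pos curve"
    using halin by (auto simp: halin_graph_def)
  have sub: "edges T \<subseteq> edges G" "edges C \<subseteq> edges G" "verts T \<subseteq> verts G" "verts C \<subseteq> verts G"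
    using G by (auto simp: graph_union_def)
  have fT: "finite (edges T)"
    using plane sub finite_edges[of G] by (auto simp: plane_graph_def intro: finite_subset)
  have injpos: "inj_on pos (verts G)" using plane by (simp add: plane_graph_def)
  have TG: "is_path T q \<Longrightarrow> is_path G q" for q using sub by (auto simp: is_path_def)
  have ET: "edges T \<inter> edges C = {}"
  proof -
    have "e \<subseteq> leaves T" if "e \<in> edges C" for e
      using cycle_edges_subset[of "r # A @ x # B @ w # D" e] cyc that vC by auto
    then show ?thesis using inner by blast
  qed
  let ?c1 = "x # B @ [w]" and ?c2 = "w # D @ r # A @ [x]"
  have Eun: "edges C = path_edges ?c1 \<union> path_edges ?c2" using cyc(3) cycle_edges_split by metis
  have c12: "is_path G ?c1" "is_path G ?c2"
    using cyc Eun sub by (auto simp: is_path_def)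
  have "path_edges ?c1 \<inter> path_edges ?c2 = {}"
  proof (rule ccontr)
    assume "\<not> ?thesis"
    then obtain e where e: "e \<in> path_edges ?c1" "e \<in> path_edges ?c2" by blast
    have "e \<subseteq> {x, w}" using path_edges_subset[OF e(1)] path_edges_subset[OF e(2)] cyc(1) by auto
    moreover have "card e = 2" using e sub Eun plane by (auto simp: plane_graph_def simple_graph_def)
    ultimately have "e = {x, w}"
      by (metis card_2_iff doubleton_eq_iff insertCI insertE singletonD subset_iff)
    obtain b B' where B: "B = b # B'" using z by (cases B) auto
    have "e = {x, b} \<or> e \<in> path_edges (b # B' @ [w])" using e(1) B by (auto simp: path_edges_Cons2)
    then show False
      using path_edges_subset[of e "b # B' @ [w]"] cyc(1) B \<open>e = {x, w}\<close> by (auto simp: doubleton_eq_iff)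
  qed
  note E12 = this
  have lenP: "length P \<ge> 2" "length Q \<ge> 2"
  proof -
    have "x \<noteq> w" "z \<noteq> r" using cyc(1) z by auto
    then show "length P \<ge> 2" "length Q \<ge> 2"
      using path_length_ge_2[OF P(1)] path_length_ge_2[OF Q(1)] P Q by auto
  qed
  obtain g1 where g1: "arc g1" "path_image g1 = (\<Union>e\<in>path_edges ?c1. path_image (curve e))"
    "pathstart g1 = pos x" "pathfinish g1 = pos w"
    using path_arc[OF plane c12(1)] by auto
  obtain g2' where g2': "arc g2'" "path_image g2' = (\<Union>e\<in>path_edges ?c2. path_image (curve e))"
    "pathstart g2' = pos w" "pathfinish g2' = pos x"
    using path_arc[OF plane c12(2)] by auto
  define g2 where "g2 = reversepath g2'"
  have g2: "arc g2" "path_image g2 = (\<Union>e\<in>path_edges ?c2. path_image (curve e))"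
    "pathstart g2 = pos x" "pathfinish g2 = pos w"
    using g2' by (auto simp: g2_def arc_reversepath)
  obtain g where g: "arc g" "path_image g = (\<Union>e\<in>path_edges P. path_image (curve e))"
    "pathstart g = pos x" "pathfinish g = pos w"
    using path_arc[OF plane TG[OF P(1)] lenP(1)] P by auto
  obtain d where d: "arc d" "path_image d = (\<Union>e\<in>path_edges Q. path_image (curve e))"
    "pathstart d = pos z" "pathfinish d = pos r"
    using path_arc[OF plane TG[OF Q(1)] lenP(2)] Q by auto
  let ?C = "point_set C pos curve"
  have vimg: "pos v \<in> (\<Union>e\<in>path_edges q. path_image (curve e))" if vq: "v \<in> set q" "length q \<ge> 2" "is_path G q" for v q
  proof -
    obtain i where i: "i < length q" "q ! i = v" using vq by (auto simp: in_set_conv_nth)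
    have "\<exists>e\<in>path_edges q. v \<in> e"
    proof (cases "Suc i < length q")
      case True then show ?thesis using i by (auto simp: path_edges_def)
    next
      case False
      then obtain j where "i = Suc j" using vq(2) i by (cases i) auto
      then show ?thesis using i by (auto simp: path_edges_def)
    qed
    then obtain e where e: "e \<in> path_edges q" "v \<in> e" by blast
    have "e \<in> edges G" using e vq(3) by (auto simp: is_path_def)
    then have "{pathstart (curve e), pathfinish (curve e)} = pos ` e"
      using plane by (simp add: plane_graph_def)
    then have "pos v \<in> path_image (curve e)" using e
      by (metis imageI insertE pathfinish_in_path_image pathstart_in_path_image singletonD)
    then show ?thesis using e by blast
  qed
  have Cset: "?C = path_image g1 \<union> path_image g2"
  proof -
    have "pos ` set ?c1 \<subseteq> path_image g1" "pos ` set ?c2 \<subseteq> path_image g2"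
      using vimg[OF _ _ c12(1)] vimg[OF _ _ c12(2)] unfolding g1(2) g2(2) by (force, force)
    then have "pos ` verts C \<subseteq> path_image g1 \<union> path_image g2" using cyc(2) by auto
    then show ?thesis unfolding point_set_def Eun using g1(2) g2(2) by auto
  qed
  have leafint: "v \<in> leaves T \<Longrightarrow> v \<in> set q \<Longrightarrow> is_path T q \<Longrightarrow> v = hd q \<or> v = last q" for v q
    using path_interior_not_leaf[OF fT, of q v] by blast
  have ePT: "path_edges P \<subseteq> edges T" "path_edges Q \<subseteq> edges T" using P Q by (auto simp: is_path_def)
  have leaf_list: "set ?c1 \<subseteq> leaves T" "set ?c2 \<subseteq> leaves T" using vC cyc(2) by auto
  have Uset: "\<Union>(path_edges q) \<subseteq> set q" for q :: "'a list" using path_edges_subset by blast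
  have meet: "path_image g1 \<inter> path_image g2 = {pos x, pos w}"
  proof
    have "path_image g1 \<inter> path_image g2 \<subseteq> pos ` (\<Union>(path_edges ?c1) \<inter> \<Union>(path_edges ?c2))"
      unfolding g1(2) g2(2) using Eun sub by (intro curves_inter[OF plane _ _ E12]) auto
    also have "\<dots> \<subseteq> pos ` (set ?c1 \<inter> set ?c2)" using Uset by blast
    also have "\<dots> \<subseteq> {pos x, pos w}" using cyc(1) by auto
    finally show "path_image g1 \<inter> path_image g2 \<subseteq> {pos x, pos w}" .
    show "{pos x, pos w} \<subseteq> path_image g1 \<inter> path_image g2"
      using g1 g2 by (metis IntI empty_subsetI insert_subset pathfinish_in_path_image pathstart_in_path_image)
  qed
  have meetC: "(\<Union>e\<in>path_edges q. path_image (curve e)) \<inter> ?C \<subseteq> {pos (hd q), pos (last q)}"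
    if q: "is_path T q" for q
  proof -
    have 1: "path_edges q \<subseteq> edges G" "path_edges q \<inter> edges C = {}"
      using q ET sub by (auto simp: is_path_def)
    have "?C = (\<Union>e\<in>edges C. path_image (curve e))" unfolding Cset g1(2) g2(2) Eun by auto
    then have "(\<Union>e\<in>path_edges q. path_image (curve e)) \<inter> ?C \<subseteq> pos ` (\<Union>(path_edges q) \<inter> \<Union>(edges C))"
      using curves_inter[OF plane 1(1) sub(2) 1(2)] by simp
    also have "\<dots> \<subseteq> pos ` (set q \<inter> leaves T)"
      using Uset[of q] Uset[of ?c1] Uset[of ?c2] leaf_list unfolding Eun by blast
    also have "\<dots> \<subseteq> {pos (hd q), pos (last q)}" using leafint[OF _ _ q] by blast
    finally show ?thesis .
  qed
  have gC: "path_image g \<inter> ?C \<subseteq> {pos x, pos w}" using meetC[OF P(1)] P unfolding g(2) by simp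
  have dC: "path_image d \<inter> ?C \<subseteq> {pos z, pos r}" using meetC[OF Q(1)] Q unfolding d(2) by simp
  have gends: "pos x \<in> path_image g" "pos w \<in> path_image g"
    using g by (metis pathstart_in_path_image, metis pathfinish_in_path_image)
  have m1: "path_image g1 \<inter> path_image g = {pos x, pos w}" "path_image g2 \<inter> path_image g = {pos x, pos w}"
    using gC gends meet Cset by blast+
  have xw: "pos x \<noteq> pos w"
    using injpos cyc sub by (auto simp: inj_on_def)
  have GC: "point_set G pos curve - ?C \<subseteq> inside ?C"
  proof (rule drawing_inside_rim[OF plane _ _ front])
    show "?C \<subseteq> point_set G pos curve" using sub by (auto simp: point_set_def)
    show "compact ?C" unfolding Cset using g1(1) g2(1) by (simp add: compact_Un compact_arc_image)
  qed
  have gG: "path_image g \<subseteq> point_set G pos curve" "path_image d \<subseteq> point_set G pos curve"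
    unfolding g(2) d(2) point_set_def using ePT sub by blast+
  \<comment> \<open>the path \<open>P\<close> really enters the inside, as the theta curve theorem demands\<close>
  have ne: "path_image g \<inter> inside (path_image g1 \<union> path_image g2) \<noteq> {}"
  proof -
    have "path_image g - {pos x, pos w} \<noteq> {}"
      using nonempty_simple_path_endless[of g] g arc_imp_simple_path by metis
    then show ?thesis using gG GC gC unfolding Cset by blast
  qed
  obtain I: "inside (path_image g1 \<union> path_image g) \<inter> inside (path_image g2 \<union> path_image g) = {}"
    and IU: "inside (path_image g1 \<union> path_image g) \<union> inside (path_image g2 \<union> path_image g) \<union>
           (path_image g - {pos x, pos w}) = inside ?C"
    using split_inside_simple_closed_curve[OF arc_imp_simple_path[OF g1(1)] g1(3,4)
       arc_imp_simple_path[OF g2(1)] g2(3,4) arc_imp_simple_path[OF g(1)] g(3,4) xw meet m1 ne]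
    unfolding Cset by blast
  let ?I1 = "inside (path_image g1 \<union> path_image g)" and ?I2 = "inside (path_image g2 \<union> path_image g)"
  have cl: "closed (path_image g1 \<union> path_image g)" "closed (path_image g2 \<union> path_image g)"
    using g(1) g1(1) g2(1) by (auto simp: compact_arc_image compact_imp_closed)
  define J where "J = path_image d - {pos z, pos r}"
  have dg: "path_image d \<inter> path_image g = {}"
  proof -
    have "path_edges P \<inter> path_edges Q = {}"
    proof (rule ccontr)
      assume "\<not> ?thesis"
      then obtain e where "e \<in> path_edges P" "e \<in> path_edges Q" by blast
      then have "e = {}" using path_edges_subset[of e] disj by blast
      then have "{} \<in> edges G" using \<open>e \<in> path_edges P\<close> ePT sub by blast
      then show False using plane by (force simp: plane_graph_def simple_graph_def)
    qed
    then have "path_image g \<inter> path_image d \<subseteq> pos ` (\<Union>(path_edges P) \<inter> \<Union>(path_edges Q))"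
      unfolding g(2) d(2) using ePT sub by (intro curves_inter[OF plane]) auto
    then show ?thesis using Uset[of P] Uset[of Q] disj by blast
  qed
  have Jin: "J \<subseteq> ?I1 \<union> ?I2"
    using gG(2) GC dC IU dg unfolding J_def by blast
  have "connected J" using connected_simple_path_endless[of d] d arc_imp_simple_path unfolding J_def by metis
  moreover have "open ?I1" "open ?I2" using cl by (auto intro: open_inside)
  ultimately have JJ: "J \<subseteq> ?I1 \<or> J \<subseteq> ?I2"
    using connectedD[of J ?I1 ?I2] Jin I by blast
  \<comment> \<open>removing the ends of an arc does not change its closure\<close>
  have Jcl: "pos z \<in> closure J" "pos r \<in> closure J"
  proof -
    have *: "closure (d ` {0<..<1}) = d ` {0..1}"
    proof (rule antisym)
      have "closed (d ` {0..1})" using d(1) compact_arc_image[of d] by (simp add: path_image_def compact_imp_closed)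
      then show "closure (d ` {0<..<1}) \<subseteq> d ` {0..1}" by (intro closure_minimal) auto
      have "d ` closure {0<..<1} \<subseteq> closure (d ` {0<..<1})"
        using d(1) by (intro image_closure_subset[of "{0<..<1}"]) (auto simp: arc_def path_def closure_subset)
      then show "d ` {0..1} \<subseteq> closure (d ` {0<..<1})" by simp
    qed
    have "J = d ` {0<..<1}" using simple_path_endless[of d] d arc_imp_simple_path unfolding J_def by metis
    then have "closure J = path_image d" using * by (simp add: path_image_def)
    then show "pos z \<in> closure J" "pos r \<in> closure J"
      using d by (metis pathstart_in_path_image, metis pathfinish_in_path_image)
  qed
  have zr: "pos z \<in> path_image g1" "pos r \<in> path_image g2"
    using vimg[OF _ _ c12(1), of z] vimg[OF _ _ c12(2), of r] z unfolding g1(2) g2(2) by auto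
  have zrne: "pos z \<notin> {pos x, pos w}" "pos r \<notin> {pos x, pos w}"
    using injpos cyc sub z by (auto simp: inj_on_def)
  have zrg: "pos z \<notin> path_image g" "pos r \<notin> path_image g"
    using zr zrne gC Cset by blast+
  have noI: "pos z \<notin> inside ?C" "pos r \<notin> inside ?C"
    using zr Cset inside_no_overlap[of ?C] by blast+
  from JJ show False
  proof
    assume "J \<subseteq> ?I1"
    then have "pos r \<in> ?I1 \<union> (path_image g1 \<union> path_image g)"
      using Jcl(2) closure_inside_subset[OF cl(1)] closure_mono[of J ?I1] by blast
    then show False using noI zrg zr zrne meet IU by blast
  next
    assume "J \<subseteq> ?I2"
    then have "pos z \<in> ?I2 \<union> (path_image g2 \<union> path_image g)"
      using Jcl(1) closure_inside_subset[OF cl(2)] closure_mono[of J ?I2] by blast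
    then show False using noI zrg zr zrne meet IU by blast
  qed
qed

section \<open>Plane rooted trees\<close>

lemma path_edges_snoc2: "path_edges (p @ [u, v]) = insert {u, v} (path_edges (p @ [u]))"
  using path_edges_append[of p u "[v]"] by (auto simp: path_edges_Cons2)

lemma path_edges_rev: "path_edges (rev p) = path_edges p"
proof (induction p rule: induct_list012)
  case (3 x y p)
  then show ?case using path_edges_snoc2[of "rev p" y x] by (simp add: path_edges_Cons2 insert_commute)
qed auto

definition reach :: "'a sgraph \<Rightarrow> 'a set \<Rightarrow> 'a \<Rightarrow> 'a \<Rightarrow> bool" where
  "reach T S x y \<longleftrightarrow> (\<exists>p. is_path T p \<and> set p \<subseteq> S \<and> hd p = x \<and> last p = y)"

lemma is_path_appendD1: "is_path T (p @ z # q) \<Longrightarrow> is_path T (p @ [z])"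
  using path_edges_append[of p z q] by (auto simp: is_path_def)

lemma is_path_rev: "is_path T (rev p) \<longleftrightarrow> is_path T p"
  by (simp add: is_path_def path_edges_rev)

lemma reach_in_path:
  assumes "is_path T p" "set p \<subseteq> S" "y \<in> set p"
  shows "reach T S (hd p) y"
proof -
  obtain p1 p2 where p: "p = p1 @ y # p2" using assms(3) by (meson split_list)
  then have "is_path T (p1 @ [y])" using assms(1) is_path_appendD1[of T p1 y p2] by simp
  then show ?thesis using p assms(2) unfolding reach_def
    by (intro exI[of _ "p1 @ [y]"]) (auto simp: hd_append)
qed

lemma reach_refl: "x \<in> verts T \<Longrightarrow> x \<in> S \<Longrightarrow> reach T S x x"
  unfolding reach_def by (intro exI[of _ "[x]"]) (auto simp: is_path_def)

lemma reach_sym: "reach T S x y \<Longrightarrow> reach T S y x"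
  unfolding reach_def by (metis is_path_rev set_rev hd_rev last_rev)

lemma reach_verts: "reach T S x y \<Longrightarrow> x \<in> verts T \<and> y \<in> verts T \<and> x \<in> S \<and> y \<in> S"
  unfolding reach_def is_path_def by (metis hd_in_set last_in_set subsetD)

locale forest =
  fixes T :: "'a sgraph"
  assumes simple: "simple_graph T" and acyclic: "\<not> (\<exists>p. is_cycle T p)"
begin

lemma edge_verts: "{x, y} \<in> edges T \<Longrightarrow> x \<in> verts T \<and> y \<in> verts T \<and> x \<noteq> y"
proof -
  assume "{x, y} \<in> edges T"
  moreover have "e \<subseteq> verts T \<and> card e = 2" if "e \<in> edges T" for e
    using simple that by (simp add: simple_graph_def)
  ultimately have "{x, y} \<subseteq> verts T \<and> card {x, y} = 2" by metis
  then show ?thesis by (cases "x = y") auto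
qed

lemma edge_pair: "e \<in> edges T \<Longrightarrow> \<exists>x y. e = {x, y}"
  using simple unfolding simple_graph_def by (meson card_2_iff)

lemma reach_step:
  assumes "reach T S x y" "{y, z} \<in> edges T" "z \<in> S"
  shows "reach T S x z"
proof -
  obtain p where p: "is_path T p" "set p \<subseteq> S" "hd p = x" "last p = y" using assms(1) by (auto simp: reach_def)
  show ?thesis
  proof (cases "z \<in> set p")
    case True then show ?thesis using reach_in_path p by metis
  next
    case False
    obtain p' where p': "p = p' @ [y]" using p(1,4) by (metis append_butlast_last_id is_path_def)
    have "is_path T (p @ [z])" using p False assms(2) edge_verts[OF assms(2)]
      by (auto simp: is_path_def p' path_edges_snoc2)
    then show ?thesis using p assms(3) unfolding reach_def
      by (intro exI[of _ "p @ [z]"]) (auto simp: p' hd_append)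
  qed
qed

lemma reach_trans:
  assumes "reach T S x y" "reach T S y z"
  shows "reach T S x z"
proof -
  have "is_path T q \<Longrightarrow> set q \<subseteq> S \<Longrightarrow> reach T S x (hd q) \<Longrightarrow> reach T S x (last q)" for q
  proof (induction q rule: induct_list012)
    case (3 u v q)
    then show ?case using reach_step[of S x u v] by (auto simp: is_path_Cons2)
  qed (auto simp: is_path_def)
  then show ?thesis using assms(2) assms(1) unfolding reach_def[of T S y z] by metis
qed

text \<open>Otherwise the two edges at \<open>v\<close> would close a cycle.\<close>
lemma no_reach_between_neighbours:
  assumes "{v, c} \<in> edges T" "{v, d} \<in> edges T" "c \<noteq> d"
  shows "\<not> reach T (- {v}) c d"
proof
  assume "reach T (- {v}) c d"
  then obtain p where p: "is_path T p" "v \<notin> set p" "hd p = c" "last p = d" by (auto simp: reach_def)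
  then obtain b q where pq: "p = c # b # q" using assms(3)
    by (cases p; cases "tl p") (auto simp: is_path_def)
  have "is_cycle T (v # p)" using p assms edge_verts[OF assms(1)]
    unfolding is_cycle_def cycle_edges_def is_path_def pq by (auto simp: path_edges_Cons2 insert_commute)
  then show False using acyclic by blast
qed

text \<open>The vertices on the far side of the edge \<open>{p, v}\<close>, seen from \<open>p\<close>.\<close>
definition branch :: "'a \<Rightarrow> 'a \<Rightarrow> 'a set" where
  "branch p v = {x. reach T (- {p}) v x}"

definition nbrs :: "'a \<Rightarrow> 'a set" where
  "nbrs v = {c. {v, c} \<in> edges T}"

lemma branch_root: "{p, v} \<in> edges T \<Longrightarrow> v \<in> branch p v"
  unfolding branch_def using edge_verts[of p v] reach_refl[of v T "- {p}"] by auto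

lemma branch_subset: "branch p v \<subseteq> verts T - {p}"
  unfolding branch_def using reach_verts by force

lemma branch_disjoint:
  assumes "c \<in> nbrs v" "d \<in> nbrs v" "c \<noteq> d"
  shows "branch v c \<inter> branch v d = {}"
proof (rule equals0I)
  fix x assume "x \<in> branch v c \<inter> branch v d"
  then have "reach T (- {v}) c x" "reach T (- {v}) x d" by (auto simp: branch_def intro: reach_sym)
  then have "reach T (- {v}) c d" by (rule reach_trans)
  then show False using assms no_reach_between_neighbours[of v c d] by (simp add: nbrs_def)
qed

lemma branch_eq:
  assumes pv: "{p, v} \<in> edges T"
  shows "branch p v = insert v (\<Union>c\<in>nbrs v - {p}. branch v c)"
proof (intro set_eqI iffI)
  fix x assume "x \<in> branch p v"
  then obtain q where q: "is_path T q" "set q \<subseteq> - {p}" "hd q = v" "last q = x"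
    by (auto simp: branch_def reach_def)
  show "x \<in> insert v (\<Union>c\<in>nbrs v - {p}. branch v c)"
  proof (cases "tl q")
    case Nil then show ?thesis using q by (cases q) (auto simp: is_path_def)
  next
    case (Cons c r)
    then have q': "q = v # c # r" using q by (cases q) (auto simp: is_path_def)
    then have "c \<in> nbrs v - {p}" "is_path T (c # r)" "set (c # r) \<subseteq> - {v}"
      using q by (auto simp: is_path_Cons2 nbrs_def)
    moreover then have "x \<in> branch v c" using q(4) q' unfolding branch_def reach_def
      by (intro CollectI exI[of _ "c # r"]) auto
    ultimately show ?thesis by blast
  qed
next
  fix x assume "x \<in> insert v (\<Union>c\<in>nbrs v - {p}. branch v c)"
  then consider "x = v" | c where "c \<in> nbrs v - {p}" "x \<in> branch v c" by blast
  then show "x \<in> branch p v"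
  proof cases
    case 1 then show ?thesis using branch_root[OF pv] by simp
  next
    case 2
    then obtain q where q: "is_path T q" "set q \<subseteq> - {v}" "hd q = c" "last q = x"
      by (auto simp: branch_def reach_def)
    have vc: "{v, c} \<in> edges T" "c \<noteq> p" using 2 by (auto simp: nbrs_def)
    have "p \<notin> set q"
      using reach_in_path[OF q(1,2)] no_reach_between_neighbours[of v c p] q(3) vc pv
      by (auto simp: insert_commute)
    moreover have "is_path T (v # q)"
      using q vc edge_verts[OF vc(1)] by (cases q) (auto simp: is_path_def path_edges_Cons2)
    ultimately show ?thesis using q edge_verts[OF pv] unfolding branch_def reach_def
      by (intro CollectI exI[of _ "v # q"]) (auto simp: is_path_def)
  qed
qed

lemma branch_complement:
  assumes conn: "connected_graph T" and pv: "{p, v} \<in> edges T"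
  shows "branch p v \<inter> branch v p = {}" "branch p v \<union> branch v p = verts T"
proof -
  have p: "p \<in> nbrs v" using pv by (simp add: nbrs_def insert_commute)
  show "branch p v \<inter> branch v p = {}"
    using branch_eq[OF pv] branch_disjoint[OF p] branch_subset[of v p] by blast
  show "branch p v \<union> branch v p = verts T"
  proof
    show "branch p v \<union> branch v p \<subseteq> verts T" using branch_subset by blast
    show "verts T \<subseteq> branch p v \<union> branch v p"
    proof
      fix x assume x: "x \<in> verts T"
      then obtain q where q: "is_path T q" "hd q = v" "last q = x"
        using conn edge_verts[OF pv] unfolding connected_graph_def by blast
      show "x \<in> branch p v \<union> branch v p"
      proof (cases "tl q")
        case Nil then show ?thesis using q branch_root[OF pv] by (cases q) (auto simp: is_path_def)
      next
        case (Cons c r)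
        then have q': "q = v # c # r" using q by (cases q) (auto simp: is_path_def)
        then have "c \<in> nbrs v" "is_path T (c # r)" "set (c # r) \<subseteq> - {v}"
          using q by (auto simp: is_path_Cons2 nbrs_def)
        moreover then have "x \<in> branch v c" using q(3) q' unfolding branch_def reach_def
          by (intro CollectI exI[of _ "c # r"]) auto
        ultimately show ?thesis using branch_eq[OF pv] by (cases "c = p") auto
      qed
    qed
  qed
qed

lemma path_in_branch:
  assumes "x \<in> branch p v" "y \<in> branch p v"
  shows "\<exists>q. is_path T q \<and> set q \<subseteq> branch p v \<and> hd q = x \<and> last q = y"
proof -
  have "reach T (- {p}) x v" "reach T (- {p}) v y" using assms by (auto simp: branch_def intro: reach_sym)
  then have "reach T (- {p}) x y" by (rule reach_trans)
  then obtain q where q: "is_path T q" "set q \<subseteq> - {p}" "hd q = x" "last q = y" by (auto simp: reach_def)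
  have "set q \<subseteq> branch p v"
  proof
    fix u assume "u \<in> set q"
    then have "reach T (- {p}) x u" using reach_in_path[OF q(1,2)] q(3) by simp
    moreover have "reach T (- {p}) v x" using assms(1) by (simp add: branch_def)
    ultimately have "reach T (- {p}) v u" by (rule reach_trans[rotated])
    then show "u \<in> branch p v" by (simp add: branch_def)
  qed
  then show ?thesis using q by blast
qed

lemma finite_nbrs: "finite (nbrs v)"
proof -
  have "nbrs v \<subseteq> verts T" using edge_verts by (auto simp: nbrs_def)
  then show ?thesis using simple by (auto simp: simple_graph_def intro: finite_subset)
qed

lemma vdegree_nbrs: "vdegree T v = card (nbrs v)"
proof -
  have "bij_betw (\<lambda>c. {v, c}) (nbrs v) {e \<in> edges T. v \<in> e}"
    unfolding bij_betw_def
  proof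
    show "inj_on (\<lambda>c. {v, c}) (nbrs v)" by (auto simp: inj_on_def doubleton_eq_iff)
    have "e \<in> (\<lambda>c. {v, c}) ` nbrs v" if e: "e \<in> edges T" "v \<in> e" for e
    proof -
      obtain x y where xy: "e = {x, y}" using edge_pair[OF e(1)] by blast
      then show ?thesis using e by (cases "v = x") (auto simp: nbrs_def insert_commute)
    qed
    then show "(\<lambda>c. {v, c}) ` nbrs v = {e \<in> edges T. v \<in> e}" by (auto simp: nbrs_def)
  qed
  then show ?thesis by (simp add: vdegree_def bij_betw_same_card)
qed

end

datatype 'a plane_tree = Nd (rt: 'a) (subs: "'a plane_tree list")

fun preorder :: "'a plane_tree \<Rightarrow> 'a list" where "preorder (Nd v ts) = v # concat (map preorder ts)"
fun leaf_list :: "'a plane_tree \<Rightarrow> 'a list" where "leaf_list (Nd v ts) = (if ts = [] then [v] else concat (map leaf_list ts))"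
fun arcs :: "'a plane_tree \<Rightarrow> ('a \<times> 'a) set" where
  "arcs (Nd v ts) = (\<lambda>s. (v, rt s)) ` set ts \<union> (\<Union>s\<in>set ts. arcs s)"
fun subtrees :: "'a plane_tree \<Rightarrow> 'a plane_tree set" where "subtrees (Nd v ts) = insert (Nd v ts) (\<Union>s\<in>set ts. subtrees s)"

text \<open>Membership in \<open>S\<close> is an interval of the list, phrased without indices so that it passes to sublists.\<close>
definition convex_in :: "'a list \<Rightarrow> 'a set \<Rightarrow> bool" where
  "convex_in xs S \<longleftrightarrow> (\<forall>x z w. subseq [x, z, w] xs \<and> x \<in> S \<and> w \<in> S \<longrightarrow> z \<in> S)"

lemma convex_inD: "convex_in xs S \<Longrightarrow> subseq [x, z, w] xs \<Longrightarrow> x \<in> S \<Longrightarrow> w \<in> S \<Longrightarrow> z \<in> S"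
  unfolding convex_in_def by blast

lemma convex_in_subseq: "convex_in xs S \<Longrightarrow> subseq ys xs \<Longrightarrow> convex_in ys S"
  unfolding convex_in_def by (meson subseq_order.trans)

text \<open>Disjoint intervals that cover a list appear in some order, and this order will be the left-to-right
order of the children of a vertex. The interval of the first element is split off and the rest is handled by induction.\<close>
lemma convex_blocks:
  assumes "finite K" and "\<And>c. c \<in> K \<Longrightarrow> convex_in ys (S c)"
    and "\<And>c d. c \<in> K \<Longrightarrow> d \<in> K \<Longrightarrow> c \<noteq> d \<Longrightarrow> S c \<inter> S d = {}"
    and "set ys \<subseteq> (\<Union>c\<in>K. S c)"
  shows "\<exists>cs. distinct cs \<and> set cs = K \<and> concat (map (\<lambda>c. filter (\<lambda>x. x \<in> S c) ys) cs) = ys"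
  using assms
proof (induction "card K" arbitrary: K ys)
  case 0
  then show ?case by (intro exI[of _ "[]"]) auto
next
  case (Suc n)
  show ?case
  proof (cases ys)
    case Nil
    obtain cs where "distinct cs" "set cs = K" using finite_distinct_list[OF Suc(3)] by blast
    then show ?thesis using Nil by (intro exI[of _ cs]) auto
  next
    case (Cons y ys')
    obtain c where c: "c \<in> K" "y \<in> S c" using Suc(6) Cons by auto
    define a where "a = takeWhile (\<lambda>x. x \<in> S c) ys"
    define b where "b = dropWhile (\<lambda>x. x \<in> S c) ys"
    have ab: "ys = a @ b" by (simp add: a_def b_def)
    have aS: "set a \<subseteq> S c" by (auto simp: a_def dest: set_takeWhileD)
    have bS: "w \<notin> S c" if w: "w \<in> set b" for w
    proof
      assume wS: "w \<in> S c"
      obtain z b' where b: "b = z # b'" using w by (cases b) auto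
      have zS: "z \<notin> S c" using b unfolding b_def by (metis hd_dropWhile list.distinct(1) list.sel(1))
      then have "w \<in> set b'" using w wS b by auto
      then have "subseq [w] b'" by (simp add: subseq_singleton_left)
      then have "subseq [z, w] b" using b by simp
      moreover have "a = y # tl a" using Cons c by (simp add: a_def)
      then have "subseq [y] a" by (metis list.set_intros(1) subseq_singleton_left)
      ultimately have "subseq ([y] @ [z, w]) (a @ b)" by (intro list_emb_append_mono)
      then have "z \<in> S c" using convex_inD[OF Suc(4)[OF c(1)], of y z w] ab c(2) wS by simp
      then show False using zS by simp
    qed
    have IH: "\<exists>cs. distinct cs \<and> set cs = K - {c} \<and> concat (map (\<lambda>c. filter (\<lambda>x. x \<in> S c) b) cs) = b"
    proof (rule Suc(1))
      show "n = card (K - {c})" using Suc(2,3) c(1) by simp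
      show "finite (K - {c})" using Suc(3) by simp
      show "convex_in b (S d)" if "d \<in> K - {c}" for d
        using convex_in_subseq[OF Suc(4), of d b] that ab by (simp add: list_emb_append2)
      show "S d \<inter> S d' = {}" if "d \<in> K - {c}" "d' \<in> K - {c}" "d \<noteq> d'" for d d'
        using Suc(5) that by auto
      show "set b \<subseteq> (\<Union>d\<in>K - {c}. S d)"
      proof
        fix w assume w: "w \<in> set b"
        then obtain d where "d \<in> K" "w \<in> S d" using Suc(6) ab by auto
        moreover have "d \<noteq> c" using bS[OF w] \<open>w \<in> S d\<close> by blast
        ultimately show "w \<in> (\<Union>d\<in>K - {c}. S d)" by blast
      qed
    qed
    then obtain cs where cs: "distinct cs" "set cs = K - {c}"
      "concat (map (\<lambda>c. filter (\<lambda>x. x \<in> S c) b) cs) = b" by blast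
    have "filter (\<lambda>x. x \<in> S d) ys = filter (\<lambda>x. x \<in> S d) b" if "d \<in> set cs" for d
    proof -
      have "S d \<inter> S c = {}" using Suc(5) that cs(2) c(1) by blast
      then show ?thesis using aS ab by (auto simp: filter_empty_conv)
    qed
    then have "map (\<lambda>c. filter (\<lambda>x. x \<in> S c) ys) cs = map (\<lambda>c. filter (\<lambda>x. x \<in> S c) b) cs" by simp
    moreover have "filter (\<lambda>x. x \<in> S c) ys = a" using aS bS ab
      by (auto simp: filter_id_conv subset_iff filter_empty_conv)
    ultimately have "concat (map (\<lambda>c. filter (\<lambda>x. x \<in> S c) ys) (c # cs)) = ys"
      using cs(3) ab by (simp only: list.map concat.simps)
    moreover have "distinct (c # cs)" "set (c # cs) = K" using cs c(1) by auto
    ultimately show ?thesis by blast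
  qed
qed

text \<open>The tree \<open>t\<close> represents the branch beyond \<open>{p, v}\<close>, and its leaves come in the order of \<open>xs\<close>.\<close>
definition (in forest) branch_tree :: "'a list \<Rightarrow> 'a \<Rightarrow> 'a \<Rightarrow> 'a plane_tree \<Rightarrow> bool" where
  "branch_tree xs p v t \<longleftrightarrow> rt t = v \<and> set (preorder t) = branch p v \<and> distinct (preorder t) \<and>
    leaf_list t = filter (\<lambda>x. x \<in> branch p v) xs \<and>
    (\<forall>(a, b)\<in>arcs t. {a, b} \<in> edges T) \<and>
    (\<forall>e\<in>edges T. e \<subseteq> branch p v \<longrightarrow> e \<in> (\<lambda>(a, b). {a, b}) ` arcs t) \<and>
    (\<forall>u\<in>subtrees t. Suc (length (subs u)) = vdegree T (rt u))"

text \<open>Induction on the size of the branch: the branches beyond the children of \<open>v\<close> partition it, and by convexity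
they partition its leaves into blocks, whose order is taken as the order of the children.\<close>
lemma (in forest) plane_rooted_branch:
  assumes conn: "connected_graph T"
    and xs: "distinct xs" "set xs = leaves T - {r}"
    and conv: "\<And>p v. {p, v} \<in> edges T \<Longrightarrow> r \<notin> branch p v \<Longrightarrow> convex_in xs (branch p v)"
    and "{p, v} \<in> edges T" "r \<notin> branch p v"
  shows "\<exists>t. branch_tree xs p v t"
  using assms(5,6)
proof (induction "card (branch p v)" arbitrary: p v rule: less_induct)
  case less
  note pv = less(2) and rb = less(3)
  define K where "K = nbrs v - {p}"
  define ys where "ys = filter (\<lambda>x. x \<in> branch p v) xs"
  have beq: "branch p v = insert v (\<Union>c\<in>K. branch v c)" using branch_eq[OF pv] K_def by simp
  have K: "{v, c} \<in> edges T" "c \<in> nbrs v" "c \<noteq> p" if "c \<in> K" for c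
    using that by (auto simp: K_def nbrs_def)
  have finK: "finite K" using finite_nbrs by (simp add: K_def)
  have vK: "v \<notin> branch v c" for c using branch_subset[of v c] by auto
  have finb: "finite (branch p v)" using branch_subset[of p v] simple
    by (auto simp: simple_graph_def intro: finite_subset)
  have "\<exists>t. branch_tree xs v c t" if c: "c \<in> K" for c
  proof (rule less(1))
    have "branch v c \<subset> branch p v" using beq vK[of c] c by blast
    then show "card (branch v c) < card (branch p v)" using finb by (simp add: psubset_card_mono)
    show "{v, c} \<in> edges T" using K c by simp
    show "r \<notin> branch v c" using rb beq c by blast
  qed
  then obtain tf where T: "\<forall>c\<in>K. branch_tree xs v c (tf c)" by metis
  have tf: "\<And>c. c \<in> K \<Longrightarrow> rt (tf c) = c"
    "\<And>c. c \<in> K \<Longrightarrow> set (preorder (tf c)) = branch v c"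
    "\<And>c. c \<in> K \<Longrightarrow> distinct (preorder (tf c))"
    "\<And>c. c \<in> K \<Longrightarrow> leaf_list (tf c) = filter (\<lambda>x. x \<in> branch v c) xs"
    "\<And>c a b. c \<in> K \<Longrightarrow> (a, b)\<in>arcs (tf c) \<Longrightarrow> {a, b} \<in> edges T"
    "\<And>c e. c \<in> K \<Longrightarrow> e\<in>edges T \<Longrightarrow> e \<subseteq> branch v c \<Longrightarrow> e \<in> (\<lambda>(a, b). {a, b}) ` arcs (tf c)"
    "\<And>c u. c \<in> K \<Longrightarrow> u\<in>subtrees (tf c) \<Longrightarrow> Suc (length (subs u)) = vdegree T (rt u)"
    using T unfolding branch_tree_def by (simp, simp, simp, simp, blast, simp, simp)
  have disj: "branch v c \<inter> branch v d = {}" if "c \<in> K" "d \<in> K" "c \<noteq> d" for c d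
    using branch_disjoint K that by blast
  have deg: "vdegree T v = Suc (card K)"
  proof -
    have "p \<in> nbrs v" using pv by (simp add: nbrs_def insert_commute)
    then show ?thesis using finite_nbrs[of v] unfolding vdegree_nbrs K_def by (rule card_Suc_Diff1[symmetric, rotated])
  qed
  show ?case
  proof (cases "K = {}")
    case True
    have "v \<in> leaves T" using deg True edge_verts[OF pv] by (simp add: leaves_def)
    moreover have "v \<noteq> r" using rb branch_root[OF pv] by auto
    ultimately have "v \<in> set xs" using xs by simp
    then obtain xs1 xs2 where "xs = xs1 @ v # xs2" by (meson split_list)
    moreover have "filter (\<lambda>x. x = v) zs = []" if "v \<notin> set zs" for zs using that by (induction zs) auto
    ultimately have f: "filter (\<lambda>x. x = v) xs = [v]" using xs(1) by simp
    have b: "branch p v = {v}" using beq True by simp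
    have "\<not> e \<subseteq> {v}" if "e \<in> edges T" for e
      using edge_pair[OF that] edge_verts that by blast
    then show ?thesis using b f deg True unfolding branch_tree_def by (intro exI[of _ "Nd v []"]) auto
  next
    case False
    have "set ys \<subseteq> (\<Union>c\<in>K. branch v c)"
    proof -
      have "card K > 0" using False finK by auto
      then have "v \<notin> leaves T" using deg by (simp add: leaves_def)
      then show ?thesis using xs(2) beq by (auto simp: ys_def)
    qed
    moreover have "convex_in ys (branch v c)" if "c \<in> K" for c
    proof (rule convex_in_subseq[OF conv])
      show "{v, c} \<in> edges T" using K that by simp
      show "r \<notin> branch v c" using rb beq that by blast
      show "subseq ys xs" by (simp add: ys_def)
    qed
    ultimately obtain cs where cs: "distinct cs" "set cs = K"
      "concat (map (\<lambda>c. filter (\<lambda>x. x \<in> branch v c) ys) cs) = ys"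
      using convex_blocks[of K ys "branch v"] disj finK by metis
    have ysf: "filter (\<lambda>x. x \<in> branch v c) ys = filter (\<lambda>x. x \<in> branch v c) xs" if "c \<in> K" for c
      unfolding ys_def filter_filter using beq that by (intro filter_cong) auto
    let ?t = "Nd v (map tf cs)"
    have lvt: "leaf_list ?t = ys"
    proof -
      have "map (\<lambda>c. filter (\<lambda>x. x \<in> branch v c) ys) cs = map (\<lambda>c. leaf_list (tf c)) cs"
        using cs(2) ysf tf(4) by simp
      then have "concat (map (\<lambda>c. leaf_list (tf c)) cs) = ys" using cs(3) by (simp only:)
      then show ?thesis using cs(2) False by (auto simp: comp_def)
    qed
    have vlt: "set (preorder ?t) = branch p v" using tf(2) cs(2) beq by auto
    have dist: "distinct (preorder ?t)"
    proof -
      have "distinct (concat (map (\<lambda>c. preorder (tf c)) ds))" if "distinct ds" "set ds \<subseteq> K" for ds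
        using that
      proof (induction ds)
        case (Cons d ds)
        then have "set (preorder (tf d)) \<inter> (\<Union>c\<in>set ds. set (preorder (tf c))) = {}"
          using tf(2) disj[of d] by (simp, blast)
        then show ?case using Cons tf(3) by auto
      qed simp
      then show ?thesis using cs vK tf(2) by (auto simp: comp_def)
    qed
    have arcs1: "{a, b} \<in> edges T" if "(a, b) \<in> arcs ?t" for a b
      using that cs(2) tf(1,5) K(1) by auto
    have arcs2: "e \<in> (\<lambda>(a, b). {a, b}) ` arcs ?t" if e: "e \<in> edges T" "e \<subseteq> branch p v" for e
    proof -
      obtain a b where ab: "e = {a, b}" using edge_pair e(1) by blast
      have root: ?thesis if "e = {v, c}" for c
      proof -
        have "c \<in> K" using that e branch_subset[of p v] by (auto simp: K_def nbrs_def)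
        then have "(v, c) \<in> arcs ?t" using cs(2) tf(1) by force
        then show ?thesis using that by force
      qed
      show ?thesis
      proof (cases "a = v \<or> b = v")
        case True then show ?thesis using root[of a] root[of b] ab by (auto simp: insert_commute)
      next
        case False
        then obtain c d where cd: "c \<in> K" "a \<in> branch v c" "d \<in> K" "b \<in> branch v d"
          using beq e(2) ab by auto
        have "b \<in> branch v c"
          using cd(2) reach_step[of "- {v}" c a b] e(1) ab False by (auto simp: branch_def)
        then have "e \<subseteq> branch v c" using cd ab by auto
        then have "e \<in> (\<lambda>(a, b). {a, b}) ` arcs (tf c)" using tf(6) cd(1) e(1) by blast
        then show ?thesis using cd(1) cs(2) by auto
      qed
    qed
    have degs: "Suc (length (subs u)) = vdegree T (rt u)" if "u \<in> subtrees ?t" for u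
      using that tf(7) cs deg distinct_card[OF cs(1)] by auto
    show ?thesis using lvt vlt dist arcs1 arcs2 degs unfolding ys_def branch_tree_def
      by (intro exI[of _ ?t]) (auto simp del: preorder.simps leaf_list.simps arcs.simps subtrees.simps)
  qed
qed

text \<open>A Halin graph without its drawing. The tree is rooted at the leaf \<open>r\<close>, whose only neighbour is the root
of \<open>t\<close>, so that each vertex of \<open>t\<close> has exactly one edge to its parent.\<close>
definition plane_rep :: "'a sgraph \<Rightarrow> nat \<Rightarrow> 'a \<Rightarrow> 'a plane_tree \<Rightarrow> bool" where
  "plane_rep G D r t \<longleftrightarrow> distinct (r # preorder t) \<and> verts G = set (r # preorder t) \<and>
     edges G = insert {r, rt t} ((\<lambda>(a, b). {a, b}) ` arcs t) \<union> cycle_edges (r # leaf_list t) \<and>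
     length (leaf_list t) \<ge> 2 \<and> subs t \<noteq> [] \<and>
     (\<forall>u\<in>subtrees t. subs u \<noteq> [] \<longrightarrow> 2 \<le> length (subs u) \<and> length (subs u) < D)"

lemma subseq_split3:
  assumes "subseq [x, z, w] xs"
  shows "\<exists>A B1 B2 D. xs = A @ x # (B1 @ z # B2) @ w # D"
proof -
  obtain A R where 1: "xs = A @ x # R" "subseq [z, w] R" using list_emb_ConsD[OF assms] by auto
  obtain B1 R2 where 2: "R = B1 @ z # R2" "subseq [w] R2" using list_emb_ConsD[OF 1(2)] by auto
  obtain B2 D where "R2 = B2 @ w # D" using list_emb_ConsD[OF 2(2)] by auto
  then show ?thesis using 1 2 by auto
qed

text \<open>For convexity: if the leaf \<open>z\<close> lay between the leaves \<open>x\<close>, \<open>w\<close> of a branch without belonging to it, then a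
path from \<open>x\<close> to \<open>w\<close> in the branch and a path from \<open>z\<close> to \<open>r\<close> in the complementary branch would be disjoint and cross.\<close>
theorem halin_plane_rep:
  assumes halin: "halin_graph G T C pos curve"
  shows "\<exists>r t. plane_rep G (max_degree G) r t"
proof -
  have plane: "plane_graph G pos curve" and G: "G = graph_union T C" and vC: "verts C = leaves T"
    and tree: "tree_graph T" and deg3: "\<And>v. v \<in> verts T \<Longrightarrow> vdegree T v = 1 \<or> vdegree T v \<ge> 3"
    and cyc: "cycle_graph C"
    using halin by (auto simp: halin_graph_def)
  interpret forest T using tree by unfold_locales (auto simp: tree_graph_def)
  have conn: "connected_graph T" using tree by (simp add: tree_graph_def)
  obtain q where q: "length q \<ge> 3" "distinct q" "verts C = set q" "edges C = cycle_edges q"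
    using cyc by (auto simp: cycle_graph_def)
  obtain r xs where qr: "q = r # xs" using q(1) by (cases q) auto
  have is_leaf: "leaves T = insert r (set xs)" "r \<notin> set xs" "distinct xs" using q vC qr by auto
  have lf1: "\<exists>c. nbrs v = {c}" if "v \<in> leaves T" for v
    using that by (simp add: leaves_def vdegree_nbrs card_1_singleton_iff)
  have inner: "\<not> e \<subseteq> leaves T" if e: "e \<in> edges T" for e
  proof
    assume sub: "e \<subseteq> leaves T"
    obtain x w where xw: "e = {x, w}" using edge_pair e by blast
    have E: "{x, w} \<in> edges T" "{w, x} \<in> edges T" using e xw by (auto simp: insert_commute)
    have "w \<in> nbrs x" "x \<in> nbrs w" using E by (auto simp: nbrs_def)
    then have "nbrs x = {w}" "nbrs w = {x}" using lf1[of x] lf1[of w] sub xw by auto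
    then have "branch x w = {w}" "branch w x = {x}" using branch_eq[OF E(1)] branch_eq[OF E(2)] by auto
    then have "verts T = {w, x}" using branch_complement(2)[OF conn E(1)] by auto
    then have "set q \<subseteq> {w, x}" using q(3) vC by (auto simp: leaves_def)
    then have "card (set q) \<le> card {w, x}" by (intro card_mono) auto
    also have "\<dots> \<le> 2" by (simp add: card_insert_if)
    finally show False using q(1,2) by (simp add: distinct_card)
  qed
  obtain s where s: "nbrs r = {s}" using lf1 is_leaf(1) by blast
  have rs: "{r, s} \<in> edges T" "{s, r} \<in> edges T" using s by (auto simp: nbrs_def insert_commute)
  have brs: "branch r s = verts T - {r}"
  proof -
    have "branch s r = {r}" using branch_eq[OF rs(2)] s by simp
    then show ?thesis using branch_complement[OF conn rs(1)] by auto
  qed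
  have conv: "convex_in xs (branch p v)" if pv: "{p, v} \<in> edges T" "r \<notin> branch p v" for p v
    unfolding convex_in_def
  proof (intro allI impI, elim conjE)
    fix x z w assume sub: "subseq [x, z, w] xs" and xb: "x \<in> branch p v" and wb: "w \<in> branch p v"
    show "z \<in> branch p v"
    proof (rule ccontr)
      assume zb: "z \<notin> branch p v"
      obtain A B1 B2 D where xs: "xs = A @ x # (B1 @ z # B2) @ w # D" using subseq_split3[OF sub] by blast
      have "z \<in> verts T" "r \<in> verts T" using is_leaf(1) xs by (auto simp: leaves_def)
      then have zr: "z \<in> branch v p" "r \<in> branch v p" using branch_complement[OF conn pv(1)] zb pv(2) by auto
      obtain P where P: "is_path T P" "set P \<subseteq> branch p v" "hd P = x" "last P = w"
        using path_in_branch[OF xb wb] by blast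
      obtain Q where Q: "is_path T Q" "set Q \<subseteq> branch v p" "hd Q = z" "last Q = r"
        using path_in_branch[OF zr] by blast
      show False
      proof (rule tree_paths_do_not_cross[OF halin _ _ _ inner P(1,3,4) Q(1,3,4)])
        show "distinct (r # A @ x # (B1 @ z # B2) @ w # D)" using q(2) unfolding qr xs .
        show "verts C = set (r # A @ x # (B1 @ z # B2) @ w # D)" using q(3) unfolding qr xs .
        show "edges C = cycle_edges (r # A @ x # (B1 @ z # B2) @ w # D)" using q(4) unfolding qr xs .
        show "z \<in> set (B1 @ z # B2)" by simp
        show "set P \<inter> set Q = {}" using P(2) Q(2) branch_complement(1)[OF conn pv(1)] by blast
      qed
    qed
  qed
  have "r \<notin> branch r s" using brs by simp
  from plane_rooted_branch[OF conn is_leaf(3) _ conv rs(1) this]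
  obtain t where "branch_tree xs r s t" using is_leaf by auto
  then have t: "rt t = s" "set (preorder t) = branch r s" "distinct (preorder t)"
    "leaf_list t = filter (\<lambda>x. x \<in> branch r s) xs" "\<forall>(a, b)\<in>arcs t. {a, b} \<in> edges T"
    "\<forall>e\<in>edges T. e \<subseteq> branch r s \<longrightarrow> e \<in> (\<lambda>(a, b). {a, b}) ` arcs t"
    "\<forall>u\<in>subtrees t. Suc (length (subs u)) = vdegree T (rt u)"
    unfolding branch_tree_def by auto
  have lvt: "leaf_list t = xs"
  proof -
    have "set xs \<subseteq> branch r s" using is_leaf brs by (auto simp: leaves_def)
    then show ?thesis using t(4) by (simp add: filter_id_conv subset_iff)
  qed
  have ET: "edges T = insert {r, s} ((\<lambda>(a, b). {a, b}) ` arcs t)"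
  proof
    show "insert {r, s} ((\<lambda>(a, b). {a, b}) ` arcs t) \<subseteq> edges T" using t(5) rs by auto
    show "edges T \<subseteq> insert {r, s} ((\<lambda>(a, b). {a, b}) ` arcs t)"
    proof
      fix e assume e: "e \<in> edges T"
      show "e \<in> insert {r, s} ((\<lambda>(a, b). {a, b}) ` arcs t)"
      proof (cases "r \<in> e")
        case True
        then obtain c where "e = {r, c}" using edge_pair[OF e] by (auto simp: insert_commute)
        then show ?thesis using e s by (auto simp: nbrs_def)
      next
        case False
        then have "e \<subseteq> branch r s" using e simple brs by (auto simp: simple_graph_def)
        then show ?thesis using t(6) e by blast
      qed
    qed
  qed
  have rtv: "rt u \<in> set (preorder t)" if "u \<in> subtrees t" for u
    using that by (induction t) auto
  have "2 \<le> length (subs u) \<and> length (subs u) < max_degree G" if u: "u \<in> subtrees t" "subs u \<noteq> []" for u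
  proof -
    have rv: "rt u \<in> verts T" using rtv[OF u(1)] t(2) brs by auto
    have d: "Suc (length (subs u)) = vdegree T (rt u)" using t(7) u by simp
    have "length (subs u) \<noteq> 0" using u by simp
    then have "length (subs u) \<ge> 2" using deg3[OF rv] d by linarith
    have "finite (edges G)" "finite (verts G)"
      using plane finite_edges[of G] by (auto simp: plane_graph_def simple_graph_def)
    then have "vdegree T (rt u) \<le> vdegree G (rt u)" unfolding vdegree_def
      using G by (intro card_mono) (auto simp: graph_union_def)
    also have "\<dots> \<le> max_degree G" unfolding max_degree_def
      using \<open>finite (verts G)\<close> rv G by (intro Max_ge) (auto simp: graph_union_def)
    finally show ?thesis using d \<open>length (subs u) \<ge> 2\<close> by simp
  qed
  moreover have "subs t \<noteq> []"
  proof
    assume e: "subs t = []"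
    have "length xs \<ge> 2" using q(1) qr by simp
    moreover have "length (leaf_list t) = 1" using e by (cases t) auto
    ultimately show False using lvt by simp
  qed
  moreover have "verts G = set (r # preorder t)"
  proof -
    have "r \<in> verts T" using edge_verts[OF rs(1)] by simp
    then show ?thesis using t(2) brs G vC by (auto simp: graph_union_def leaves_def)
  qed
  moreover have "edges G = insert {r, rt t} ((\<lambda>(a, b). {a, b}) ` arcs t) \<union> cycle_edges (r # leaf_list t)"
    using G ET q(4) qr lvt t(1) by (simp add: graph_union_def)
  ultimately have "plane_rep G (max_degree G) r t"
    using t(2,3) brs q(1) qr lvt by (auto simp: plane_rep_def)
  then show ?thesis by blast
qed

section \<open>Edge colourings of a tree with a ring through its leaves\<close>

lemma cycle_edges_nth:
  assumes "q \<noteq> []"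
  shows "cycle_edges q = (\<lambda>i. {q ! i, q ! (Suc i mod length q)}) ` {..<length q}" (is "_ = ?R")
proof -
  define n where "n = length q"
  have n: "n > 0" using assms by (simp add: n_def)
  have "{..<n} = insert (n - 1) {i. Suc i < n}" using n by auto
  moreover have "q ! (n - 1) = last q" "q ! 0 = hd q" using assms by (simp_all add: n_def last_conv_nth hd_conv_nth)
  moreover have "path_edges q = (\<lambda>i. {q ! i, q ! (Suc i mod n)}) ` {i. Suc i < n}"
    by (auto simp: path_edges_def n_def)
  ultimately show ?thesis using n unfolding cycle_edges_def n_def[symmetric] by simp
qed

lemma roots_of_subtrees: "rt ` subtrees t = set (preorder t)"
proof (induction t)
  case (Nd v ts)
  have "rt ` (\<Union>s\<in>set ts. subtrees s) = (\<Union>s\<in>set ts. set (preorder s))"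
    unfolding image_UN using Nd by simp
  then show ?case by simp
qed

lemma root_in_preorder: "u \<in> subtrees t \<Longrightarrow> rt u \<in> set (preorder t)"
  by (auto simp flip: roots_of_subtrees)

lemma self_subtree: "t \<in> subtrees t"
  by (cases t) auto

lemma child_subtree: "u \<in> subtrees t \<Longrightarrow> s \<in> set (subs u) \<Longrightarrow> s \<in> subtrees t"
proof (induction t)
  case (Nd v ts)
  then consider "u = Nd v ts" | w where "w \<in> set ts" "u \<in> subtrees w" by auto
  then show ?case
  proof cases
    case 1
    then show ?thesis using Nd(3) self_subtree[of s] by auto
  next
    case 2
    then show ?thesis using Nd(1)[of w] Nd(3) by auto
  qed
qed

lemma arcs_via_subtrees: "arcs t = {(rt u, rt s) |u s. u \<in> subtrees t \<and> s \<in> set (subs u)}"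
proof (induction t)
  case (Nd v ts)
  have "arcs (Nd v ts) = {(v, rt s) |s. s \<in> set ts} \<union> (\<Union>w\<in>set ts. {(rt u, rt s) |u s. u \<in> subtrees w \<and> s \<in> set (subs u)})"
    using Nd by auto
  also have "\<dots> = {(rt u, rt s) |u s. u \<in> subtrees (Nd v ts) \<and> s \<in> set (subs u)}"
  proof (intro equalityI subsetI)
    fix x assume "x \<in> {(v, rt s) |s. s \<in> set ts} \<union> (\<Union>w\<in>set ts. {(rt u, rt s) |u s. u \<in> subtrees w \<and> s \<in> set (subs u)})"
    then consider s where "x = (v, rt s)" "s \<in> set ts"
      | w u s where "w \<in> set ts" "x = (rt u, rt s)" "u \<in> subtrees w" "s \<in> set (subs u)" by blast
    then show "x \<in> {(rt u, rt s) |u s. u \<in> subtrees (Nd v ts) \<and> s \<in> set (subs u)}"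
    proof cases
      case 1
      then show ?thesis by (intro CollectI exI[of _ "Nd v ts"] exI[of _ s]) simp
    next
      case 2
      then show ?thesis by (intro CollectI exI[of _ u] exI[of _ s]) auto
    qed
  next
    fix x assume "x \<in> {(rt u, rt s) |u s. u \<in> subtrees (Nd v ts) \<and> s \<in> set (subs u)}"
    then obtain u s where u: "x = (rt u, rt s)" "u \<in> subtrees (Nd v ts)" "s \<in> set (subs u)" by blast
    from u(2) consider "u = Nd v ts" | w where "w \<in> set ts" "u \<in> subtrees w" by auto
    then show "x \<in> {(v, rt s) |s. s \<in> set ts} \<union> (\<Union>w\<in>set ts. {(rt u, rt s) |u s. u \<in> subtrees w \<and> s \<in> set (subs u)})"
      using u by cases auto
  qed
  finally show ?case .
qed

lemma distinct_concat_map: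
  assumes "distinct (concat (map g ts))" "s \<in> set ts" "s' \<in> set ts" "x \<in> set (g s)" "x \<in> set (g s')"
  shows "s = s'"
  using assms by (induction ts) auto

lemma distinct_preorder_child: "distinct (preorder (Nd v ts)) \<Longrightarrow> s \<in> set ts \<Longrightarrow> distinct (preorder s)"
  by (induction ts) auto

lemma inj_rt: "distinct (preorder t) \<Longrightarrow> inj_on rt (subtrees t)"
proof (induction t)
  case (Nd v ts)
  show ?case
  proof (rule inj_onI)
    fix a b assume ab: "a \<in> subtrees (Nd v ts)" "b \<in> subtrees (Nd v ts)" "rt a = rt b"
    have v: "v \<notin> set (preorder s)" if "s \<in> set ts" for s using Nd(2) that by auto
    have r: "rt c \<in> set (preorder s)" if "c \<in> subtrees s" for c s using that by (rule root_in_preorder)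
    show "a = b"
    proof (cases "a = Nd v ts \<or> b = Nd v ts")
      case True
      have "x = Nd v ts" if "x \<in> subtrees (Nd v ts)" "rt x = v" for x
        using that v r by (metis UN_E insertE subtrees.simps)
      then show ?thesis using ab True by (metis plane_tree.sel(1))
    next
      case False
      then obtain s s' where s: "s \<in> set ts" "a \<in> subtrees s" "s' \<in> set ts" "b \<in> subtrees s'" using ab by auto
      then have "s = s'" using distinct_concat_map[of preorder ts s s' "rt a"] Nd(2) r[of a s] r[of b s'] ab(3) by auto
      then show ?thesis using Nd(1)[OF s(1)] distinct_preorder_child[OF Nd(2) s(1)] s ab(3)
        by (auto dest: inj_onD)
    qed
  qed
qed

lemma size_subtree: "u \<in> subtrees t \<Longrightarrow> size u \<le> size t"
proof (induction t)
  case (Nd v ts)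
  then consider "u = Nd v ts" | s where "s \<in> set ts" "u \<in> subtrees s" by auto
  then show ?case
  proof cases
    case 2
    then have "size u \<le> size s" "size s \<le> size_list size ts" using Nd by (auto simp: size_list_estimation')
    then show ?thesis by simp
  qed simp
qed

lemma size_child: "s \<in> set (subs u) \<Longrightarrow> size s < size u"
  by (cases u) (use size_list_estimation'[of s _ "size s" size] in \<open>force simp: less_Suc_eq_le\<close>)

lemma unique_parent:
  assumes "distinct (preorder t)" "u \<in> subtrees t" "u' \<in> subtrees t" "s \<in> set (subs u)" "s \<in> set (subs u')"
  shows "u = u'"
  using assms
proof (induction t arbitrary: u u')
  case (Nd v ts)
  have rs: "rt s \<in> set (preorder x)" if "s \<in> subtrees x" for x using that by (rule root_in_preorder)
  have key: False if "w \<in> set ts" "x \<in> subtrees w" "s \<in> set (subs x)" "s \<in> set ts" for w x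
  proof -
    have "s \<in> subtrees w" using child_subtree[OF that(2,3)] .
    then have "w = s" using distinct_concat_map[of preorder ts w s "rt s"] Nd(2) that rs[of w] rs[of s] self_subtree by auto
    then show False using that size_subtree[of x w] size_child[of s x] by simp
  qed
  show ?case
  proof (cases "u = Nd v ts \<or> u' = Nd v ts")
    case True
    have "x = Nd v ts" if "x \<in> subtrees (Nd v ts)" "s \<in> set (subs x)" "s \<in> set ts" for x
      using that key by (metis UN_E insertE subtrees.simps)
    then show ?thesis using Nd(3-6) True by (metis plane_tree.sel(2))
  next
    case False
    then obtain w w' where w: "w \<in> set ts" "u \<in> subtrees w" "w' \<in> set ts" "u' \<in> subtrees w'" using Nd(3,4) by auto
    then have "s \<in> subtrees w" "s \<in> subtrees w'" using Nd(5,6) by (auto intro: child_subtree)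
    then have "w = w'" using distinct_concat_map[of preorder ts w w' "rt s"] Nd(2) w rs[of w] rs[of w'] by simp
    then show ?thesis using Nd(1)[of w u u'] distinct_preorder_child[OF Nd(2) w(1)] w Nd(5,6) by simp
  qed
qed

lemma set_leaf_list: "set (leaf_list t) = {rt u |u. u \<in> subtrees t \<and> subs u = []}"
proof (induction t)
  case (Nd v ts)
  show ?case
  proof (cases "ts = []")
    case False
    then have "set (leaf_list (Nd v ts)) = (\<Union>s\<in>set ts. {rt u |u. u \<in> subtrees s \<and> subs u = []})" using Nd by auto
    also have "\<dots> = {rt u |u. u \<in> subtrees (Nd v ts) \<and> subs u = []}" using False by auto
    finally show ?thesis .
  qed auto
qed

lemma subseq_leaf_list_preorder: "subseq (leaf_list t) (preorder t)"
proof (induction t)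
  case (Nd v ts)
  have "subseq (concat (map leaf_list ts)) (concat (map preorder ts))"
    using Nd by (induction ts) (auto intro: list_emb_append_mono)
  then show ?case by (auto intro: subseq_Cons')
qed

lemma distinct_leaf_list: "distinct (preorder t) \<Longrightarrow> distinct (leaf_list t)"
  using subseq_leaf_list_preorder[of t] by (metis subseq_conv_nths distinct_nthsI)

text \<open>A colouring \<open>\<kappa>\<close> of the tree edges is a function on vertices: \<open>\<kappa> v\<close> is the colour of the edge from
\<open>v\<close> to its parent.\<close>
definition tree_colors :: "('a \<Rightarrow> nat) \<Rightarrow> 'a plane_tree \<Rightarrow> nat set" where
  "tree_colors \<kappa> u = insert (\<kappa> (rt u)) ((\<lambda>s. \<kappa> (rt s)) ` set (subs u))"

text \<open>All colours at the vertex of \<open>u\<close>, where \<open>E\<close> supplies those of the rim edges.\<close>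
definition all_colors :: "('a \<Rightarrow> nat) \<Rightarrow> ('a \<Rightarrow> nat set) \<Rightarrow> 'a plane_tree \<Rightarrow> nat set" where
  "all_colors \<kappa> E u = tree_colors \<kappa> u \<union> (if subs u = [] then E (rt u) else {})"

text \<open>The pair criterion at one vertex, with the pairs parent-child and child-child; \<open>P\<close> is the set of
colours at the parent.\<close>
definition star_colored_at :: "('a \<Rightarrow> nat) \<Rightarrow> ('a \<Rightarrow> nat set) \<Rightarrow> nat set \<Rightarrow> 'a plane_tree \<Rightarrow> bool" where
  "star_colored_at \<kappa> E P u \<longleftrightarrow> distinct (\<kappa> (rt u) # map (\<kappa> \<circ> rt) (subs u)) \<and>
     (\<forall>s\<in>set (subs u). \<not> (\<kappa> (rt s) \<in> P \<and> \<kappa> (rt u) \<in> all_colors \<kappa> E s)) \<and>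
     (\<forall>s\<in>set (subs u). \<forall>s'\<in>set (subs u). s \<noteq> s' \<longrightarrow> \<not> (\<kappa> (rt s') \<in> all_colors \<kappa> E s \<and> \<kappa> (rt s) \<in> all_colors \<kappa> E s'))"

fun star_colored :: "('a \<Rightarrow> nat) \<Rightarrow> ('a \<Rightarrow> nat set) \<Rightarrow> nat set \<Rightarrow> 'a plane_tree \<Rightarrow> bool" where
  "star_colored \<kappa> E P (Nd v ts) \<longleftrightarrow> star_colored_at \<kappa> E P (Nd v ts) \<and> (\<forall>s\<in>set ts. star_colored \<kappa> E (all_colors \<kappa> E (Nd v ts)) s)"

lemma star_colored_subtree:
  "star_colored \<kappa> E P t \<Longrightarrow> u \<in> subtrees t \<Longrightarrow> s \<in> set (subs u) \<Longrightarrow> star_colored_at \<kappa> E (all_colors \<kappa> E u) s"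
proof (induction t arbitrary: P)
  case (Nd v ts)
  have root: "star_colored \<kappa> E Q s \<Longrightarrow> star_colored_at \<kappa> E Q s" for Q s by (cases s) auto
  from Nd(3) consider "u = Nd v ts" | w where "w \<in> set ts" "u \<in> subtrees w" by auto
  then show ?case using Nd root by cases auto
qed

locale ring_tree =
  fixes G :: "'a sgraph" and D r t
  assumes rep: "plane_rep G D r t"
begin

definition "q = r # leaf_list t"
definition "n = length q"
definition "par_arcs = insert (r, rt t) (arcs t)"

text \<open>The colour of the tree edge at the leaf \<open>q ! i\<close>. Only for \<open>i = 0\<close>, the leaf \<open>r\<close>, does this edge lead
downwards.\<close>
definition leaf_color :: "('a \<Rightarrow> nat) \<Rightarrow> nat \<Rightarrow> nat" where
  "leaf_color \<kappa> i = (if i = 0 then \<kappa> (rt t) else \<kappa> (q ! i))"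

text \<open>Successor and predecessor on the rim; the rim edge \<open>i\<close> joins \<open>q ! i\<close> and \<open>q ! nx i\<close>.\<close>
definition nx :: "nat \<Rightarrow> nat" where "nx i = Suc i mod n"
definition pv :: "nat \<Rightarrow> nat" where "pv i = (i + n - 1) mod n"

text \<open>The vertex of \<open>u\<close> is the tree neighbour of the leaf \<open>v\<close>.\<close>
definition attached :: "'a plane_tree \<Rightarrow> 'a \<Rightarrow> bool" where
  "attached u v \<longleftrightarrow> u = t \<and> v = r \<or> u \<in> subtrees t \<and> Nd v [] \<in> set (subs u)"

definition edge_color :: "('a \<Rightarrow> nat) \<Rightarrow> (nat \<Rightarrow> nat) \<Rightarrow> 'a set \<Rightarrow> nat" where
  "edge_color \<kappa> \<epsilon> e = (if \<exists>p v. (p, v) \<in> par_arcs \<and> e = {p, v}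
     then \<kappa> (SOME v. \<exists>p. (p, v) \<in> par_arcs \<and> e = {p, v})
     else \<epsilon> (SOME i. i < n \<and> e = {q ! i, q ! nx i}))"

definition rim :: "(nat \<Rightarrow> nat) \<Rightarrow> 'a \<Rightarrow> nat set" where
  "rim \<epsilon> v = {\<epsilon> i |i. i < n \<and> (v = q ! i \<or> v = q ! nx i)}"

lemma dist: "distinct (preorder t)" "r \<notin> set (preorder t)" "distinct q" "n \<ge> 3" "subs t \<noteq> []"
  using rep distinct_leaf_list[of t] set_leaf_list[of t] roots_of_subtrees[of t]
  unfolding plane_rep_def q_def n_def by auto

lemma edges_G: "edges G = (\<lambda>(a, b). {a, b}) ` par_arcs \<union> (\<lambda>i. {q ! i, q ! nx i}) ` {..<n}"
  using rep cycle_edges_nth[of q] unfolding plane_rep_def par_arcs_def q_def n_def nx_def by auto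

lemma nx_pv: "i < n \<Longrightarrow> nx i < n" "i < n \<Longrightarrow> pv i < n" "i < n \<Longrightarrow> nx (pv i) = i" "i < n \<Longrightarrow> pv (nx i) = i"
  "i < n \<Longrightarrow> nx i \<noteq> i" "i < n \<Longrightarrow> pv i \<noteq> i" "i < n \<Longrightarrow> nx i \<noteq> pv i"
proof -
  have n: "n \<ge> 3" using dist by simp
  have pv: "pv i = (if i = 0 then n - 1 else i - 1)" if "i < n" for i
    using n that by (cases i) (auto simp: pv_def)
  have nx: "nx i = (if Suc i = n then 0 else Suc i)" if "i < n" for i
    using n that by (auto simp: nx_def)
  show "i < n \<Longrightarrow> nx i < n" "i < n \<Longrightarrow> pv i < n" using n by (auto simp: nx pv)
  show "i < n \<Longrightarrow> nx (pv i) = i" "i < n \<Longrightarrow> pv (nx i) = i"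
    "i < n \<Longrightarrow> nx i \<noteq> i" "i < n \<Longrightarrow> pv i \<noteq> i" "i < n \<Longrightarrow> nx i \<noteq> pv i"
    using n by (auto simp: nx pv split: if_splits)
qed

lemma q_inj: "i < n \<Longrightarrow> j < n \<Longrightarrow> q ! i = q ! j \<longleftrightarrow> i = j"
  using dist by (simp add: n_def nth_eq_iff_index_eq)

lemma par_arcs_iff: "(p, v) \<in> par_arcs \<longleftrightarrow> p = r \<and> v = rt t \<or> (\<exists>u s. u \<in> subtrees t \<and> s \<in> set (subs u) \<and> p = rt u \<and> v = rt s)"
  unfolding par_arcs_def arcs_via_subtrees by auto

lemma rt_in: "u \<in> subtrees t \<Longrightarrow> rt u \<in> set (preorder t)" "u \<in> subtrees t \<Longrightarrow> rt u \<noteq> r"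
  using root_in_preorder dist(2) by auto

lemma rt_eq: "u \<in> subtrees t \<Longrightarrow> u' \<in> subtrees t \<Longrightarrow> rt u = rt u' \<longleftrightarrow> u = u'"
  using inj_rt[OF dist(1)] by (auto dest: inj_onD)

lemma child_not_root: "u \<in> subtrees t \<Longrightarrow> s \<in> set (subs u) \<Longrightarrow> s \<noteq> t"
  using size_subtree size_child by (metis leD)

lemma par_arcs_fun:
  assumes "(p, v) \<in> par_arcs" "(p', v) \<in> par_arcs" shows "p = p'"
proof -
  have 1: "rt s \<noteq> rt t" if "u \<in> subtrees t" "s \<in> set (subs u)" for u s
    using that child_not_root child_subtree rt_eq self_subtree by metis
  have 2: "rt u = rt u'" if "u \<in> subtrees t" "s \<in> set (subs u)" "u' \<in> subtrees t" "s' \<in> set (subs u')" "rt s = rt s'" for u s u' s'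
    using that unique_parent[OF dist(1), of u u' s] rt_eq child_subtree by metis
  show ?thesis using assms 1 2 unfolding par_arcs_iff by metis
qed

lemma par_arcs_acyclic: "(p, v) \<in> par_arcs \<Longrightarrow> (v, p) \<notin> par_arcs"
proof
  assume a: "(p, v) \<in> par_arcs" "(v, p) \<in> par_arcs"
  have v: "v \<noteq> r \<and> p \<noteq> r" using a rt_in child_subtree self_subtree unfolding par_arcs_iff by metis
  then obtain u s u' s' where u: "u \<in> subtrees t" "s \<in> set (subs u)" "p = rt u" "v = rt s"
    "u' \<in> subtrees t" "s' \<in> set (subs u')" "v = rt u'" "p = rt s'" using a unfolding par_arcs_iff by auto
  then have "s = u'" "s' = u" using rt_eq child_subtree by metis+
  then show False using size_child[of s u] size_child[of s' u'] u by simp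
qed

lemma edge_color_arc: "(p, v) \<in> par_arcs \<Longrightarrow> edge_color \<kappa> \<epsilon> {p, v} = \<kappa> v"
proof -
  assume a: "(p, v) \<in> par_arcs"
  have "(SOME w. \<exists>p'. (p', w) \<in> par_arcs \<and> {p, v} = {p', w}) = v"
    using a par_arcs_acyclic by (intro some_equality) (auto simp: doubleton_eq_iff)
  then show ?thesis using a unfolding edge_color_def by auto
qed

lemma q_leaf: "i < n \<Longrightarrow> q ! i = r \<or> (\<exists>u\<in>subtrees t. subs u = [] \<and> rt u = q ! i)"
  unfolding q_def n_def using set_leaf_list[of t] nth_mem[of "i - 1" "leaf_list t"] by (cases i) auto

lemma leaf_in_q: "u \<in> subtrees t \<Longrightarrow> subs u = [] \<Longrightarrow> \<exists>i<n. i \<noteq> 0 \<and> q ! i = rt u"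
proof -
  assume "u \<in> subtrees t" "subs u = []"
  then have "rt u \<in> set (leaf_list t)" by (auto simp: set_leaf_list)
  then obtain j where "j < length (leaf_list t)" "leaf_list t ! j = rt u" by (meson in_set_conv_nth)
  then show ?thesis by (intro exI[of _ "Suc j"]) (auto simp: q_def n_def)
qed

lemma rim_not_arc:
  assumes "i < n" "j < n" "i \<noteq> j" shows "(q ! i, q ! j) \<notin> par_arcs"
proof
  assume a: "(q ! i, q ! j) \<in> par_arcs"
  consider "q ! i = r" | u where "u \<in> subtrees t" "subs u = []" "rt u = q ! i" using q_leaf[OF assms(1)] by blast
  then show False
  proof cases
    case 1
    then have "q ! j = rt t" using a rt_in(2) unfolding par_arcs_iff by metis
    then obtain u where "u \<in> subtrees t" "subs u = []" "rt u = rt t" using q_leaf[OF assms(2)] rt_in(2) self_subtree by metis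
    then show False using rt_eq self_subtree dist(5) by metis
  next
    case 2
    then obtain u' s where "u' \<in> subtrees t" "s \<in> set (subs u')" "rt u' = q ! i" using a rt_in(2) unfolding par_arcs_iff by metis
    moreover then have "u' = u" using 2 rt_eq[of u' u] by simp
    ultimately show False using 2 by simp
  qed
qed

lemma edge_color_rim: "i < n \<Longrightarrow> edge_color \<kappa> \<epsilon> {q ! i, q ! nx i} = \<epsilon> i"
proof -
  assume i: "i < n"
  have "\<not> (\<exists>p v. (p, v) \<in> par_arcs \<and> {q ! i, q ! nx i} = {p, v})"
    using rim_not_arc[of i "nx i"] rim_not_arc[of "nx i" i] nx_pv(1,5)[OF i] i
    by (simp add: doubleton_eq_iff) metis
  moreover have "(SOME j. j < n \<and> {q ! i, q ! nx i} = {q ! j, q ! nx j}) = i"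
  proof (rule some_equality)
    fix j assume j: "j < n \<and> {q ! i, q ! nx i} = {q ! j, q ! nx j}"
    then have "i = j \<and> nx i = nx j \<or> i = nx j \<and> nx i = j"
      using q_inj i nx_pv by (auto simp: doubleton_eq_iff)
    then show "j = i" using nx_pv i j by metis
  qed (use i in auto)
  ultimately show ?thesis unfolding edge_color_def by auto
qed

end

context ring_tree
begin

lemma arc_at_inner:
  assumes "u \<in> subtrees t" "{rt u, b} \<in> edges G" "subs u \<noteq> []"
  shows "(b, rt u) \<in> par_arcs \<or> (\<exists>s\<in>set (subs u). b = rt s)"
proof -
  have nq: "rt u \<noteq> q ! i" if "i < n" for i
    using q_leaf[OF that] assms(1,3) rt_in(2) rt_eq by metis
  then have "{rt u, b} \<noteq> {q ! i, q ! nx i}" if "i < n" for i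
    using that nx_pv(1)[OF that] by (metis doubleton_eq_iff)
  then obtain p v where pv: "(p, v) \<in> par_arcs" "{rt u, b} = {p, v}"
    using assms(2) unfolding edges_G by force
  then consider "p = b" "v = rt u" | "p = rt u" "v = b" by (auto simp: doubleton_eq_iff)
  then show ?thesis
  proof cases
    case 2
    then obtain u' s where u': "u' \<in> subtrees t" "s \<in> set (subs u')" "rt u = rt u'" "b = rt s"
      using pv rt_in(2)[OF assms(1)] unfolding par_arcs_iff by auto
    then have "u' = u" using rt_eq[OF assms(1) u'(1)] by simp
    then show ?thesis using u' by auto
  qed (use pv in simp)
qed

lemma node_cases: "u \<in> subtrees t \<Longrightarrow> u = t \<or> (\<exists>p\<in>subtrees t. u \<in> set (subs p))"
proof -
  have "u = w \<or> (\<exists>p\<in>subtrees w. u \<in> set (subs p))" if "u \<in> subtrees w" for w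
    using that
  proof (induction w)
    case (Nd v ts)
    then consider "u = Nd v ts" | x where "x \<in> set ts" "u \<in> subtrees x" by auto
    then show ?case
    proof cases
      case 2
      then show ?thesis using Nd(1)[of x] by auto
    qed simp
  qed
  then show "u \<in> subtrees t \<Longrightarrow> ?thesis" by blast
qed

lemma colors_at_node:
  assumes "u \<in> subtrees t"
  shows "colors_at G (edge_color \<kappa> \<epsilon>) (rt u) = all_colors \<kappa> (rim \<epsilon>) u"
proof (intro equalityI subsetI)
  fix k assume "k \<in> colors_at G (edge_color \<kappa> \<epsilon>) (rt u)"
  then obtain e where e: "e \<in> edges G" "rt u \<in> e" "k = edge_color \<kappa> \<epsilon> e" by (auto simp: colors_at_def)
  from e(1) consider p v where "(p, v) \<in> par_arcs" "e = {p, v}" | i where "i < n" "e = {q ! i, q ! nx i}"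
    unfolding edges_G by auto
  then show "k \<in> all_colors \<kappa> (rim \<epsilon>) u"
  proof cases
    case 1
    then have k: "k = \<kappa> v" using e edge_color_arc by simp
    show ?thesis
    proof (cases "v = rt u")
      case True then show ?thesis using k by (simp add: all_colors_def tree_colors_def)
    next
      case False
      then have "p = rt u" using e(2) 1 by auto
      then obtain u' s where u': "u' \<in> subtrees t" "s \<in> set (subs u')" "rt u = rt u'" "v = rt s"
        using 1 rt_in(2)[OF assms] unfolding par_arcs_iff by auto
      then have "u' = u" using rt_eq[OF assms u'(1)] by simp
      then show ?thesis using u' k by (auto simp: all_colors_def tree_colors_def)
    qed
  next
    case 2
    then have k: "k = \<epsilon> i" using e edge_color_rim by simp
    have "rt u = q ! i \<or> rt u = q ! nx i" using 2 e(2) by auto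
    then obtain j where "j < n" "rt u = q ! j" using 2 nx_pv(1) by blast
    then have "subs u = []" using q_leaf[of j] rt_in(2)[OF assms] rt_eq[OF assms] by metis
    then show ?thesis using k 2 \<open>rt u = q ! i \<or> rt u = q ! nx i\<close> by (auto simp: all_colors_def rim_def)
  qed
next
  fix k assume k: "k \<in> all_colors \<kappa> (rim \<epsilon>) u"
  have arc: "\<kappa> v \<in> colors_at G (edge_color \<kappa> \<epsilon>) x" if "(p, v) \<in> par_arcs" "x = p \<or> x = v" for p v x
  proof -
    have "{p, v} \<in> edges G" using that(1) unfolding edges_G by force
    then have "{p, v} \<in> {e \<in> edges G. x \<in> e}" using that(2) by auto
    then show ?thesis unfolding colors_at_def by (rule rev_image_eqI) (simp add: edge_color_arc[OF that(1)])
  qed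
  from k consider "k = \<kappa> (rt u)" | s where "s \<in> set (subs u)" "k = \<kappa> (rt s)"
    | i where "i < n" "rt u = q ! i \<or> rt u = q ! nx i" "k = \<epsilon> i"
    by (auto simp: all_colors_def tree_colors_def rim_def split: if_splits)
  then show "k \<in> colors_at G (edge_color \<kappa> \<epsilon>) (rt u)"
  proof cases
    case 1
    have "\<exists>p. (p, rt u) \<in> par_arcs"
    proof (cases "u = t")
      case False
      then obtain p where "p \<in> subtrees t" "u \<in> set (subs p)" using node_cases[OF assms] by blast
      then show ?thesis unfolding par_arcs_iff by blast
    qed (auto simp: par_arcs_def)
    then show ?thesis using arc 1 by blast
  next
    case 2
    then have "(rt u, rt s) \<in> par_arcs" using assms unfolding par_arcs_iff by blast
    then show ?thesis using arc 2 by blast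
  next
    case 3
    then have "{q ! i, q ! nx i} \<in> {e \<in> edges G. rt u \<in> e}" unfolding edges_G by auto
    then show ?thesis unfolding colors_at_def by (rule rev_image_eqI) (simp add: edge_color_rim[OF 3(1)] 3(3))
  qed
qed

lemma q0: "q ! 0 = r" "0 < n"
  by (simp_all add: q_def n_def)

lemma rim_leaf: "i < n \<Longrightarrow> rim \<epsilon> (q ! i) = {\<epsilon> i, \<epsilon> (pv i)}"
proof -
  assume i: "i < n"
  have "j = i \<or> j = pv i" if "j < n" "q ! i = q ! j \<or> q ! i = q ! nx j" for j
    using that q_inj[of i j] q_inj[of i "nx j"] nx_pv(1,4)[OF that(1)] i by auto
  moreover have "q ! i = q ! nx (pv i)" "pv i < n" using nx_pv[OF i] by auto
  ultimately show ?thesis unfolding rim_def using i by auto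
qed

lemma colors_at_root: "colors_at G (edge_color \<kappa> \<epsilon>) r = insert (\<kappa> (rt t)) (rim \<epsilon> r)"
proof (intro equalityI subsetI)
  fix k assume "k \<in> colors_at G (edge_color \<kappa> \<epsilon>) r"
  then obtain e where e: "e \<in> edges G" "r \<in> e" "k = edge_color \<kappa> \<epsilon> e" by (auto simp: colors_at_def)
  from e(1) consider p v where "(p, v) \<in> par_arcs" "e = {p, v}" | i where "i < n" "e = {q ! i, q ! nx i}"
    unfolding edges_G by auto
  then show "k \<in> insert (\<kappa> (rt t)) (rim \<epsilon> r)"
  proof cases
    case 1
    then have "v = rt t" using e(2) rt_in(2) child_subtree self_subtree unfolding par_arcs_iff by blast
    then show ?thesis using 1 e edge_color_arc by simp
  next
    case 2 then show ?thesis using e edge_color_rim[OF 2(1)] by (auto simp: rim_def)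
  qed
next
  fix k assume "k \<in> insert (\<kappa> (rt t)) (rim \<epsilon> r)"
  then consider "k = \<kappa> (rt t)" | i where "i < n" "r = q ! i \<or> r = q ! nx i" "k = \<epsilon> i"
    by (auto simp: rim_def)
  then show "k \<in> colors_at G (edge_color \<kappa> \<epsilon>) r"
  proof cases
    case 1
    have a: "(r, rt t) \<in> par_arcs" by (simp add: par_arcs_def)
    then have "{r, rt t} \<in> {e \<in> edges G. r \<in> e}" unfolding edges_G by force
    then show ?thesis unfolding colors_at_def by (rule rev_image_eqI) (simp add: edge_color_arc[OF a] 1)
  next
    case 2
    then have "{q ! i, q ! nx i} \<in> {e \<in> edges G. r \<in> e}" unfolding edges_G by auto
    then show ?thesis unfolding colors_at_def by (rule rev_image_eqI) (simp add: edge_color_rim[OF 2(1)] 2(3))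
  qed
qed

lemma colors_at_leaf:
  assumes i: "i < n"
  shows "colors_at G (edge_color \<kappa> \<epsilon>) (q ! i) = {leaf_color \<kappa> i, \<epsilon> i, \<epsilon> (pv i)}"
proof (cases "i = 0")
  case True
  then show ?thesis using colors_at_root rim_leaf[OF i] by (simp add: q0 leaf_color_def)
next
  case False
  then have "q ! i \<noteq> r" using q_inj[OF i q0(2)] q0(1) by simp
  then obtain u where u: "u \<in> subtrees t" "subs u = []" "rt u = q ! i" using q_leaf[OF i] by blast
  then show ?thesis using colors_at_node[OF u(1)] rim_leaf[OF i] False
    by (simp add: all_colors_def tree_colors_def leaf_color_def insert_commute)
qed

lemma edge_at_leaf:
  assumes i: "i < n" and e: "{q ! i, b} \<in> edges G"
  shows "(\<exists>u\<in>subtrees t. subs u \<noteq> [] \<and> attached u (q ! i) \<and> b = rt u \<and> edge_color \<kappa> \<epsilon> {q ! i, b} = leaf_color \<kappa> i)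
    \<or> b = q ! nx i \<or> b = q ! pv i"
proof -
  from e consider p v where "(p, v) \<in> par_arcs" "{q ! i, b} = {p, v}" | j where "j < n" "{q ! i, b} = {q ! j, q ! nx j}"
    unfolding edges_G by auto
  then show ?thesis
  proof cases
    case 1
    show ?thesis
    proof (cases "i = 0")
      case True
      then have r: "q ! i = r" by (simp add: q0)
      then have "v \<noteq> r" using 1(1) rt_in(2) child_subtree self_subtree unfolding par_arcs_iff by metis
      then have "p = r" "v = b" using 1(2) r by (auto simp: doubleton_eq_iff)
      then have "b = rt t" using 1(1) rt_in(2) unfolding par_arcs_iff by metis
      then show ?thesis using 1 r True dist(5) self_subtree edge_color_arc[OF 1(1)] \<open>v = b\<close>
        by (intro disjI1 bexI[of _ t]) (auto simp: attached_def leaf_color_def)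
    next
      case False
      then have nr: "q ! i \<noteq> r" using q_inj[OF i q0(2)] q0(1) by simp
      then obtain l where l: "l \<in> subtrees t" "subs l = []" "rt l = q ! i" using q_leaf[OF i] by blast
      have "q ! i \<noteq> p"
      proof
        assume "q ! i = p"
        then obtain u s where "u \<in> subtrees t" "s \<in> set (subs u)" "rt u = rt l"
          using 1(1) nr l(3) unfolding par_arcs_iff by metis
        then have "u = l" using rt_eq l(1) by metis
        then show False using \<open>s \<in> set (subs u)\<close> l(2) by simp
      qed
      then have pv': "q ! i = v" "b = p" using 1(2) by (auto simp: doubleton_eq_iff)
      have "l \<noteq> t" using l(2) dist(5) by auto
      then have "v \<noteq> rt t" using l pv' rt_eq self_subtree by metis
      then obtain u s where u: "u \<in> subtrees t" "s \<in> set (subs u)" "b = rt u" "q ! i = rt s"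
        using 1(1) pv' unfolding par_arcs_iff by auto
      then have "s = l" using rt_eq l child_subtree by metis
      then have "Nd (q ! i) [] \<in> set (subs u)" using u(2) l by (cases l) auto
      then show ?thesis using u edge_color_arc[OF 1(1)] 1(2) pv' False
        by (intro disjI1 bexI[of _ u]) (auto simp: attached_def leaf_color_def)
    qed
  next
    case 2
    then consider "q ! i = q ! j" "b = q ! nx j" | "q ! i = q ! nx j" "b = q ! j" by (auto simp: doubleton_eq_iff)
    then show ?thesis
    proof cases
      case 1 then show ?thesis using q_inj[OF i 2(1)] by simp
    next
      case prv: 2
      then have "i = nx j" using q_inj[OF i nx_pv(1)[OF 2(1)]] by simp
      then show ?thesis using prv nx_pv(4)[OF 2(1)] by simp
    qed
  qed
qed

lemma attached_unique: "attached u (q ! i) \<Longrightarrow> attached u' (q ! i) \<Longrightarrow> u = u'"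
proof -
  assume a: "attached u (q ! i)" "attached u' (q ! i)"
  have "v \<noteq> r" if "w \<in> subtrees t" "Nd v [] \<in> set (subs w)" for w v
    using rt_in(2)[OF child_subtree[OF that]] by simp
  then show ?thesis using a unique_parent[OF dist(1), of u u' "Nd (q ! i) []"] unfolding attached_def by blast
qed

text \<open>The pair criterion is checked at each vertex. At inner vertices it is \<open>star_colored\<close>, including the rim colours
seen at leaves. A leaf has one tree edge and two rim edges: \<open>l2\<close> and its mirror image \<open>l2'\<close> treat a pair of a tree edge and a rim edge,
\<open>l3\<close> the pair of two rim edges, read at the middle vertex \<open>q ! nx i\<close>.\<close>
theorem glue_star_edge_coloring:
  assumes gs: "star_colored \<kappa> (rim \<epsilon>) (insert (\<kappa> (rt t)) (rim \<epsilon> r)) t"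
    and l1: "\<And>i. i < n \<Longrightarrow> \<epsilon> i \<noteq> leaf_color \<kappa> i \<and> \<epsilon> i \<noteq> leaf_color \<kappa> (nx i) \<and> \<epsilon> i \<noteq> \<epsilon> (nx i)"
    and l2: "\<And>i u. i < n \<Longrightarrow> attached u (q ! i) \<Longrightarrow> \<epsilon> i \<in> tree_colors \<kappa> u \<Longrightarrow>
      leaf_color \<kappa> i \<noteq> leaf_color \<kappa> (nx i) \<and> leaf_color \<kappa> i \<noteq> \<epsilon> (nx i)"
    and l2': "\<And>i u. i < n \<Longrightarrow> attached u (q ! nx i) \<Longrightarrow> \<epsilon> i \<in> tree_colors \<kappa> u \<Longrightarrow>
      leaf_color \<kappa> (nx i) \<noteq> leaf_color \<kappa> i \<and> leaf_color \<kappa> (nx i) \<noteq> \<epsilon> (pv i)"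
    and l3: "\<And>i. i < n \<Longrightarrow> \<not> ((\<epsilon> (nx i) = leaf_color \<kappa> i \<or> \<epsilon> (nx i) = \<epsilon> (pv i)) \<and>
      (\<epsilon> i = leaf_color \<kappa> (nx (nx i)) \<or> \<epsilon> i = \<epsilon> (nx (nx i))))"
  shows "star_edge_coloring G (edge_color \<kappa> \<epsilon>)"
proof -
  let ?c = "edge_color \<kappa> \<epsilon>" and ?E = "rim \<epsilon>"
  let ?bad = "\<lambda>m b d. ?c {m, d} \<in> colors_at G ?c b \<and> ?c {m, b} \<in> colors_at G ?c d"
  have pair: "?c {m, b} \<noteq> ?c {m, d} \<and> \<not> ?bad m b d"
    if mb: "{m, b} \<in> edges G" and md: "{m, d} \<in> edges G" and bd: "b \<noteq> d" for m b d
  proof -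
    have "m \<in> verts G"
    proof -
      have vG: "verts G = insert r (set (preorder t))" using rep by (simp add: plane_rep_def)
      have "set q \<subseteq> verts G" using rt_in(1) by (auto simp: q_def vG set_leaf_list)
      moreover have "p \<in> verts G \<and> v \<in> verts G" if "(p, v) \<in> par_arcs" for p v
        using that rt_in(1) child_subtree self_subtree unfolding par_arcs_iff vG by (metis insertCI)
      then have "\<Union> ((\<lambda>(a, b). {a, b}) ` par_arcs) \<subseteq> verts G" by auto
      moreover have "q ! i \<in> set q" if "i < n" for i using that by (simp add: n_def)
      ultimately have "e \<subseteq> verts G" if "e \<in> edges G" for e
        using that nx_pv(1) unfolding edges_G by auto
      then show ?thesis using mb by blast
    qed
    then have "m = r \<or> (\<exists>u\<in>subtrees t. m = rt u)" using rep unfolding plane_rep_def by (auto simp flip: roots_of_subtrees)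
    then consider u where "u \<in> subtrees t" "subs u \<noteq> []" "m = rt u" | i where "i < n" "m = q ! i"
      using leaf_in_q q0 by metis
    then show ?thesis
    proof cases
      case 1
      define P where "P = (if u = t then insert (\<kappa> (rt t)) (rim \<epsilon> r) else all_colors \<kappa> ?E (SOME p. p \<in> subtrees t \<and> u \<in> set (subs p)))"
      have par: "?c {m, x} = \<kappa> m \<and> colors_at G ?c x = P" if a: "(x, m) \<in> par_arcs" for x
      proof -
        have c: "?c {m, x} = \<kappa> m" using edge_color_arc[OF a] by (simp add: insert_commute)
        show ?thesis
        proof (cases "u = t")
          case True
          then have "(r, m) \<in> par_arcs" using 1 by (simp add: par_arcs_def)
          then have "x = r" using par_arcs_fun a by blast
          then show ?thesis using c colors_at_root True by (simp add: P_def)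
        next
          case False
          define p where "p = (SOME p. p \<in> subtrees t \<and> u \<in> set (subs p))"
          have "\<exists>p. p \<in> subtrees t \<and> u \<in> set (subs p)" using node_cases[OF 1(1)] False by blast
          then have p: "p \<in> subtrees t" "u \<in> set (subs p)" unfolding p_def by (metis (mono_tags, lifting) someI_ex)+
          then have "(rt p, m) \<in> par_arcs" using 1 unfolding par_arcs_iff by blast
          then have "x = rt p" using par_arcs_fun a by blast
          then show ?thesis using c colors_at_node[OF p(1)] False by (simp add: P_def p_def)
        qed
      qed
      have star: "star_colored_at \<kappa> ?E P u"
      proof (cases "u = t")
        case True
        then show ?thesis using gs by (cases t) (simp add: P_def)
      next
        case False
        then have "\<exists>p. p \<in> subtrees t \<and> u \<in> set (subs p)" using node_cases[OF 1(1)] by blast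
        then have "(SOME p. p \<in> subtrees t \<and> u \<in> set (subs p)) \<in> subtrees t \<and> u \<in> set (subs (SOME p. p \<in> subtrees t \<and> u \<in> set (subs p)))"
          by (rule someI_ex)
        then show ?thesis using star_colored_subtree[OF gs] False by (simp add: P_def)
      qed
      have child: "?c {m, rt s} = \<kappa> (rt s) \<and> colors_at G ?c (rt s) = all_colors \<kappa> ?E s" if "s \<in> set (subs u)" for s
        using that 1 edge_color_arc[of m "rt s"] colors_at_node[OF child_subtree[OF 1(1) that]] par_arcs_iff by blast
      have d1: "\<kappa> m \<noteq> \<kappa> (rt s)" if "s \<in> set (subs u)" for s
        using star that 1(3) unfolding star_colored_at_def by auto
      have d2: "\<kappa> (rt s) \<noteq> \<kappa> (rt s')" if "s \<in> set (subs u)" "s' \<in> set (subs u)" "s \<noteq> s'" for s s'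
        using star that inj_onD[of "\<kappa> \<circ> rt" "set (subs u)" s s'] unfolding star_colored_at_def by (auto simp: distinct_map)
      have s1: "\<not> (\<kappa> (rt s) \<in> P \<and> \<kappa> m \<in> all_colors \<kappa> ?E s)" if "s \<in> set (subs u)" for s
        using star that 1(3) unfolding star_colored_at_def by auto
      have s2: "\<not> (\<kappa> (rt s') \<in> all_colors \<kappa> ?E s \<and> \<kappa> (rt s) \<in> all_colors \<kappa> ?E s')"
        if "s \<in> set (subs u)" "s' \<in> set (subs u)" "s \<noteq> s'" for s s'
        using star that unfolding star_colored_at_def by auto
      have b: "(b, m) \<in> par_arcs \<or> (\<exists>s\<in>set (subs u). b = rt s)"
        and d: "(d, m) \<in> par_arcs \<or> (\<exists>s\<in>set (subs u). d = rt s)"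
        using arc_at_inner[OF 1(1) _ 1(2)] mb md 1(3) by auto
      show ?thesis
      proof (cases "(b, m) \<in> par_arcs")
        case B: True
        show ?thesis
        proof (cases "(d, m) \<in> par_arcs")
          case True then show ?thesis using par_arcs_fun B bd by blast
        next
          case False
          then obtain s where s: "s \<in> set (subs u)" "d = rt s" using d by blast
          then show ?thesis using par[OF B] child[OF s(1)] d1[OF s(1)] s1[OF s(1)] by auto
        qed
      next
        case B: False
        then obtain s where s: "s \<in> set (subs u)" "b = rt s" using b by blast
        show ?thesis
        proof (cases "(d, m) \<in> par_arcs")
          case True then show ?thesis using par[OF True] child[OF s(1)] d1[OF s(1)] s1[OF s(1)] s(2) by auto
        next
          case False
          then obtain s' where s': "s' \<in> set (subs u)" "d = rt s'" using d by blast
          then have "s \<noteq> s'" using s bd by auto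
          then show ?thesis using child[OF s(1)] child[OF s'(1)] d2[OF s(1) s'(1)] s2[OF s(1) s'(1)] s s' by auto
        qed
      qed
    next
      case 2
      note i = 2(1) and mq = 2(2)
      have pi: "pv i < n" "nx (pv i) = i" "nx i < n" "pv (nx i) = i" using nx_pv[OF i] by auto
      have nxt: "?c {m, q ! nx i} = \<epsilon> i" "colors_at G ?c (q ! nx i) = {leaf_color \<kappa> (nx i), \<epsilon> (nx i), \<epsilon> i}"
        using edge_color_rim[OF i] colors_at_leaf[OF pi(3)] pi 2(2) by auto
      have prv: "?c {m, q ! pv i} = \<epsilon> (pv i)" "colors_at G ?c (q ! pv i) = {leaf_color \<kappa> (pv i), \<epsilon> (pv i), \<epsilon> (pv (pv i))}"
        using edge_color_rim[OF pi(1)] colors_at_leaf[OF pi(1)] pi 2(2) by (auto simp: insert_commute)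
      let ?tree = "\<lambda>x. \<exists>u\<in>subtrees t. subs u \<noteq> [] \<and> attached u (q ! i) \<and> x = rt u \<and> ?c {q ! i, x} = leaf_color \<kappa> i"
      have tn: "?c {m, x} \<noteq> ?c {m, q ! nx i} \<and> \<not> ?bad m x (q ! nx i) \<and> \<not> ?bad m (q ! nx i) x" if tx: "?tree x" for x
      proof -
        obtain u where u: "u \<in> subtrees t" "subs u \<noteq> []" "attached u (q ! i)" "x = rt u" "?c {m, x} = leaf_color \<kappa> i"
          using tx 2(2) by blast
        have "colors_at G ?c x = tree_colors \<kappa> u" using colors_at_node[OF u(1)] u by (simp add: all_colors_def)
        then show ?thesis using nxt u l1[OF i] l2[OF i u(3)] by auto
      qed
      have tp: "?c {m, x} \<noteq> ?c {m, q ! pv i} \<and> \<not> ?bad m x (q ! pv i) \<and> \<not> ?bad m (q ! pv i) x" if tx: "?tree x" for x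
      proof -
        obtain u where u: "u \<in> subtrees t" "subs u \<noteq> []" "attached u (q ! i)" "x = rt u" "?c {m, x} = leaf_color \<kappa> i"
          using tx 2(2) by blast
        have "colors_at G ?c x = tree_colors \<kappa> u" using colors_at_node[OF u(1)] u by (simp add: all_colors_def)
        then show ?thesis using prv u l1[OF pi(1)] l2'[OF pi(1), of u] pi(2) by auto
      qed
      have np: "?c {m, q ! nx i} \<noteq> ?c {m, q ! pv i} \<and> \<not> ?bad m (q ! nx i) (q ! pv i) \<and> \<not> ?bad m (q ! pv i) (q ! nx i)"
        using nxt prv l1[OF pi(1)] l3[OF pi(1)] pi(2) by auto
      define tr where "tr x \<longleftrightarrow> ?tree x" for x
      define ok where "ok x y \<longleftrightarrow> ?c {m, x} \<noteq> ?c {m, y} \<and> \<not> ?bad m x y" for x y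
      have sym: "ok x y \<Longrightarrow> ok y x" for x y unfolding ok_def by auto
      have 1: "tr x \<Longrightarrow> ok x (q ! nx i)" "tr x \<Longrightarrow> ok x (q ! pv i)" for x
        using tn[of x] tp[of x] unfolding tr_def ok_def by blast+
      have 2: "ok (q ! nx i) (q ! pv i)" using np unfolding ok_def by blast
      have 3: "tr x \<Longrightarrow> tr y \<Longrightarrow> x = y" for x y
        unfolding tr_def using attached_unique by metis
      have 4: "tr b \<or> b = q ! nx i \<or> b = q ! pv i" "tr d \<or> d = q ! nx i \<or> d = q ! pv i"
        using edge_at_leaf[OF i, of b \<kappa> \<epsilon>] edge_at_leaf[OF i, of d \<kappa> \<epsilon>] mb md mq
        unfolding tr_def by auto
      have "ok b d" using 1 2 3 4 sym bd by metis
      then show ?thesis unfolding ok_def .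
    qed
  qed
  show ?thesis
  proof (rule star_edge_coloringI)
    show "proper_edge_coloring G ?c"
      unfolding proper_edge_coloring_def
    proof (intro ballI impI)
      fix e f assume ef: "e \<in> edges G" "f \<in> edges G" "e \<noteq> f \<and> e \<inter> f \<noteq> {}"
      have "\<exists>a b. e = {a, b}" if "e \<in> edges G" for e using that unfolding edges_G by auto
      then obtain a b c d where abcd: "e = {a, b}" "f = {c, d}" using ef by metis
      then obtain m x y where "e = {m, x}" "f = {m, y}" using ef by (metis disjoint_iff doubleton_eq_iff empty_iff insert_iff)
      then show "?c e \<noteq> ?c f" using pair[of m x y] ef by auto
    qed
    show False if "{m, b} \<in> edges G" "{m, d} \<in> edges G" "b \<noteq> d"
      "?c {m, d} \<in> colors_at G ?c b" "?c {m, b} \<in> colors_at G ?c d" for m b d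
      using pair[OF that(1-3)] that(4,5) by simp
  qed
qed

end

section \<open>Colouring binary trees with six colours\<close>

definition olist :: "nat option \<Rightarrow> nat list" where
  "olist z = (case z of None \<Rightarrow> [] | Some x \<Rightarrow> [x])"

text \<open>Leaf colours of a subtree in a context: \<open>L\<close> and \<open>R\<close> are the colours of the leaves to the left and right of the
subtree, \<open>None\<close> if not fixed yet.\<close>
definition fits :: "nat option \<Rightarrow> nat list \<Rightarrow> nat option \<Rightarrow> bool" where
  "fits L ws R \<longleftrightarrow> distinct_adj (olist L @ ws @ olist R)"

lemma olist_simps [simp]: "olist None = []" "olist (Some x) = [x]"
  by (simp_all add: olist_def)

lemma distinct_adj_join: "distinct_adj (xs @ [z]) \<Longrightarrow> distinct_adj (z # ys) \<Longrightarrow> distinct_adj (xs @ z # ys)"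
  by (induction xs rule: induct_list012) (auto simp: distinct_adj_Cons_Cons)

lemma fits_append:
  assumes "fits L w1 R1" "fits (Some (last w1)) w2 R" "w1 \<noteq> []"
  shows "fits L (w1 @ w2) R"
proof -
  have 1: "distinct_adj (olist L @ w1)" using assms(1) unfolding fits_def by (metis append.assoc distinct_adj_appendD1)
  have "w1 = butlast w1 @ [last w1]" using assms(3) by simp
  then have "distinct_adj ((olist L @ butlast w1) @ [last w1])" using 1 by (metis append.assoc)
  moreover have "distinct_adj ([last w1] @ w2 @ olist R)" using assms(2) by (simp add: fits_def)
  ultimately have "distinct_adj ((olist L @ butlast w1) @ last w1 # (w2 @ olist R))"
    by (metis append_Cons append_Nil distinct_adj_join)
  moreover have "(olist L @ butlast w1) @ last w1 # (w2 @ olist R) = olist L @ (w1 @ w2) @ olist R"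
    using assms(3) by (metis append.assoc append_Cons append_Nil append_butlast_last_id)
  ultimately show ?thesis unfolding fits_def by metis
qed

lemma fits_last: "fits L w (Some x) \<Longrightarrow> w \<noteq> [] \<Longrightarrow> last w \<noteq> x"
  unfolding fits_def by (auto simp: distinct_adj_append_iff)

lemma fits_rev: "fits R (rev ws) L \<longleftrightarrow> fits L ws R"
proof -
  have "rev (olist z) = olist z" for z by (cases z) auto
  then have "rev (olist L @ ws @ olist R) = olist R @ rev ws @ olist L" by simp
  then show ?thesis unfolding fits_def by (metis distinct_adj_rev)
qed

lemma fits_Cons: "fits L (x # ws) R \<longleftrightarrow> L \<noteq> Some x \<and> fits (Some x) ws R"
  by (cases L) (auto simp: fits_def distinct_adj_Cons)

lemma fits_Nil: "fits (Some x) [] R \<longleftrightarrow> R \<noteq> Some x"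
  by (cases R) (auto simp: fits_def)

lemma inter_singleD: "C \<inter> X = {a} \<Longrightarrow> x \<in> X \<Longrightarrow> x \<noteq> a \<Longrightarrow> x \<notin> C"
  by blast

text \<open>Colours \<open>0, 1, 2\<close> are called low and \<open>3, 4, 5\<close> high. The tree \<open>t\<close> has a star edge colouring with colour
\<open>\<alpha>\<close> above its root, colour set \<open>C\<close> at its root and leaf colours \<open>ws\<close>, all low, when the parent has colour set \<open>P\<close>. The last two
premises of the second rule allow any high colours on the rim: a leaf is assumed to see every one of them.\<close>
inductive cubic_coloring :: "'a plane_tree \<Rightarrow> nat set \<Rightarrow> nat \<Rightarrow> nat set \<Rightarrow> nat list \<Rightarrow> bool" where
  leaf: "x < 3 \<Longrightarrow> cubic_coloring (Nd v []) P x {x} [x]"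
| node: "cubic_coloring s1 {\<alpha>, \<beta>, \<gamma>} \<beta> C1 w1 \<Longrightarrow> cubic_coloring s2 {\<alpha>, \<beta>, \<gamma>} \<gamma> C2 w2 \<Longrightarrow>
    \<alpha> < 6 \<Longrightarrow> \<alpha> \<noteq> \<beta> \<Longrightarrow> \<alpha> \<noteq> \<gamma> \<Longrightarrow> \<beta> \<noteq> \<gamma> \<Longrightarrow>
    (\<beta> \<in> P \<longrightarrow> \<alpha> \<notin> C1) \<Longrightarrow> (\<gamma> \<in> P \<longrightarrow> \<alpha> \<notin> C2) \<Longrightarrow> \<not> (\<gamma> \<in> C1 \<and> \<beta> \<in> C2) \<Longrightarrow>
    (subs s1 = [] \<longrightarrow> (\<alpha> \<ge> 3 \<longrightarrow> \<beta> \<notin> P) \<and> (\<gamma> \<ge> 3 \<longrightarrow> \<beta> \<notin> C2)) \<Longrightarrow>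
    (subs s2 = [] \<longrightarrow> (\<alpha> \<ge> 3 \<longrightarrow> \<gamma> \<notin> P) \<and> (\<beta> \<ge> 3 \<longrightarrow> \<gamma> \<notin> C1)) \<Longrightarrow>
    cubic_coloring (Nd v [s1, s2]) P \<alpha> {\<alpha>, \<beta>, \<gamma>} (w1 @ w2)"

lemma cubic_coloring_nonempty: "cubic_coloring t P \<alpha> C ws \<Longrightarrow> ws \<noteq> []"
  by (induction rule: cubic_coloring.induct) auto

lemma cubic_coloring_antimono: "cubic_coloring t P \<alpha> C ws \<Longrightarrow> P' \<subseteq> P \<Longrightarrow> cubic_coloring t P' \<alpha> C ws"
proof (induction arbitrary: P' rule: cubic_coloring.induct)
  case (node s1 \<alpha> \<beta> \<gamma> C1 w1 s2 C2 w2 P v)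
  show ?case by (rule cubic_coloring.node[OF node.hyps(1,2)]) (use node.hyps(3-11) node.prems in blast)+
qed (auto intro: cubic_coloring.leaf)

text \<open>Reflection halves the number of cases in the induction.\<close>
fun mirror :: "'a plane_tree \<Rightarrow> 'a plane_tree" where "mirror (Nd v ts) = Nd v (rev (map mirror ts))"

lemma mirror_mirror [simp]: "mirror (mirror t) = t"
  by (induction t) (auto simp: rev_map intro: map_idI)

lemma size_mirror [simp]: "size (mirror t) = size t"
proof (induction t)
  case (Nd v ts)
  then have "size_list size (rev (map mirror ts)) = size_list size ts" by (induction ts) auto
  then show ?case by simp
qed

lemma subs_mirror: "subs (mirror t) = rev (map mirror (subs t))"
  by (cases t) simp

lemma cubic_coloring_mirror: "cubic_coloring t P \<alpha> C ws \<Longrightarrow> cubic_coloring (mirror t) P \<alpha> C (rev ws)"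
proof (induction rule: cubic_coloring.induct)
  case (node s1 \<alpha> \<beta> \<gamma> C1 w1 s2 C2 w2 P v)
  have "cubic_coloring (Nd v [mirror s2, mirror s1]) P \<alpha> {\<alpha>, \<gamma>, \<beta>} (rev w2 @ rev w1)"
    by (rule cubic_coloring.node[of "mirror s2" \<alpha> \<gamma> \<beta> C2 "rev w2" "mirror s1" C1 "rev w1"])
       (use node in \<open>simp_all add: insert_commute subs_mirror, blast?\<close>)
  then show ?case by (simp add: insert_commute)
qed (auto intro: cubic_coloring.leaf)

fun binary :: "'a plane_tree \<Rightarrow> bool" where
  "binary (Nd v ts) \<longleftrightarrow> (ts = [] \<or> length ts = 2) \<and> (\<forall>s\<in>set ts. binary s)"

lemma binary_mirror: "binary (mirror t) = binary t"
  by (induction t) auto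

definition is_leaf :: "'a plane_tree \<Rightarrow> bool" where "is_leaf t \<longleftrightarrow> subs t = []"

text \<open>The extension lemmas distinguish four shapes of a binary tree; among the full ones, \<open>two_cherries\<close> is
an exception.\<close>
definition cherry :: "'a plane_tree \<Rightarrow> bool" where "cherry t \<longleftrightarrow> (\<exists>v s1 s2. t = Nd v [s1, s2] \<and> is_leaf s1 \<and> is_leaf s2)"
definition mixedL :: "'a plane_tree \<Rightarrow> bool" where "mixedL t \<longleftrightarrow> (\<exists>v s1 s2. t = Nd v [s1, s2] \<and> is_leaf s1 \<and> \<not> is_leaf s2)"
definition mixedR :: "'a plane_tree \<Rightarrow> bool" where "mixedR t \<longleftrightarrow> (\<exists>v s1 s2. t = Nd v [s1, s2] \<and> \<not> is_leaf s1 \<and> is_leaf s2)"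
definition full :: "'a plane_tree \<Rightarrow> bool" where "full t \<longleftrightarrow> (\<exists>v s1 s2. t = Nd v [s1, s2] \<and> \<not> is_leaf s1 \<and> \<not> is_leaf s2)"
definition two_cherries :: "'a plane_tree \<Rightarrow> bool" where "two_cherries t \<longleftrightarrow> (\<exists>v s1 s2. t = Nd v [s1, s2] \<and> cherry s1 \<and> cherry s2)"

lemma is_leaf_mirror [simp]: "is_leaf (mirror t) = is_leaf t"
  by (simp add: is_leaf_def subs_mirror)

lemma ex_node2_mirror:
  "(\<exists>v s1 s2. mirror t = Nd v [s1, s2] \<and> Q s1 s2) \<longleftrightarrow> (\<exists>v s1 s2. t = Nd v [s1, s2] \<and> Q (mirror s2) (mirror s1))"
proof
  assume "\<exists>v s1 s2. mirror t = Nd v [s1, s2] \<and> Q s1 s2"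
  then obtain v s1 s2 where 1: "mirror t = Nd v [s1, s2]" "Q s1 s2" by blast
  then have "mirror (mirror t) = mirror (Nd v [s1, s2])" by simp
  then have "t = Nd v [mirror s2, mirror s1]" by simp
  then show "\<exists>v s1 s2. t = Nd v [s1, s2] \<and> Q (mirror s2) (mirror s1)" using 1 by auto
qed auto

lemma cherry_mirror [simp]: "cherry (mirror t) = cherry t"
  unfolding cherry_def ex_node2_mirror is_leaf_mirror by blast
lemma mixedL_mirror [simp]: "mixedL (mirror t) = mixedR t"
  unfolding mixedL_def mixedR_def ex_node2_mirror is_leaf_mirror by blast
lemma mixedR_mirror [simp]: "mixedR (mirror t) = mixedL t"
  unfolding mixedL_def mixedR_def ex_node2_mirror is_leaf_mirror by blast
lemma two_cherries_mirror [simp]: "two_cherries (mirror t) = two_cherries t"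
  unfolding two_cherries_def ex_node2_mirror cherry_mirror by blast

lemma shape_cases:
  assumes "binary t" "\<not> is_leaf t"
  obtains "cherry t" | "mixedL t" | "mixedR t" | "full t"
proof -
  obtain v ts where t: "t = Nd v ts" by (cases t)
  then have "length ts = 2" using assms by (auto simp: is_leaf_def)
  then obtain s1 s2 where "ts = [s1, s2]" by (auto simp: numeral_eq_Suc length_Suc_conv)
  then show ?thesis using t that unfolding cherry_def mixedL_def mixedR_def full_def by metis
qed

lemma shape_excl:
  "cherry t \<Longrightarrow> \<not> is_leaf t \<and> \<not> mixedL t \<and> \<not> mixedR t \<and> \<not> full t \<and> \<not> two_cherries t"
  "mixedL t \<Longrightarrow> \<not> is_leaf t \<and> \<not> mixedR t \<and> \<not> full t \<and> \<not> two_cherries t"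
  "mixedR t \<Longrightarrow> \<not> is_leaf t \<and> \<not> full t \<and> \<not> two_cherries t"
  "full t \<Longrightarrow> \<not> is_leaf t"
  unfolding cherry_def mixedL_def mixedR_def full_def two_cherries_def is_leaf_def by auto

text \<open>A cherry that must avoid \<open>n\<close> has only the two other low colours for its leaves, and no order of them fits
between two leaves that both have one of these colours.\<close>
definition clash :: "nat option \<Rightarrow> nat option \<Rightarrow> nat \<Rightarrow> bool" where
  "clash L R n \<longleftrightarrow> (\<exists>x. L = Some x \<and> R = Some x \<and> x \<noteq> n)"

text \<open>High edge above the tree, with a parent that sees this colour \<open>\<alpha>\<close>, another high colour \<open>\<beta>\<close> and a
low colour \<open>n\<close>. The root shares only \<open>\<alpha>\<close> with the parent, so that no conflict with its sibling can arise. Two cherries between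
leaves coloured \<open>n\<close> may instead have all three high colours at their root.\<close>
definition high_extends :: "'a plane_tree \<Rightarrow> bool" where
  "high_extends t \<longleftrightarrow> (\<forall>\<alpha> \<beta> n L R. \<alpha> \<in> {3,4,5} \<longrightarrow> \<beta> \<in> {3,4,5} \<longrightarrow> \<alpha> \<noteq> \<beta> \<longrightarrow> n < 3 \<longrightarrow> \<not> (cherry t \<and> clash L R n) \<longrightarrow>
     (\<exists>C ws. cubic_coloring t {\<alpha>, \<beta>, n} \<alpha> C ws \<and> fits L ws R \<and>
       (C \<inter> {\<alpha>, \<beta>, n} = {\<alpha>} \<or> two_cherries t \<and> L = Some n \<and> R = Some n \<and> C = {3,4,5})))"

text \<open>High edge above the tree, with a parent that sees two low colours \<open>n\<close>, \<open>y\<close>; then only the third low colour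
\<open>m\<close> may occur at the root.\<close>
definition high_extends2 :: "'a plane_tree \<Rightarrow> bool" where
  "high_extends2 t \<longleftrightarrow> (\<forall>\<alpha> n y m L R. \<alpha> \<in> {3,4,5} \<longrightarrow> {n, y, m} = {0,1,2} \<longrightarrow> \<not> cherry t \<longrightarrow>
     (mixedL t \<longrightarrow> L \<noteq> Some m) \<longrightarrow> (mixedR t \<longrightarrow> R \<noteq> Some m) \<longrightarrow> \<not> (two_cherries t \<and> clash L R m) \<longrightarrow>
     (\<exists>C ws. cubic_coloring t {\<alpha>, n, y} \<alpha> C ws \<and> fits L ws R \<and> C \<inter> {\<alpha>, n, y} = {\<alpha>}))"

text \<open>Low edge above the tree, with a parent that may see every high colour. This is also the situation at the edge
to the leaf \<open>r\<close>.\<close>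
definition low_extends :: "'a plane_tree \<Rightarrow> bool" where
  "low_extends t \<longleftrightarrow> (\<forall>n L R. n < 3 \<longrightarrow> \<not> ((cherry t \<or> two_cherries t) \<and> clash L R n) \<longrightarrow>
     (mixedL t \<or> mixedR t \<longrightarrow> L = None \<or> L = Some n \<or> R = None \<or> R = Some n) \<longrightarrow>
     (\<exists>C ws. cubic_coloring t {n, 3, 4, 5} n C ws \<and> fits L ws R))"

lemma clash_commute: "clash L R n = clash R L n"
  by (auto simp: clash_def)

lemma cubic_coloring_fits_mirror:
  "(\<exists>C ws. cubic_coloring (mirror t) P \<alpha> C ws \<and> fits R ws L \<and> Q C) \<Longrightarrow> \<exists>C ws. cubic_coloring t P \<alpha> C ws \<and> fits L ws R \<and> Q C"
proof -
  assume "\<exists>C ws. cubic_coloring (mirror t) P \<alpha> C ws \<and> fits R ws L \<and> Q C"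
  then obtain C ws where 1: "cubic_coloring (mirror t) P \<alpha> C ws" "fits R ws L" "Q C" by blast
  have "cubic_coloring t P \<alpha> C (rev ws)" using cubic_coloring_mirror[OF 1(1)] by simp
  then show ?thesis using 1 fits_rev[of L ws R] by blast
qed

lemma high_extends_if_mirror: "high_extends (mirror t) \<Longrightarrow> high_extends t"
  unfolding high_extends_def cherry_mirror two_cherries_mirror
proof (intro allI impI, rule cubic_coloring_fits_mirror)
  fix \<alpha> \<beta> n :: nat and L R
  assume a: "\<forall>\<alpha> \<beta> n L R. \<alpha> \<in> {3,4,5} \<longrightarrow> \<beta> \<in> {3,4,5} \<longrightarrow> \<alpha> \<noteq> \<beta> \<longrightarrow> n < 3 \<longrightarrow> \<not> (cherry t \<and> clash L R n) \<longrightarrow>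
     (\<exists>C ws. cubic_coloring (mirror t) {\<alpha>, \<beta>, n} \<alpha> C ws \<and> fits L ws R \<and>
       (C \<inter> {\<alpha>, \<beta>, n} = {\<alpha>} \<or> two_cherries t \<and> L = Some n \<and> R = Some n \<and> C = {3,4,5}))"
    and b: "\<alpha> \<in> {3,4,5}" "\<beta> \<in> {3,4,5}" "\<alpha> \<noteq> \<beta>" "n < 3" "\<not> (cherry t \<and> clash L R n)"
  have "\<not> (cherry t \<and> clash R L n)" using b(5) clash_commute by blast
  from a[rule_format, OF b(1-4) this]
  show "\<exists>C ws. cubic_coloring (mirror t) {\<alpha>, \<beta>, n} \<alpha> C ws \<and> fits R ws L \<and>
       (C \<inter> {\<alpha>, \<beta>, n} = {\<alpha>} \<or> two_cherries t \<and> L = Some n \<and> R = Some n \<and> C = {3,4,5})" by blast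
qed

lemma high_extends2_if_mirror: "high_extends2 (mirror t) \<Longrightarrow> high_extends2 t"
  unfolding high_extends2_def cherry_mirror two_cherries_mirror mixedL_mirror mixedR_mirror
proof (intro allI impI, rule cubic_coloring_fits_mirror)
  fix \<alpha> n y m :: nat and L R
  assume a: "\<forall>\<alpha> n y m L R. \<alpha> \<in> {3,4,5} \<longrightarrow> {n, y, m} = {0,1,2} \<longrightarrow> \<not> cherry t \<longrightarrow>
     (mixedR t \<longrightarrow> L \<noteq> Some m) \<longrightarrow> (mixedL t \<longrightarrow> R \<noteq> Some m) \<longrightarrow> \<not> (two_cherries t \<and> clash L R m) \<longrightarrow>
     (\<exists>C ws. cubic_coloring (mirror t) {\<alpha>, n, y} \<alpha> C ws \<and> fits L ws R \<and> C \<inter> {\<alpha>, n, y} = {\<alpha>})"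
    and b: "\<alpha> \<in> {3,4,5}" "{n, y, m} = {0,1,2}" "\<not> cherry t" "mixedL t \<longrightarrow> L \<noteq> Some m"
      "mixedR t \<longrightarrow> R \<noteq> Some m" "\<not> (two_cherries t \<and> clash L R m)"
  have "\<not> (two_cherries t \<and> clash R L m)" using b(6) clash_commute by blast
  from a[rule_format, OF b(1-3) b(5)[rule_format] b(4)[rule_format] this]
  show "\<exists>C ws. cubic_coloring (mirror t) {\<alpha>, n, y} \<alpha> C ws \<and> fits R ws L \<and> C \<inter> {\<alpha>, n, y} = {\<alpha>}" by blast
qed

lemma low_extends_if_mirror: "low_extends (mirror t) \<Longrightarrow> low_extends t"
  unfolding low_extends_def cherry_mirror two_cherries_mirror mixedL_mirror mixedR_mirror
proof (intro allI impI)
  fix n L R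
  assume a: "\<forall>n L R. n < 3 \<longrightarrow> \<not> ((cherry t \<or> two_cherries t) \<and> clash L R n) \<longrightarrow>
     (mixedR t \<or> mixedL t \<longrightarrow> L = None \<or> L = Some n \<or> R = None \<or> R = Some n) \<longrightarrow>
     (\<exists>C ws. cubic_coloring (mirror t) {n, 3, 4, 5} n C ws \<and> fits L ws R)"
    and b: "n < 3" "\<not> ((cherry t \<or> two_cherries t) \<and> clash L R n)"
      "mixedL t \<or> mixedR t \<longrightarrow> L = None \<or> L = Some n \<or> R = None \<or> R = Some n"
  have "\<not> ((cherry t \<or> two_cherries t) \<and> clash R L n)" using b(2) clash_commute by blast
  moreover have "mixedR t \<or> mixedL t \<longrightarrow> R = None \<or> R = Some n \<or> L = None \<or> L = Some n" using b(3) by blast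
  ultimately obtain C ws where "cubic_coloring (mirror t) {n, 3, 4, 5} n C ws" "fits R ws L" using a b(1) by blast
  then show "\<exists>C ws. cubic_coloring t {n, 3, 4, 5} n C ws \<and> fits L ws R"
    using cubic_coloring_fits_mirror[of t "{n, 3, 4, 5}" n R L "\<lambda>_. True"] by blast
qed

lemma third_color:
  assumes "\<alpha> \<in> {3,4,5::nat}" "\<beta> \<in> {3,4,5}" "\<alpha> \<noteq> \<beta>"
  obtains \<gamma> where "\<gamma> \<in> {3,4,5}" "\<gamma> \<noteq> \<alpha>" "\<gamma> \<noteq> \<beta>" "{\<alpha>, \<beta>, \<gamma>} = {3,4,5}"
proof -
  \<comment> \<open>the three high colours sum up to 12\<close>
  have "12 - \<alpha> - \<beta> \<in> {3,4,5} \<and> 12 - \<alpha> - \<beta> \<noteq> \<alpha> \<and> 12 - \<alpha> - \<beta> \<noteq> \<beta> \<and> {\<alpha>, \<beta>, 12 - \<alpha> - \<beta>} = {3,4,5}"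
    using assms by auto
  then show ?thesis using that by blast
qed

lemma two_others:
  assumes "n < (3::nat)"
  obtains x y where "{n, x, y} = {0,1,2}" "x < 3" "y < 3" "x \<noteq> y" "x \<noteq> n" "y \<noteq> n"
proof -
  consider "n = 0" | "n = 1" | "n = 2" using assms by linarith
  then show ?thesis
  proof cases
    case 1 then show ?thesis by (intro that[of 1 2]) auto
  next
    case 2 then show ?thesis by (intro that[of 0 2]) auto
  next
    case 3 then show ?thesis by (intro that[of 0 1]) auto
  qed
qed

lemma cubic_coloring_cherry:
  assumes "cherry t" "\<alpha> < 6" "x < 3" "y < 3" "x \<noteq> y" "x \<noteq> \<alpha>" "y \<noteq> \<alpha>" "\<alpha> \<ge> 3 \<longrightarrow> x \<notin> P \<and> y \<notin> P"
  shows "cubic_coloring t P \<alpha> {\<alpha>, x, y} [x, y]"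
proof -
  obtain v a b where t: "t = Nd v [Nd a [], Nd b []]"
    using assms(1) unfolding cherry_def is_leaf_def by (metis plane_tree.exhaust_sel)
  have "cubic_coloring (Nd v [Nd a [], Nd b []]) P \<alpha> {\<alpha>, x, y} ([x] @ [y])"
    by (rule cubic_coloring.node[OF cubic_coloring.leaf cubic_coloring.leaf]) (use assms in auto)
  then show ?thesis using t by simp
qed

lemma cherry_order:
  assumes "\<not> clash L R n" "{n, x, y} = {0,1,2::nat}" "x \<noteq> y" "x \<noteq> n" "y \<noteq> n"
  obtains x' y' where "{x', y'} = {x, y}" "L \<noteq> Some x'" "R \<noteq> Some y'"
proof (cases "L \<noteq> Some x \<and> R \<noteq> Some y")
  case True then show ?thesis using that[of x y] by simp
next
  case False
  then have "L \<noteq> Some y \<and> R \<noteq> Some x" using assms unfolding clash_def by auto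
  then show ?thesis using that[of y x] by auto
qed

lemma high_extends_mirror: "high_extends t \<Longrightarrow> high_extends (mirror t)" and low_extends_mirror: "low_extends t \<Longrightarrow> low_extends (mirror t)" and high_extends2_mirror: "high_extends2 t \<Longrightarrow> high_extends2 (mirror t)"
  using high_extends_if_mirror[of "mirror t"] low_extends_if_mirror[of "mirror t"] high_extends2_if_mirror[of "mirror t"] by simp_all

lemma fits_ne_last: "fits L w R \<Longrightarrow> w \<noteq> [] \<Longrightarrow> R \<noteq> Some (last w)"
  using fits_last by blast

text \<open>Two inner children, of which the left one gets the high colour \<open>\<beta>\<close> and the right one the low colour \<open>m\<close>.
Colouring from left to right, the right child has a left neighbour different from \<open>R\<close>, which excludes a clash.\<close>
lemma high_left_low_right:
  assumes "\<not> is_leaf s1" "\<not> is_leaf s2" "high_extends s1" "low_extends s2" "\<not> mixedL s2" "\<not> mixedR s2"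
    "\<alpha> \<in> {3,4,5}" "\<beta> \<in> {3,4,5}" "\<alpha> \<noteq> \<beta>" "m < 3" "\<beta> \<notin> P" "m \<notin> P" "\<not> (cherry s1 \<and> clash L R m)"
  shows "\<exists>ws. cubic_coloring (Nd v [s1, s2]) P \<alpha> {\<alpha>, \<beta>, m} ws \<and> fits L ws R"
proof -
  from assms(3)[unfolded high_extends_def, rule_format, OF assms(8,7) assms(9)[symmetric] assms(10,13)]
  obtain C1 w1 where 1: "cubic_coloring s1 {\<beta>, \<alpha>, m} \<beta> C1 w1" "fits L w1 R"
    "C1 \<inter> {\<beta>, \<alpha>, m} = {\<beta>} \<or> C1 = {3,4,5}" by blast
  have ne: "w1 \<noteq> []" using cubic_coloring_nonempty[OF 1(1)] .
  have "\<not> clash (Some (last w1)) R m" using fits_ne_last[OF 1(2) ne] by (auto simp: clash_def)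
  then obtain C2 w2 where 2: "cubic_coloring s2 {m, 3, 4, 5} m C2 w2" "fits (Some (last w1)) w2 R"
    using assms(4-6,10) unfolding low_extends_def by blast
  have r2: "cubic_coloring s2 {\<alpha>, \<beta>, m} m C2 w2" using cubic_coloring_antimono[OF 2(1)] assms(7,8) by auto
  moreover have r1: "cubic_coloring s1 {\<alpha>, \<beta>, m} \<beta> C1 w1" using 1(1) by (simp add: insert_commute)
  moreover have "m \<notin> C1"
  proof -
    have "m \<notin> {3,4,5}" "m \<noteq> \<beta>" using assms(8,10) by auto
    then show ?thesis using 1(3) by blast
  qed
  ultimately have "cubic_coloring (Nd v [s1, s2]) P \<alpha> {\<alpha>, \<beta>, m} (w1 @ w2)"
    using assms by (intro cubic_coloring.node[OF r1 r2]) (auto simp: is_leaf_def)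
  then show ?thesis using fits_append[OF 1(2) 2(2) ne] by blast
qed

text \<open>Either child can get the high colour. This freedom avoids a high edge above a cherry with a clash and a low edge above a
child with exactly one leaf below its root; if both
children are of that kind, the low one goes first, with its right neighbour still open.\<close>
lemma high_above_inner_children:
  assumes "\<not> is_leaf s1" "\<not> is_leaf s2" "binary s1" "binary s2" "high_extends s1" "low_extends s1" "high_extends s2" "low_extends s2"
    "\<alpha> \<in> {3,4,5}" "\<beta> \<in> {3,4,5}" "\<alpha> \<noteq> \<beta>" "m < 3" "\<beta> \<notin> P" "m \<notin> P"
    "\<not> (cherry s1 \<and> cherry s2 \<and> clash L R m)"
  shows "\<exists>ws. cubic_coloring (Nd v [s1, s2]) P \<alpha> {\<alpha>, \<beta>, m} ws \<and> fits L ws R"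
proof -
  let ?M = "\<lambda>s. mixedL s \<or> mixedR s"
  consider "\<not> ?M s2" "\<not> (cherry s1 \<and> clash L R m)" | "?M s1" "?M s2"
    | "\<not> ?M s1" "\<not> (cherry s2 \<and> clash L R m)"
    using assms(15) shape_excl(1) by blast
  then show ?thesis
  proof cases
    case 1
    then show ?thesis using high_left_low_right[of s1 s2] assms by blast
  next
    case 2
    then have nc: "\<not> cherry s1" "\<not> two_cherries s1" "\<not> cherry s2" "\<not> two_cherries s2" using shape_excl by blast+
    then obtain C1 w1 where 1: "cubic_coloring s1 {m, 3, 4, 5} m C1 w1" "fits L w1 None"
      using assms(6,12) unfolding low_extends_def by blast
    have "\<not> (cherry s2 \<and> clash (Some (last w1)) R m)" using nc by blast
    from assms(7)[unfolded high_extends_def, rule_format, OF assms(10,9) assms(11)[symmetric] assms(12) this]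
    obtain C2 w2 where 2: "cubic_coloring s2 {\<beta>, \<alpha>, m} \<beta> C2 w2" "fits (Some (last w1)) w2 R" "C2 \<inter> {\<beta>, \<alpha>, m} = {\<beta>}"
      using nc by blast
    have ne: "w1 \<noteq> []" using cubic_coloring_nonempty[OF 1(1)] .
    have r1: "cubic_coloring s1 {\<alpha>, m, \<beta>} m C1 w1" using cubic_coloring_antimono[OF 1(1)] assms(9,10) by auto
    moreover have r2: "cubic_coloring s2 {\<alpha>, m, \<beta>} \<beta> C2 w2" using 2(1) by (simp add: insert_commute)
    moreover have "m \<noteq> \<beta>" using assms(10,12) by auto
    moreover then have "m \<notin> C2" using inter_singleD[OF 2(3), of m] by simp
    ultimately have "cubic_coloring (Nd v [s1, s2]) P \<alpha> {\<alpha>, m, \<beta>} (w1 @ w2)"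
      using assms by (intro cubic_coloring.node[OF r1 r2]) (auto simp: is_leaf_def)
    then show ?thesis using fits_append[OF 1(2) 2(2) ne] by (auto simp: insert_commute)
  next
    case 3
    have "\<exists>ws. cubic_coloring (Nd v [mirror s2, mirror s1]) P \<alpha> {\<alpha>, \<beta>, m} ws \<and> fits R ws L"
      using 3 assms high_extends_mirror[of s2] low_extends_mirror[of s1] clash_commute[of L R m] by (intro high_left_low_right) auto
    then obtain ws where ws: "cubic_coloring (Nd v [mirror s2, mirror s1]) P \<alpha> {\<alpha>, \<beta>, m} ws" "fits R ws L" by blast
    have "cubic_coloring (Nd v [s1, s2]) P \<alpha> {\<alpha>, \<beta>, m} (rev ws)" using cubic_coloring_mirror[OF ws(1)] by simp
    then show ?thesis using ws(2) fits_rev[of L ws R] by blast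
  qed
qed

text \<open>Below a low edge both inner children get high colours.\<close>
lemma low_above_inner_children:
  assumes "\<not> is_leaf s1" "\<not> is_leaf s2" "high_extends s1" "high_extends s2" "n < 3" "\<not> (cherry s1 \<and> clash L R n)"
  shows "\<exists>ws. cubic_coloring (Nd v [s1, s2]) {n,3,4,5} n {n, 3, 4} ws \<and> fits L ws R"
proof -
  from assms(3)[unfolded high_extends_def, rule_format, of 3 4 n L R] assms(5,6)
  obtain C1 w1 where 1: "cubic_coloring s1 {3, 4, n} 3 C1 w1" "fits L w1 R"
    "C1 \<inter> {3, 4, n} = {3} \<or> C1 = {3,4,5}" by auto
  have ne: "w1 \<noteq> []" using cubic_coloring_nonempty[OF 1(1)] .
  have nl: "R \<noteq> Some (last w1)" using fits_ne_last[OF 1(2) ne] .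
  then have "\<not> clash (Some (last w1)) R n" by (auto simp: clash_def)
  with assms(4)[unfolded high_extends_def, rule_format, of 4 3 n "Some (last w1)" R] assms(5) nl
  obtain C2 w2 where 2: "cubic_coloring s2 {4, 3, n} 4 C2 w2" "fits (Some (last w1)) w2 R"
    "C2 \<inter> {4, 3, n} = {4}" by auto
  have r: "cubic_coloring s1 {n, 3, 4} 3 C1 w1" "cubic_coloring s2 {n, 3, 4} 4 C2 w2" using 1(1) 2(1) by (simp_all add: insert_commute)
  moreover have n: "n \<noteq> 3" "n \<noteq> 4" "n \<noteq> 5" using assms(5) by auto
  moreover have "n \<notin> C1" using 1(3)
  proof
    assume "C1 \<inter> {3, 4, n} = {3}" then show ?thesis by (rule inter_singleD) (use n in auto)
  qed (use n in simp)
  moreover have "n \<notin> C2" "3 \<notin> C2" by (rule inter_singleD[OF 2(3)]; use n in simp)+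
  ultimately have "cubic_coloring (Nd v [s1, s2]) {n,3,4,5} n {n, 3, 4} (w1 @ w2)"
    using assms by (intro cubic_coloring.node[OF r]) (auto simp: is_leaf_def)
  then show ?thesis using fits_append[OF 1(2) 2(2) ne] by blast
qed

text \<open>A leaf child takes a low colour other than \<open>n\<close>. With an inner child it is the third high colour \<open>\<gamma>\<close>
that goes down, so that \<open>\<beta>\<close> and \<open>n\<close> do not appear at the root. The exceptional case of two cherries between
leaves coloured \<open>n\<close> uses \<open>\<beta>\<close> and \<open>\<gamma>\<close>.\<close>
lemma high_extends_step:
  assumes t: "t = Nd v [s1, s2]" "binary t"
    and IH: "\<not> is_leaf s1 \<Longrightarrow> high_extends s1 \<and> low_extends s1" "\<not> is_leaf s2 \<Longrightarrow> high_extends s2 \<and> low_extends s2"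
    and nR: "\<not> mixedR t"
  shows "high_extends t"
  unfolding high_extends_def
proof (intro allI impI)
  fix \<alpha> \<beta> n :: nat and L R
  assume \<alpha>: "\<alpha> \<in> {3,4,5}" and \<beta>: "\<beta> \<in> {3,4,5}" and ne: "\<alpha> \<noteq> \<beta>" and n: "n < 3"
    and cl: "\<not> (cherry t \<and> clash L R n)"
  obtain \<gamma> where \<gamma>: "\<gamma> \<in> {3,4,5}" "\<gamma> \<noteq> \<alpha>" "\<gamma> \<noteq> \<beta>" "{\<alpha>, \<beta>, \<gamma>} = {3,4,5}"
    using third_color[OF \<alpha> \<beta> ne] by blast
  have bd: "\<alpha> < 6" "\<alpha> \<ge> 3" "\<beta> \<ge> 3" "\<gamma> \<ge> 3" "\<beta> < 6" "\<gamma> < 6" using \<alpha> \<beta> \<gamma> by auto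
  have nl: "\<not> is_leaf t" using t by (simp add: is_leaf_def)
  obtain x y where xy: "{n, x, y} = {0,1,2}" "x < 3" "y < 3" "x \<noteq> y" "x \<noteq> n" "y \<noteq> n"
    using two_others[OF n] by blast
  show "\<exists>C ws. cubic_coloring t {\<alpha>, \<beta>, n} \<alpha> C ws \<and> fits L ws R \<and>
       (C \<inter> {\<alpha>, \<beta>, n} = {\<alpha>} \<or> two_cherries t \<and> L = Some n \<and> R = Some n \<and> C = {3,4,5})"
  proof (rule shape_cases[OF t(2) nl])
    assume c: "cherry t"
    then obtain x' y' where x': "{x', y'} = {x, y}" "L \<noteq> Some x'" "R \<noteq> Some y'"
      using cherry_order[of L R n x y] cl xy by blast
    then have 1: "x' < 3" "y' < 3" "x' \<noteq> y'" "x' \<noteq> n" "y' \<noteq> n" using xy(2-6) by (auto simp: doubleton_eq_iff)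
    have "cubic_coloring t {\<alpha>, \<beta>, n} \<alpha> {\<alpha>, x', y'} [x', y']"
      using c 1 bd by (intro cubic_coloring_cherry) auto
    moreover have "fits L [x', y'] R" using x' 1 by (auto simp: fits_Cons fits_Nil)
    moreover have "{\<alpha>, x', y'} \<inter> {\<alpha>, \<beta>, n} = {\<alpha>}" using 1 bd by auto
    ultimately show ?thesis by blast
  next
    assume "mixedL t"
    then have s: "is_leaf s1" "\<not> is_leaf s2" using t by (auto simp: mixedL_def)
    obtain z where z: "z < 3" "z \<noteq> n" "L \<noteq> Some z" using xy(2-6) by (cases "L = Some x") auto
    have "\<not> (cherry s2 \<and> clash (Some z) R z)" by (auto simp: clash_def)
    from IH(2)[OF s(2), THEN conjunct1, unfolded high_extends_def, rule_format, OF \<gamma>(1) \<alpha> \<gamma>(2) z(1) this]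
    obtain C ws where 1: "cubic_coloring s2 {\<gamma>, \<alpha>, z} \<gamma> C ws" "fits (Some z) ws R"
      "C \<inter> {\<gamma>, \<alpha>, z} = {\<gamma>} \<or> C = {3,4,5}" by blast
    obtain a where a: "s1 = Nd a []" using s(1) by (cases s1) (auto simp: is_leaf_def)
    have "z \<notin> C" using 1(3)
    proof
      assume "C \<inter> {\<gamma>, \<alpha>, z} = {\<gamma>}" then show ?thesis by (rule inter_singleD) (use z(1) bd in auto)
    qed (use z(1) in auto)
    moreover have r2: "cubic_coloring s2 {\<alpha>, z, \<gamma>} \<gamma> C ws" using 1(1) by (simp add: insert_commute)
    ultimately have "cubic_coloring t {\<alpha>, \<beta>, n} \<alpha> {\<alpha>, z, \<gamma>} ([z] @ ws)"
      unfolding t(1) a using z bd \<gamma> n s(2) by (intro cubic_coloring.node[OF cubic_coloring.leaf r2]) (auto simp: is_leaf_def)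
    moreover have "fits L ([z] @ ws) R" using z(3) 1(2) by (simp add: fits_Cons)
    moreover have "{\<alpha>, z, \<gamma>} \<inter> {\<alpha>, \<beta>, n} = {\<alpha>}" using z bd \<gamma> n by auto
    ultimately show ?thesis by blast
  next
    assume "mixedR t" then show ?thesis using nR by blast
  next
    assume f: "full t"
    then have s: "\<not> is_leaf s1" "\<not> is_leaf s2" "binary s1" "binary s2" using t by (auto simp: full_def)
    \<comment> \<open>inner children get \<open>\<gamma>\<close> and a low colour \<open>m \<noteq> n\<close>\<close>
    have fullm: ?thesis if m: "m < 3" "m \<noteq> n" "\<not> (cherry s1 \<and> cherry s2 \<and> clash L R m)" for m
    proof -
      have "\<exists>ws. cubic_coloring (Nd v [s1, s2]) {\<alpha>, \<beta>, n} \<alpha> {\<alpha>, \<gamma>, m} ws \<and> fits L ws R"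
        using high_above_inner_children[OF s(1-4) _ _ _ _ \<alpha> \<gamma>(1) \<gamma>(2)[symmetric] m(1) _ _ m(3), of "{\<alpha>, \<beta>, n}" v]
          IH s \<gamma> bd m n by auto
      moreover have "{\<alpha>, \<gamma>, m} \<inter> {\<alpha>, \<beta>, n} = {\<alpha>}" using m bd \<gamma> n by auto
      ultimately show ?thesis unfolding t(1) by blast
    qed
    show ?thesis
    proof (cases "cherry s1 \<and> cherry s2 \<and> L = Some n \<and> R = Some n")
      case False
      show ?thesis
      proof (cases "cherry s1 \<and> cherry s2 \<and> clash L R x")
        case True
        then obtain k where k: "L = Some k" "R = Some k" "k \<noteq> x" by (auto simp: clash_def)
        show ?thesis
        proof (cases "k < 3")
          case True
          then have "k \<noteq> n" using False k \<open>cherry s1 \<and> cherry s2 \<and> clash L R x\<close> by auto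
          then show ?thesis using fullm[OF True] k by (auto simp: clash_def)
        next
          case False
          \<comment> \<open>the neighbouring leaves have the same colour \<open>k\<close>, which is not low and hence leaves the cherries free\<close>
          have k3: "k \<noteq> x" "k \<noteq> y" using False xy(2-6) by auto
          have r1: "cubic_coloring s1 {\<alpha>, \<gamma>, x} \<gamma> {\<gamma>, n, y} [n, y]"
            using True xy(2-6) bd \<gamma> n by (intro cubic_coloring_cherry) auto
          moreover have r2: "cubic_coloring s2 {\<alpha>, \<gamma>, x} x {x, n, y} [n, y]"
            using True xy(2-6) bd \<gamma> n by (intro cubic_coloring_cherry) auto
          ultimately have "cubic_coloring (Nd v [s1, s2]) {\<alpha>, \<beta>, n} \<alpha> {\<alpha>, \<gamma>, x} ([n, y] @ [n, y])"
            using s xy(2-6) bd \<gamma> n by (intro cubic_coloring.node[OF r1 r2]) (auto simp: is_leaf_def)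
          moreover have "fits L ([n, y] @ [n, y]) R" using k False xy(2-6) n by (auto simp: fits_Cons fits_Nil)
          moreover have "{\<alpha>, \<gamma>, x} \<inter> {\<alpha>, \<beta>, n} = {\<alpha>}" using xy(2-6) bd \<gamma> n by auto
          ultimately show ?thesis unfolding t(1) by blast
        qed
      next
        case False
        then show ?thesis using fullm xy(2-6) by blast
      qed
    next
      case True
      have r1: "cubic_coloring s1 {\<alpha>, \<beta>, \<gamma>} \<beta> {\<beta>, x, n} [x, n]"
        using True xy(2-6) bd n by (intro cubic_coloring_cherry) auto
      moreover have r2: "cubic_coloring s2 {\<alpha>, \<beta>, \<gamma>} \<gamma> {\<gamma>, x, y} [x, y]"
        using True xy(2-6) bd by (intro cubic_coloring_cherry) auto
      ultimately have "cubic_coloring (Nd v [s1, s2]) {\<alpha>, \<beta>, n} \<alpha> {\<alpha>, \<beta>, \<gamma>} ([x, n] @ [x, y])"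
        using s xy(2-6) bd \<gamma> n ne by (intro cubic_coloring.node[OF r1 r2]) (auto simp: is_leaf_def)
      moreover have "fits L ([x, n] @ [x, y]) R" using True xy(2-6) by (auto simp: fits_Cons fits_Nil)
      moreover have "two_cherries t" using True t by (auto simp: two_cherries_def)
      ultimately show ?thesis using True \<gamma>(4) unfolding t(1) by metis
    qed
  qed
qed

lemma high_extends2_step:
  assumes t: "t = Nd v [s1, s2]" "binary t"
    and IH: "\<not> is_leaf s1 \<Longrightarrow> high_extends s1 \<and> low_extends s1" "\<not> is_leaf s2 \<Longrightarrow> high_extends s2 \<and> low_extends s2"
    and nR: "\<not> mixedR t"
  shows "high_extends2 t"
  unfolding high_extends2_def
proof (intro allI impI)
  fix \<alpha> n y m :: nat and L R
  assume \<alpha>: "\<alpha> \<in> {3,4,5}" and N: "{n, y, m} = {0,1,2}" and nc: "\<not> cherry t"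
    and L: "mixedL t \<longrightarrow> L \<noteq> Some m" and cl: "\<not> (two_cherries t \<and> clash L R m)"
  have card: "card {n, y, m} = 3" unfolding N by simp
  then have N': "n \<noteq> y" "n \<noteq> m" "y \<noteq> m" by (auto simp: card_insert_if split: if_splits)
  have "n \<in> {0,1,2}" "y \<in> {0,1,2}" "m \<in> {0,1,2}" using N by blast+
  then have lt: "n < 3" "y < 3" "m < 3" by auto
  define \<beta> where "\<beta> = (if \<alpha> = 3 then 4 else 3::nat)"
  have \<beta>: "\<beta> \<in> {3,4,5}" "\<beta> \<noteq> \<alpha>" by (auto simp: \<beta>_def)
  have bd: "\<alpha> < 6" "\<alpha> \<ge> 3" "\<beta> \<ge> 3" using \<alpha> \<beta> by auto
  have nl: "\<not> is_leaf t" using t by (simp add: is_leaf_def)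
  show "\<exists>C ws. cubic_coloring t {\<alpha>, n, y} \<alpha> C ws \<and> fits L ws R \<and> C \<inter> {\<alpha>, n, y} = {\<alpha>}"
  proof (rule shape_cases[OF t(2) nl])
    assume "mixedL t"
    then have s: "is_leaf s1" "\<not> is_leaf s2" "L \<noteq> Some m" using t L by (auto simp: mixedL_def)
    have "\<not> (cherry s2 \<and> clash (Some m) R m)" by (auto simp: clash_def)
    from IH(2)[OF s(2), THEN conjunct1, unfolded high_extends_def, rule_format, OF \<beta>(1) \<alpha> \<beta>(2) lt(3) this]
    obtain C ws where 1: "cubic_coloring s2 {\<beta>, \<alpha>, m} \<beta> C ws" "fits (Some m) ws R"
      "C \<inter> {\<beta>, \<alpha>, m} = {\<beta>} \<or> C = {3,4,5}" by blast
    obtain a where a: "s1 = Nd a []" using s(1) by (cases s1) (auto simp: is_leaf_def)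
    have "m \<notin> C" using 1(3)
    proof
      assume "C \<inter> {\<beta>, \<alpha>, m} = {\<beta>}" then show ?thesis by (rule inter_singleD) (use lt bd in auto)
    qed (use lt in auto)
    moreover have r2: "cubic_coloring s2 {\<alpha>, m, \<beta>} \<beta> C ws" using 1(1) by (simp add: insert_commute)
    ultimately have "cubic_coloring t {\<alpha>, n, y} \<alpha> {\<alpha>, m, \<beta>} ([m] @ ws)"
      unfolding t(1) a using lt bd \<beta> N' s(2) by (intro cubic_coloring.node[OF cubic_coloring.leaf r2]) (auto simp: is_leaf_def)
    moreover have "fits L ([m] @ ws) R" using s(3) 1(2) by (simp add: fits_Cons)
    moreover have "{\<alpha>, m, \<beta>} \<inter> {\<alpha>, n, y} = {\<alpha>}" using lt bd \<beta> N' by auto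
    ultimately show ?thesis by blast
  next
    assume f: "full t"
    then have s: "\<not> is_leaf s1" "\<not> is_leaf s2" "binary s1" "binary s2" using t by (auto simp: full_def)
    have "\<not> (cherry s1 \<and> cherry s2 \<and> clash L R m)" using cl t by (auto simp: two_cherries_def)
    then have "\<exists>ws. cubic_coloring (Nd v [s1, s2]) {\<alpha>, n, y} \<alpha> {\<alpha>, \<beta>, m} ws \<and> fits L ws R"
      using high_above_inner_children[OF s(1-4) _ _ _ _ \<alpha> \<beta>(1) \<beta>(2)[symmetric] lt(3), of "{\<alpha>, n, y}" L R v]
        IH s bd lt N' \<beta> by auto
    moreover have "{\<alpha>, \<beta>, m} \<inter> {\<alpha>, n, y} = {\<alpha>}" using lt bd \<beta> N' by auto
    ultimately show ?thesis unfolding t(1) by blast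
  qed (use nR nc in auto)
qed

lemma low_extends_step:
  assumes t: "t = Nd v [s1, s2]" "binary t"
    and IH: "\<not> is_leaf s1 \<Longrightarrow> high_extends s1 \<and> low_extends s1" "\<not> is_leaf s2 \<Longrightarrow> high_extends s2 \<and> high_extends2 s2 \<and> low_extends s2"
    and nR: "\<not> mixedR t"
  shows "low_extends t"
  unfolding low_extends_def
proof (intro allI impI)
  fix n :: nat and L R
  assume n: "n < 3" and cl: "\<not> ((cherry t \<or> two_cherries t) \<and> clash L R n)"
    and M: "mixedL t \<or> mixedR t \<longrightarrow> L = None \<or> L = Some n \<or> R = None \<or> R = Some n"
  obtain x y where xy: "{n, x, y} = {0,1,2}" "x < 3" "y < 3" "x \<noteq> y" "x \<noteq> n" "y \<noteq> n"
    using two_others[OF n] by blast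
  have nl: "\<not> is_leaf t" using t by (simp add: is_leaf_def)
  show "\<exists>C ws. cubic_coloring t {n, 3, 4, 5} n C ws \<and> fits L ws R"
  proof (rule shape_cases[OF t(2) nl])
    assume c: "cherry t"
    then obtain x' y' where x': "{x', y'} = {x, y}" "L \<noteq> Some x'" "R \<noteq> Some y'"
      using cherry_order[of L R n x y] cl xy by blast
    then have 1: "x' < 3" "y' < 3" "x' \<noteq> y'" "x' \<noteq> n" "y' \<noteq> n" using xy(2-6) by (auto simp: doubleton_eq_iff)
    have "cubic_coloring t {n, 3, 4, 5} n {n, x', y'} [x', y']"
      using c 1 n by (intro cubic_coloring_cherry) auto
    moreover have "fits L [x', y'] R" using x' 1 by (auto simp: fits_Cons fits_Nil)
    ultimately show ?thesis by blast
  next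
    assume mL: "mixedL t"
    then have s: "is_leaf s1" "\<not> is_leaf s2" using t by (auto simp: mixedL_def)
    obtain a where a: "s1 = Nd a []" using s(1) by (cases s1) (auto simp: is_leaf_def)
    have choice: "\<exists>z m. {n, z, m} = {0,1,2} \<and> z < 3 \<and> m < 3 \<and> z \<noteq> m \<and> z \<noteq> n \<and> m \<noteq> n \<and> Q z m"
      if "Q x y \<or> Q y x" for Q
      using that xy by (metis insert_commute)
    show ?thesis
    proof (cases "cherry s2")
      case True
      have "\<exists>z m. {n, z, m} = {0,1,2} \<and> z < 3 \<and> m < 3 \<and> z \<noteq> m \<and> z \<noteq> n \<and> m \<noteq> n \<and> (L \<noteq> Some z \<and> R \<noteq> Some z)"
        by (rule choice) (use M mL xy(2-6) in auto)
      then obtain z m where z: "z < 3" "m < 3" "z \<noteq> m" "z \<noteq> n" "m \<noteq> n" "L \<noteq> Some z" "R \<noteq> Some z" by blast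
      have r2: "cubic_coloring s2 {n, z, m} m {m, n, z} [n, z]" using True z n by (intro cubic_coloring_cherry) auto
      have "cubic_coloring t {n, 3, 4, 5} n {n, z, m} ([z] @ [n, z])"
        unfolding t(1) a using z n s(2) by (intro cubic_coloring.node[OF cubic_coloring.leaf r2]) (auto simp: is_leaf_def)
      moreover have "fits L ([z] @ [n, z]) R" using z by (auto simp: fits_Cons fits_Nil)
      ultimately show ?thesis by blast
    next
      case False
      have "\<exists>z m. {n, z, m} = {0,1,2} \<and> z < 3 \<and> m < 3 \<and> z \<noteq> m \<and> z \<noteq> n \<and> m \<noteq> n \<and>
        (L \<noteq> Some z \<and> (mixedR s2 \<longrightarrow> R \<noteq> Some m) \<and> (two_cherries s2 \<longrightarrow> R \<noteq> Some z))"
        by (rule choice) (use M mL xy(2-6) shape_excl(3)[of s2] in auto)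
      then obtain z m where z: "{n, z, m} = {0,1,2}" "z < 3" "m < 3" "z \<noteq> m" "z \<noteq> n" "m \<noteq> n" "L \<noteq> Some z"
        "mixedR s2 \<longrightarrow> R \<noteq> Some m" "two_cherries s2 \<longrightarrow> R \<noteq> Some z" by blast
      have "\<not> (two_cherries s2 \<and> clash (Some z) R m)" "mixedL s2 \<longrightarrow> Some z \<noteq> Some m" using z by (auto simp: clash_def)
      then obtain C ws where 1: "cubic_coloring s2 {3, n, z} 3 C ws" "fits (Some z) ws R" "C \<inter> {3, n, z} = {3}"
        using IH(2)[OF s(2), THEN conjunct2, THEN conjunct1, unfolded high_extends2_def, rule_format, of 3 n z m "Some z" R]
          z False by auto
      have nz: "n \<notin> C" "z \<notin> C" using inter_singleD[OF 1(3), of n] inter_singleD[OF 1(3), of z] n z by auto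
      have r2: "cubic_coloring s2 {n, z, 3} 3 C ws" using 1(1) by (simp add: insert_commute)
      have "cubic_coloring t {n, 3, 4, 5} n {n, z, 3} ([z] @ ws)"
        unfolding t(1) a using z n s(2) nz by (intro cubic_coloring.node[OF cubic_coloring.leaf r2]) (auto simp: is_leaf_def)
      moreover have "fits L ([z] @ ws) R" using z 1(2) by (simp add: fits_Cons)
      ultimately show ?thesis by blast
    qed
  next
    assume f: "full t"
    then have s: "\<not> is_leaf s1" "\<not> is_leaf s2" using t by (auto simp: full_def)
    have E: "high_extends s1" "high_extends s2" using IH s by auto
    show ?thesis
    proof (cases "cherry s1 \<and> clash L R n")
      case False
      then show ?thesis using low_above_inner_children[OF s E n, of L R v] unfolding t(1) by blast
    next
      case True
      then have "\<not> cherry s2" using cl t by (auto simp: two_cherries_def)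
      then obtain ws where ws: "cubic_coloring (Nd v [mirror s2, mirror s1]) {n,3,4,5} n {n, 3, 4} ws" "fits R ws L"
        using low_above_inner_children[of "mirror s2" "mirror s1" n R L v] s E high_extends_mirror n by auto
      have "cubic_coloring (Nd v [s1, s2]) {n,3,4,5} n {n, 3, 4} (rev ws)" using cubic_coloring_mirror[OF ws(1)] by simp
      then show ?thesis using ws(2) fits_rev[of L ws R] unfolding t(1) by blast
    qed
  qed (use nR in auto)
qed

lemma extension_lemma:
  fixes t :: "'a plane_tree"
  assumes "binary t" "\<not> is_leaf t" shows "high_extends t \<and> high_extends2 t \<and> low_extends t"
  using assms
proof (induction "size t" arbitrary: t rule: less_induct)
  case less
  have main: "high_extends u \<and> high_extends2 u \<and> low_extends u" if u: "size u = size t" "binary u" "\<not> is_leaf u" "\<not> mixedR u" for u :: "'a plane_tree"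
  proof -
    obtain v s1 s2 where s: "u = Nd v [s1, s2]"
      using shape_cases[OF u(2,3)] unfolding cherry_def mixedL_def mixedR_def full_def by metis
    have "size s1 < size t" "size s2 < size t" using u(1) s by auto
    then have "\<not> is_leaf s1 \<Longrightarrow> high_extends s1 \<and> high_extends2 s1 \<and> low_extends s1" "\<not> is_leaf s2 \<Longrightarrow> high_extends s2 \<and> high_extends2 s2 \<and> low_extends s2"
      using less(1)[of s1] less(1)[of s2] u(2) s by auto
    then show ?thesis
      using high_extends_step[OF s u(2) _ _ u(4)] high_extends2_step[OF s u(2) _ _ u(4)] low_extends_step[OF s u(2) _ _ u(4)] by blast
  qed
  show ?case
  proof (cases "mixedR t")
    case False then show ?thesis using main less by blast
  next
    case True
    then have "high_extends (mirror t) \<and> high_extends2 (mirror t) \<and> low_extends (mirror t)"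
      using main[of "mirror t"] less(2,3) shape_excl(2)[of "mirror t"] by (auto simp: binary_mirror)
    then show ?thesis using high_extends_if_mirror high_extends2_if_mirror low_extends_if_mirror by blast
  qed
qed

text \<open>The leaf \<open>r\<close> gets colour \<open>0\<close>, and it is the neighbour on both sides, which no exception of
\<open>low_extends\<close> excludes.\<close>
theorem cubic_tree_coloring:
  assumes "binary t" "\<not> is_leaf t"
  shows "\<exists>C ws. cubic_coloring t {0, 3, 4, 5} 0 C ws \<and> fits (Some 0) ws (Some 0)"
  using extension_lemma[OF assms] unfolding low_extends_def clash_def by auto

lemma tree_colors_cong: "(\<And>x. x \<in> set (preorder t) \<Longrightarrow> \<kappa> x = \<kappa>' x) \<Longrightarrow> tree_colors \<kappa> t = tree_colors \<kappa>' t"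
proof (cases t)
  case (Nd v ts)
  assume a: "\<And>x. x \<in> set (preorder t) \<Longrightarrow> \<kappa> x = \<kappa>' x"
  have "\<kappa> (rt s) = \<kappa>' (rt s)" if "s \<in> set ts" for s
    using a[of "rt s"] that root_in_preorder[OF self_subtree[of s]] Nd by auto
  then show ?thesis using a[of v] Nd by (auto simp: tree_colors_def)
qed

lemma star_colored_cong:
  "(\<And>x. x \<in> set (preorder t) \<Longrightarrow> \<kappa> x = \<kappa>' x) \<Longrightarrow> star_colored \<kappa> E P t = star_colored \<kappa>' E P t"
proof (induction t arbitrary: P)
  case (Nd v ts)
  have sub: "\<kappa> x = \<kappa>' x" if "s \<in> set ts" "x \<in> set (preorder s)" for s x using Nd(2) that by auto
  have r: "\<kappa> (rt s) = \<kappa>' (rt s)" if "s \<in> set ts" for s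
    using sub[OF that root_in_preorder[OF self_subtree]] .
  have v: "\<kappa> v = \<kappa>' v" using Nd(2) by simp
  have c: "all_colors \<kappa> E s = all_colors \<kappa>' E s" if "s \<in> set ts" for s
    using tree_colors_cong[of s \<kappa> \<kappa>'] sub[OF that] by (simp add: all_colors_def)
  have "all_colors \<kappa> E (Nd v ts) = all_colors \<kappa>' E (Nd v ts)"
    using tree_colors_cong[of "Nd v ts" \<kappa> \<kappa>'] Nd(2) by (simp add: all_colors_def)
  have "map (\<kappa> \<circ> rt) ts = map (\<kappa>' \<circ> rt) ts" using r by simp
  then have "distinct (map (\<kappa> \<circ> rt) ts) = distinct (map (\<kappa>' \<circ> rt) ts)" by (rule arg_cong)
  then have "star_colored_at \<kappa> E P (Nd v ts) = star_colored_at \<kappa>' E P (Nd v ts)"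
    unfolding star_colored_at_def using r v c by (simp cong: ball_cong)
  moreover have "star_colored \<kappa> E Q s = star_colored \<kappa>' E Q s" if "s \<in> set ts" for s Q
    using Nd(1)[OF that] sub[OF that] by blast
  ultimately show ?case using \<open>all_colors \<kappa> E (Nd v ts) = all_colors \<kappa>' E (Nd v ts)\<close> by simp
qed

lemma star_colored_antimono: "star_colored \<kappa> E P t \<Longrightarrow> P' \<subseteq> P \<Longrightarrow> star_colored \<kappa> E P' t"
  by (cases t) (auto simp: star_colored_at_def)

lemma tree_colors_node: "tree_colors \<kappa> (Nd v ts) = insert (\<kappa> v) ((\<lambda>s. \<kappa> (rt s)) ` set ts)"
  by (simp add: tree_colors_def)

text \<open>The colour choices for the subtrees combine to one function because the vertices are distinct.\<close>
lemma cubic_coloring_realize: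
  assumes "cubic_coloring t P \<alpha> C ws" "distinct (preorder t)"
  shows "\<exists>\<kappa>. \<kappa> (rt t) = \<alpha> \<and> tree_colors \<kappa> t = C \<and> map \<kappa> (leaf_list t) = ws \<and> (\<forall>x\<in>set (preorder t). \<kappa> x < 6) \<and>
    (\<forall>x\<in>set (leaf_list t). \<kappa> x < 3) \<and> (\<forall>E. (\<forall>v. E v \<subseteq> {3..}) \<longrightarrow> star_colored \<kappa> E P t)"
  using assms
proof (induction rule: cubic_coloring.induct)
  case (leaf x v P)
  then show ?case by (intro exI[of _ "\<lambda>_. x"]) (auto simp: tree_colors_def star_colored_at_def)
next
  case (node s1 \<alpha> \<beta> \<gamma> C1 w1 s2 C2 w2 P v)
  have d: "distinct (preorder s1)" "distinct (preorder s2)" "v \<notin> set (preorder s1)" "v \<notin> set (preorder s2)"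
    "set (preorder s1) \<inter> set (preorder s2) = {}" using node.prems by auto
  obtain k1 where k1: "k1 (rt s1) = \<beta>" "tree_colors k1 s1 = C1" "map k1 (leaf_list s1) = w1" "\<forall>x\<in>set (preorder s1). k1 x < 6"
    "\<forall>x\<in>set (leaf_list s1). k1 x < 3" "\<And>E. (\<forall>v. E v \<subseteq> {3..}) \<Longrightarrow> star_colored k1 E {\<alpha>, \<beta>, \<gamma>} s1"
    using node.IH(1)[OF d(1)] by blast
  obtain k2 where k2: "k2 (rt s2) = \<gamma>" "tree_colors k2 s2 = C2" "map k2 (leaf_list s2) = w2" "\<forall>x\<in>set (preorder s2). k2 x < 6"
    "\<forall>x\<in>set (leaf_list s2). k2 x < 3" "\<And>E. (\<forall>v. E v \<subseteq> {3..}) \<Longrightarrow> star_colored k2 E {\<alpha>, \<beta>, \<gamma>} s2"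
    using node.IH(2)[OF d(2)] by blast
  define \<kappa> where "\<kappa> x = (if x \<in> set (preorder s1) then k1 x else if x \<in> set (preorder s2) then k2 x else \<alpha>)" for x
  have kv: "\<kappa> v = \<alpha>" using d by (simp add: \<kappa>_def)
  have e1: "\<kappa> x = k1 x" if "x \<in> set (preorder s1)" for x using that by (simp add: \<kappa>_def)
  have e2: "\<kappa> x = k2 x" if "x \<in> set (preorder s2)" for x using that d(5) by (auto simp: \<kappa>_def)
  have lvs: "set (leaf_list s) \<subseteq> set (preorder s)" for s :: "'a plane_tree" using set_leaf_list[of s] root_in_preorder by auto
  have m: "map \<kappa> (leaf_list s1) = w1" "map \<kappa> (leaf_list s2) = w2" using k1(3) k2(3) e1 e2 lvs by (auto intro!: map_cong)
  have r: "\<kappa> (rt s1) = \<beta>" "\<kappa> (rt s2) = \<gamma>" using e1 e2 k1(1) k2(1) root_in_preorder[OF self_subtree] by metis+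
  have c: "tree_colors \<kappa> s1 = C1" "tree_colors \<kappa> s2 = C2" using tree_colors_cong[of s1 \<kappa> k1] tree_colors_cong[of s2 \<kappa> k2] e1 e2 k1(2) k2(2) by auto
  have l1: "\<beta> < 3" if "subs s1 = []" using that k1(1,5) by (cases s1) auto
  have l2: "\<gamma> < 3" if "subs s2 = []" using that k2(1,5) by (cases s2) auto
  have "star_colored \<kappa> E P (Nd v [s1, s2])" if E: "\<forall>v. E v \<subseteq> {3..}" for E
  proof -
    have g: "star_colored \<kappa> E {\<alpha>, \<beta>, \<gamma>} s1" "star_colored \<kappa> E {\<alpha>, \<beta>, \<gamma>} s2"
      using star_colored_cong[of s1 \<kappa> k1 E] star_colored_cong[of s2 \<kappa> k2 E] e1 e2 k1(6)[OF E] k2(6)[OF E] by auto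
    have ge: "x \<ge> 3" if "x \<in> E w" for x w using E that by blast
    have X1: "all_colors \<kappa> E s1 \<subseteq> C1 \<union> (if subs s1 = [] then {3..} else {})"
      and X2: "all_colors \<kappa> E s2 \<subseteq> C2 \<union> (if subs s2 = [] then {3..} else {})"
      using c ge by (auto simp: all_colors_def)
    have a1: "\<not> (\<beta> \<in> P \<and> \<alpha> \<in> all_colors \<kappa> E s1)" using X1 node.hyps by (auto split: if_splits)
    have a2: "\<not> (\<gamma> \<in> P \<and> \<alpha> \<in> all_colors \<kappa> E s2)" using X2 node.hyps by (auto split: if_splits)
    have a3: "\<not> (\<gamma> \<in> all_colors \<kappa> E s1 \<and> \<beta> \<in> all_colors \<kappa> E s2)"
    proof
      assume "\<gamma> \<in> all_colors \<kappa> E s1 \<and> \<beta> \<in> all_colors \<kappa> E s2"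
      then have "\<gamma> \<in> C1 \<or> subs s1 = [] \<and> \<gamma> \<ge> 3" "\<beta> \<in> C2 \<or> subs s2 = [] \<and> \<beta> \<ge> 3"
        using X1 X2 by (auto split: if_splits)
      then show False using node.hyps l1 l2 by auto
    qed
    have "star_colored_at \<kappa> E P (Nd v [s1, s2])"
      unfolding star_colored_at_def using r kv a1 a2 a3 node.hyps by auto
    moreover have "all_colors \<kappa> E (Nd v [s1, s2]) = {\<alpha>, \<beta>, \<gamma>}" using r kv by (auto simp: all_colors_def tree_colors_node)
    ultimately show ?thesis using g by simp
  qed
  moreover have "\<forall>x\<in>set (preorder (Nd v [s1, s2])). \<kappa> x < 6" using e1 e2 k1(4) k2(4) kv node.hyps(3) by auto
  moreover have "\<forall>x\<in>set (leaf_list (Nd v [s1, s2])). \<kappa> x < 3" using e1 e2 k1(5) k2(5) lvs[of s1] lvs[of s2] by auto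
  moreover have "tree_colors \<kappa> (Nd v [s1, s2]) = {\<alpha>, \<beta>, \<gamma>}" using r kv by (simp add: tree_colors_node)
  ultimately show ?case using kv m by (intro exI[of _ \<kappa>]) auto
qed

section \<open>The rim word and cubic Halin graphs\<close>

text \<open>The cyclic word with \<open>n mod 3\<close> blocks \<open>0102\<close> followed by blocks \<open>012\<close>. There is enough room for
these blocks unless \<open>n = 5\<close>.\<close>
definition rim_word :: "nat \<Rightarrow> nat \<Rightarrow> nat" where
  "rim_word n i = (let k = 4 * (n mod 3) in
     if i < k then (if i mod 4 = 1 then 1 else if i mod 4 = 3 then 2 else 0) else (i - k) mod 3)"

context ring_tree
begin

lemma nx_eq: "i < n \<Longrightarrow> nx i = (if Suc i = n then 0 else Suc i)"
  using dist(4) by (auto simp: nx_def)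

lemma rim_word:
  assumes n5: "n \<noteq> 5" and i: "i < n"
  shows "rim_word n i \<noteq> rim_word n (nx i)"
    and "rim_word n (nx i) = 0 \<Longrightarrow> rim_word n i \<noteq> rim_word n (nx (nx i))"
    and "rim_word n i = 0 \<or> rim_word n (nx i) = 0 \<or> rim_word n (nx (nx i)) = 0"
    and "rim_word n i < 3"
proof -
  have n3: "n \<ge> 3" using dist(4) .
  have "\<exists>s. n = 3 * s \<and> n mod 3 = 0 \<and> s \<ge> 1 \<or> n = 4 + 3 * s \<and> n mod 3 = 1 \<or> n = 8 + 3 * s \<and> n mod 3 = 2"
    using n3 n5 by presburger
  then obtain s where
    "n = 3 * s \<and> n mod 3 = 0 \<and> s \<ge> 1 \<or> n = 4 + 3 * s \<and> n mod 3 = 1 \<or> n = 8 + 3 * s \<and> n mod 3 = 2" ..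
  then have cases: "n mod 3 = 0 \<or> n = 4 + 3 * s \<and> n mod 3 = 1 \<or> n = 8 + 3 * s \<and> n mod 3 = 2"
    by metis
  define wd where "wd = rim_word n"
  have tail: "wd i \<noteq> wd (nx i) \<and> (wd (nx i) = 0 \<longrightarrow> wd i \<noteq> wd (nx (nx i))) \<and>
      (wd i = 0 \<or> wd (nx i) = 0 \<or> wd (nx (nx i)) = 0) \<and> wd i < 3"
    if k: "i \<ge> k" "(n - k) mod 3 = 0" "\<forall>j\<ge>k. wd j = (j - k) mod 3" "wd 0 = 0" "wd 1 = 1" for k
  proof -
    have nw: "wd (nx j) = Suc (j - k) mod 3" if "j < n" "j \<ge> k" for j
    proof (cases "Suc j = n")
      case True
      then have "Suc (j - k) = n - k" using that by linarith
      then show ?thesis using True that(1) k(2,4) by (simp add: nx_eq)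
    next
      case False then show ?thesis using that k(3) by (simp add: nx_eq Suc_diff_le)
    qed
    have nn: "wd (nx (nx i)) = Suc (Suc (i - k)) mod 3"
    proof (cases "Suc i = n")
      case True
      then have "Suc (i - k) = n - k" using k(1) by linarith
      then have "Suc (Suc (i - k)) mod 3 = 1" using k(2) by (simp add: mod_Suc)
      then show ?thesis using True i n3 k(5) by (simp add: nx_eq)
    next
      case False
      then show ?thesis using nw[of "Suc i"] i k(1) by (simp add: nx_eq Suc_diff_le)
    qed
    have "wd i = (i - k) mod 3" using k(1,3) by blast
    then show ?thesis unfolding nn nw[OF i k(1)] by (auto simp: mod_Suc)
  qed
  have "wd i \<noteq> wd (nx i) \<and>
    (wd (nx i) = 0 \<longrightarrow> wd i \<noteq> wd (nx (nx i))) \<and>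
    (wd i = 0 \<or> wd (nx i) = 0 \<or> wd (nx (nx i)) = 0) \<and> wd i < 3"
    using cases
  proof (elim disjE conjE)
    assume 1: "n mod 3 = 0"
    then show ?thesis using tail[of 0] n3 by (simp add: wd_def rim_word_def)
  next
    assume 2: "n = 4 + 3 * s" "n mod 3 = 1"
    have w: "wd j = (if j < 4 then (if j = 1 then 1 else if j = 3 then 2 else 0) else (j - 4) mod 3)" for j
      using 2(2) by (auto simp: wd_def rim_word_def)
    show ?thesis
    proof (cases "i \<ge> 4")
      case True then show ?thesis using tail[of 4] 2(1) by (simp add: w)
    next
      case False
      then consider "i = 0" | "i = 1" | "i = 2" | "i = 3" by linarith
      then show ?thesis using 2(1) by cases (auto simp: w nx_eq)
    qed
  next
    assume 3: "n = 8 + 3 * s" "n mod 3 = 2"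
    have w: "wd j = (if j < 8 then (if j = 1 \<or> j = 5 then 1 else if j = 3 \<or> j = 7 then 2 else 0) else (j - 8) mod 3)" for j
    proof -
      have "j = 0 \<or> j = 1 \<or> j = 2 \<or> j = 3 \<or> j = 4 \<or> j = 5 \<or> j = 6 \<or> j = 7 \<or> j \<ge> 8" by linarith
      then show ?thesis using 3(2) by (auto simp: wd_def rim_word_def)
    qed
    show ?thesis
    proof (cases "i \<ge> 8")
      case True then show ?thesis using tail[of 8] 3(1) by (simp add: w)
    next
      case False
      then consider "i = 0" | "i = 1" | "i = 2" | "i = 3" | "i = 4" | "i = 5" | "i = 6" | "i = 7" by linarith
      then show ?thesis using 3(1) by cases (auto simp: w nx_eq)
    qed
  qed
  then show "rim_word n i \<noteq> rim_word n (nx i)"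
    and "rim_word n (nx i) = 0 \<Longrightarrow> rim_word n i \<noteq> rim_word n (nx (nx i))"
    and "rim_word n i = 0 \<or> rim_word n (nx i) = 0 \<or> rim_word n (nx (nx i)) = 0"
    and "rim_word n i < 3" unfolding wd_def by auto
qed

text \<open>A condition on neighbouring leaves may be checked along the list that starts and ends with \<open>r\<close>.\<close>
lemma successive_on_rim:
  assumes s: "successively P (g r # map g (leaf_list t) @ [g r])" and i: "i < n"
  shows "P (g (q ! i)) (g (q ! nx i))"
proof -
  let ?w = "g r # map g (leaf_list t) @ [g r]"
  have w: "?w = map g q @ [g (q ! 0)]" by (simp add: q_def)
  have len: "length ?w = Suc n" by (simp add: n_def q_def)
  have lc: "?w ! j = g (q ! j)" if "j < n" for j
    using that unfolding w by (simp add: nth_append n_def)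
  have "?w ! Suc i = g (q ! nx i)"
  proof (cases "Suc i = n")
    case True
    then have "?w ! Suc i = g (q ! 0)" unfolding w by (simp add: nth_append n_def)
    then show ?thesis using True i by (simp add: nx_eq)
  next
    case False then show ?thesis using lc[of "Suc i"] i by (simp add: nx_eq)
  qed
  moreover have "P (?w ! i) (?w ! Suc i)" using s len i unfolding successively_conv_nth by auto
  ultimately show ?thesis using lc[OF i] by simp
qed

lemma leaf_color_eq: "i < n \<Longrightarrow> leaf_color \<kappa> i = (if q ! i = r then \<kappa> (rt t) else \<kappa> (q ! i))"
  using q_inj[of i 0] q0 by (auto simp: leaf_color_def)

lemma leaf_color_fits:
  assumes f: "fits (Some (\<kappa> (rt t))) (map \<kappa> (leaf_list t)) (Some (\<kappa> (rt t)))" and i: "i < n"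
  shows "leaf_color \<kappa> i \<noteq> leaf_color \<kappa> (nx i)"
proof -
  define g where "g v = (if v = r then \<kappa> (rt t) else \<kappa> v)" for v
  have "set (leaf_list t) \<subseteq> set (preorder t)" using set_leaf_list[of t] root_in_preorder by auto
  then have m: "map g (leaf_list t) = map \<kappa> (leaf_list t)" using dist(2) by (auto simp: g_def)
  have "g r = \<kappa> (rt t)" by (simp add: g_def)
  then have "successively (\<noteq>) (g r # map g (leaf_list t) @ [g r])"
    using f unfolding m by (simp add: fits_def distinct_adj_def)
  from successive_on_rim[OF this i] show ?thesis
    using leaf_color_eq[OF i] leaf_color_eq[OF nx_pv(1)[OF i]] by (simp add: g_def)
qed

lemma colorableI:
  assumes star: "star_edge_coloring G (edge_color \<kappa> \<epsilon>)"
    and "\<And>v. v \<in> set (preorder t) \<Longrightarrow> \<kappa> v < K" "\<And>i. i < n \<Longrightarrow> \<epsilon> i < K"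
  shows "star_edge_colorable G K"
proof -
  have "edge_color \<kappa> \<epsilon> e < K" if "e \<in> edges G" for e
  proof -
    from that consider p v where "(p, v) \<in> par_arcs" "e = {p, v}" | i where "i < n" "e = {q ! i, q ! nx i}"
      unfolding edges_G by auto
    then show ?thesis
    proof cases
      case 1
      then have "v \<in> set (preorder t)" using rt_in(1) self_subtree child_subtree unfolding par_arcs_iff by metis
      then show ?thesis using edge_color_arc[OF 1(1)] 1(2) assms(2) by simp
    next
      case 2 then show ?thesis using edge_color_rim[OF 2(1)] assms(3) by simp
    qed
  qed
  then show ?thesis using star unfolding star_edge_colorable_def by (intro exI[of _ "edge_color \<kappa> \<epsilon>"]) auto
qed

lemma binary_if_cubic: "D = 3 \<Longrightarrow> binary t"
proof -
  assume D: "D = 3"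
  have "length (subs u) = 2" if "u \<in> subtrees t" "subs u \<noteq> []" for u
    using rep that D unfolding plane_rep_def by fastforce
  moreover have "(\<And>u. u \<in> subtrees w \<Longrightarrow> subs u \<noteq> [] \<Longrightarrow> length (subs u) = 2) \<Longrightarrow> binary w" for w :: "'a plane_tree"
  proof (induction w)
    case (Nd v ts)
    have "binary s" if "s \<in> set ts" for s using Nd(1)[OF that] Nd(2) that by auto
    moreover have "ts = [] \<or> length ts = 2" using Nd(2)[of "Nd v ts"] by auto
    ultimately show ?case by simp
  qed
  ultimately show ?thesis by blast
qed

text \<open>The colours of leaf edges are low, those of rim edges are high and consecutive leaf edges differ, so only \<open>l3\<close> is left. There the
word helps: of three consecutive rim
edges one has letter \<open>0\<close>, and the two edges next to it have different colours.\<close>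
lemma cubic_colorable:
  assumes D: "binary t" and n5: "n \<noteq> 5"
  shows "star_edge_colorable G 6"
proof -
  have "\<not> is_leaf t" using dist(5) by (simp add: is_leaf_def)
  then obtain C ws where r: "cubic_coloring t {0, 3, 4, 5} 0 C ws" "fits (Some 0) ws (Some 0)"
    using cubic_tree_coloring D by blast
  obtain \<kappa> where \<kappa>: "\<kappa> (rt t) = 0" "map \<kappa> (leaf_list t) = ws" "\<forall>x\<in>set (preorder t). \<kappa> x < 6" "\<forall>x\<in>set (leaf_list t). \<kappa> x < 3"
    "\<And>E. (\<forall>v. E v \<subseteq> {3..}) \<Longrightarrow> star_colored \<kappa> E {0, 3, 4, 5} t"
    using cubic_coloring_realize[OF r(1) dist(1)] by blast
  define \<epsilon> where "\<epsilon> i = rim_word n i + 3" for i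
  have e: "3 \<le> \<epsilon> i \<and> \<epsilon> i \<le> 5" if "i < n" for i using rim_word(4)[OF n5 that] by (auto simp: \<epsilon>_def)
  have rimE: "rim \<epsilon> v \<subseteq> {3..5}" for v using e by (auto simp: rim_def)
  have lc: "leaf_color \<kappa> i < 3" if "i < n" for i
  proof (cases "i = 0")
    case False
    then have "q ! i \<in> set (leaf_list t)" using that by (auto simp: q_def n_def nth_Cons split: nat.splits)
    then show ?thesis using \<kappa>(4) False by (simp add: leaf_color_def)
  qed (use \<kappa>(1) in \<open>simp add: leaf_color_def\<close>)
  have lcd: "leaf_color \<kappa> i \<noteq> leaf_color \<kappa> (nx i)" if "i < n" for i
    using leaf_color_fits[OF _ that, of \<kappa>] r(2) \<kappa>(1,2) by simp
  have star: "star_edge_coloring G (edge_color \<kappa> \<epsilon>)"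
  proof (rule glue_star_edge_coloring)
    have 1: "star_colored \<kappa> (rim \<epsilon>) {0, 3, 4, 5} t"
    proof (rule \<kappa>(5), intro allI)
      show "rim \<epsilon> v \<subseteq> {3..}" for v using rimE[of v] by auto
    qed
    have "{3..5} = {3, 4, 5::nat}" by auto
    then show "star_colored \<kappa> (rim \<epsilon>) (insert (\<kappa> (rt t)) (rim \<epsilon> r)) t"
      using star_colored_antimono[OF 1, of "insert (\<kappa> (rt t)) (rim \<epsilon> r)"] rimE[of r] \<kappa>(1) by auto
  next
    fix i assume i: "i < n"
    show "\<epsilon> i \<noteq> leaf_color \<kappa> i \<and> \<epsilon> i \<noteq> leaf_color \<kappa> (nx i) \<and> \<epsilon> i \<noteq> \<epsilon> (nx i)"
      using e[OF i] lc[OF i] lc[OF nx_pv(1)[OF i]] rim_word(1)[OF n5 i] by (auto simp: \<epsilon>_def)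
  next
    fix i u assume i: "i < n"
    show "leaf_color \<kappa> i \<noteq> leaf_color \<kappa> (nx i) \<and> leaf_color \<kappa> i \<noteq> \<epsilon> (nx i)"
      using lcd[OF i] lc[OF i] e[OF nx_pv(1)[OF i]] by auto
    show "leaf_color \<kappa> (nx i) \<noteq> leaf_color \<kappa> i \<and> leaf_color \<kappa> (nx i) \<noteq> \<epsilon> (pv i)"
      using lcd[OF i] lc[OF nx_pv(1)[OF i]] e[OF nx_pv(2)[OF i]] by auto
  next
    fix i assume i: "i < n"
    have p: "pv i < n" "nx (pv i) = i" "nx i < n" using nx_pv[OF i] by auto
    have "\<not> (\<epsilon> (nx i) = \<epsilon> (pv i) \<and> \<epsilon> i = \<epsilon> (nx (nx i)))"
    proof
      assume a: "\<epsilon> (nx i) = \<epsilon> (pv i) \<and> \<epsilon> i = \<epsilon> (nx (nx i))"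
      have "rim_word n (pv i) = 0 \<or> rim_word n i = 0 \<or> rim_word n (nx i) = 0"
        using rim_word(3)[OF n5 p(1)] p by simp
      then show False using a rim_word(2)[OF n5 p(1)] rim_word(2)[OF n5 i] p by (auto simp: \<epsilon>_def)
    qed
    then show "\<not> ((\<epsilon> (nx i) = leaf_color \<kappa> i \<or> \<epsilon> (nx i) = \<epsilon> (pv i)) \<and>
      (\<epsilon> i = leaf_color \<kappa> (nx (nx i)) \<or> \<epsilon> i = \<epsilon> (nx (nx i))))"
      using e[OF i] e[OF p(3)] lc[OF i] lc[OF nx_pv(1)[OF p(3)]] by auto
  qed
  have "\<epsilon> i < 6" if "i < n" for i using e[OF that] by simp
  then show ?thesis using colorableI[OF star] \<kappa>(3) by blast
qed

end

section \<open>Large degree: ordering the palette at a vertex\<close>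

lemma successively_concat:
  assumes "\<And>w. w \<in> set ws \<Longrightarrow> w \<noteq> [] \<and> successively P w"
    and "successively (\<lambda>w w'. P (last w) (hd w')) ws"
  shows "successively P (concat ws)"
  using assms
proof (induction ws rule: induct_list012)
  case (3 x y zs)
  have "hd (concat (y # zs)) = hd y" using 3(3)[of y] by simp
  then show ?case using 3 by (simp add: successively_append_iff)
qed auto

lemma star_colored_mono:
  "star_colored \<kappa> E P t \<Longrightarrow> (\<And>v. v \<in> set (preorder t) \<Longrightarrow> E' v \<subseteq> E v) \<Longrightarrow> star_colored \<kappa> E' P t"
proof (induction t arbitrary: P)
  case (Nd v ts)
  have sub: "E' x \<subseteq> E x" if "s \<in> set ts" "x \<in> set (preorder s)" for s x using Nd(3)[of x] that by auto
  have c: "all_colors \<kappa> E' s \<subseteq> all_colors \<kappa> E s" if "s \<in> set ts" for s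
    using sub[OF that root_in_preorder[OF self_subtree]] by (auto simp: all_colors_def)
  have C: "all_colors \<kappa> E' (Nd v ts) \<subseteq> all_colors \<kappa> E (Nd v ts)" using Nd(3)[of v] by (auto simp: all_colors_def)
  have "star_colored_at \<kappa> E P (Nd v ts)" using Nd(2) by simp
  then have "star_colored_at \<kappa> E' P (Nd v ts)" unfolding star_colored_at_def using c by fastforce
  moreover have "star_colored \<kappa> E' (all_colors \<kappa> E' (Nd v ts)) s" if "s \<in> set ts" for s
  proof (rule Nd(1)[OF that _ sub[OF that]])
    show "star_colored \<kappa> E (all_colors \<kappa> E' (Nd v ts)) s"
      by (rule star_colored_antimono[OF _ C]) (use Nd(2) that in simp)
  qed
  ultimately show ?case by simp
qed

lemma star_colored_cong_rim:
  assumes "\<And>v. v \<in> set (preorder t) \<Longrightarrow> E' v = E v"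
  shows "star_colored \<kappa> E P t = star_colored \<kappa> E' P t"
  using star_colored_mono[of \<kappa> E P t E'] star_colored_mono[of \<kappa> E' P t E] assms by auto

locale palette =
  fixes D :: nat
  assumes D4: "D \<ge> 4"
begin

text \<open>The tree is coloured with \<open>k\<close> colours; \<open>h\<close> is the reach within a cyclic list of \<open>D\<close> colours, and \<open>b\<close>
bounds the number of colours blocked at the first and last leaf of a subtree.\<close>
definition "h = (D - 1) div 2"
definition "k = 3 * D div 2"
definition "b = (if D = 4 then 2 else D div 2 + 1)"

lemma hD: "h + 1 + D div 2 = D" "2 * h < D" "h \<ge> 1" "D + D div 2 = k" "h \<le> D div 2" "b + b < k" "D div 2 + 1 + b < k"
proof -
  consider m where "D = 2 * m" "m \<ge> 2" | m where "D = Suc (2 * m)" "m \<ge> 2"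
  proof (cases "even D")
    case True
    then show ?thesis using D4 that(1)[of "D div 2"] by auto
  next
    case False
    then show ?thesis using D4 that(2)[of "D div 2"] by auto
  qed
  then show "h + 1 + D div 2 = D" "2 * h < D" "h \<ge> 1" "D + D div 2 = k" "h \<le> D div 2" "b + b < k" "D div 2 + 1 + b < k"
    unfolding h_def k_def b_def by (cases; auto)+
qed

text \<open>The colours available at a vertex: \<open>hd A\<close> is the colour of its parent edge, \<open>A\<close> contains the colours it shares
with the list of its parent, and the colours in \<open>O'\<close> do not occur at the parent.\<close>
definition valid :: "nat list \<Rightarrow> nat set \<Rightarrow> bool" where
  "valid A O' \<longleftrightarrow> length A = h + 1 \<and> distinct A \<and> finite O' \<and> card O' = D div 2 \<and> set A \<inter> O' = {} \<and>
     set A \<union> O' \<subseteq> {..<k}"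

text \<open>Colours for \<open>m\<close> children that respect the colours \<open>L\<close>, \<open>R\<close> of the adjacent leaves.\<close>
lemma choose_colors:
  assumes v: "valid A O'" and m: "2 \<le> m" "m < D"
  shows "\<exists>cs. length cs = m \<and> distinct cs \<and> set cs \<subseteq> set A \<union> O' - {hd A} \<and>
    L \<noteq> Some (hd cs) \<and> R \<noteq> Some (last cs)"
proof -
  define S where "S = set A \<union> O' - {hd A}"
  have A: "A \<noteq> []" "finite S" using v by (auto simp: valid_def S_def)
  have "card (set A \<union> O') = D" using v hD(1) by (simp add: valid_def card_Un_disjoint distinct_card)
  then have cS: "card S = D - 1" using A(1) v by (simp add: S_def valid_def)
  have pick: "\<exists>x\<in>S - F. Z \<noteq> Some x" if "finite F" "card F \<le> 1" for F and Z :: "nat option"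
  proof -
    have "card (S - F - (case Z of None \<Rightarrow> {} | Some z \<Rightarrow> {z})) \<ge> card S - card F - 1"
    proof -
      have "card (case Z of None \<Rightarrow> {} | Some z \<Rightarrow> {z}) \<le> 1" by (cases Z) auto
      moreover have "finite (case Z of None \<Rightarrow> {} | Some z \<Rightarrow> {z})" by (cases Z) auto
      ultimately show ?thesis using diff_card_le_card_Diff[of F S]
          diff_card_le_card_Diff[of "case Z of None \<Rightarrow> {} | Some z \<Rightarrow> {z}" "S - F"] that(1) by linarith
    qed
    then have "card (S - F - (case Z of None \<Rightarrow> {} | Some z \<Rightarrow> {z})) > 0" using cS D4 that(2) by linarith
    then obtain x where "x \<in> S - F - (case Z of None \<Rightarrow> {} | Some z \<Rightarrow> {z})" by (metis card_gt_0_iff ex_in_conv)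
    then show ?thesis by (intro bexI[of _ x]) (auto split: option.splits)
  qed
  obtain x where x: "x \<in> S" "L \<noteq> Some x" using pick[of "{}" L] by auto
  obtain y where y: "y \<in> S" "y \<noteq> x" "R \<noteq> Some y" using pick[of "{x}" R] by auto
  have "card (S - {x, y}) = D - 3" using cS x y A(2) by (simp add: card_Diff_subset)
  then obtain B where B: "B \<subseteq> S - {x, y}" "card B = m - 2" "finite B"
    using obtain_subset_with_card_n[of "m - 2" "S - {x, y}"] m by (metis diff_le_mono finite_subset finite_Diff A(2)
        Suc_leI diff_Suc_eq_diff_pred numeral_2_eq_2 numeral_3_eq_3 diff_Suc_1 le_diff_conv)
  obtain ds where ds: "set ds = B" "distinct ds" using finite_distinct_list[OF B(3)] by blast
  then have "length ds = m - 2" using B(2) distinct_card by metis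
  then show ?thesis using ds B(1) x y m unfolding S_def[symmetric]
    by (intro exI[of _ "x # ds @ [y]"]) auto
qed

text \<open>The list \<open>A @ os\<close> arranges the colours at a vertex in \<open>D\<close> cyclic slots; \<open>cs\<close> are the colours of its children and
\<open>fl c\<close> says that the child with colour \<open>c\<close> is a leaf. For a leaf, \<open>X c\<close> is the set of colours which the rim must avoid there.
It contains the colours in the \<open>h\<close> slots before \<open>c\<close>, as inner children in these slots may see \<open>c\<close>. Of any two leaves at
least one avoids the colour of the other. The remaining conditions bound the number of blocked colours, so that every rim edge between
neighbouring leaves has a colour left.\<close>
definition ordering :: "nat list \<Rightarrow> nat set \<Rightarrow> nat list \<Rightarrow> (nat \<Rightarrow> bool) \<Rightarrow> nat list \<Rightarrow> (nat \<Rightarrow> nat set) \<Rightarrow> bool" where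
  "ordering A O' cs fl os X \<longleftrightarrow> set os = O' \<and> distinct os \<and>
    (\<forall>c\<in>set cs. fl c \<longrightarrow> c \<in> X c \<and> X c \<subseteq> {..<k}) \<and>
    (\<forall>i j e. i < D \<longrightarrow> j < D \<longrightarrow> 1 \<le> e \<longrightarrow> e \<le> h \<longrightarrow> j = (i + e) mod D \<longrightarrow> (A @ os) ! j \<in> set cs \<longrightarrow>
       fl ((A @ os) ! j) \<longrightarrow> (A @ os) ! i \<in> X ((A @ os) ! j)) \<and>
    (\<forall>c\<in>set cs. \<forall>c'\<in>set cs. fl c \<longrightarrow> fl c' \<longrightarrow> c \<noteq> c' \<longrightarrow> c' \<in> X c \<or> c \<in> X c') \<and>
    (\<forall>c\<in>set cs. fl c \<longrightarrow> (c = hd cs \<or> c = last cs \<or> (\<exists>c'\<in>set cs. \<not> fl c')) \<longrightarrow> card (X c) \<le> b) \<and>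
    (\<forall>i. Suc i < length cs \<longrightarrow> fl (cs ! i) \<longrightarrow> fl (cs ! Suc i) \<longrightarrow> card (X (cs ! i)) + card (X (cs ! Suc i)) < k)"

text \<open>Each leaf blocks its own slot and the \<open>D div 2\<close> slots before it. Of two slots one is within this distance
before the other.\<close>
lemma ordering_large:
  assumes v: "valid A O'" and cs: "distinct cs" "set cs \<subseteq> set A \<union> O' - {hd A}" and D5: "D \<noteq> 4"
  shows "\<exists>os X. ordering A O' cs fl os X"
proof -
  obtain os where os: "set os = O'" "distinct os" using v finite_distinct_list[of O'] by (auto simp: valid_def)
  define s where "s = A @ os"
  have s: "length s = D" "distinct s" "set s = set A \<union> O'" "set s \<subseteq> {..<k}"
    using v os distinct_card[OF os(2)] hD(1) by (auto simp: s_def valid_def)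
  define X where "X c = {s ! i |i. i < D \<and> (\<exists>e\<le>D div 2. \<exists>j<D. c = s ! j \<and> j = (i + e) mod D)}" for c
  have Xin: "s ! i \<in> X (s ! j)" if "i < D" "j < D" "e \<le> D div 2" "j = (i + e) mod D" for i j e
    using that unfolding X_def by blast
  have Xk: "X c \<subseteq> {..<k}" for c using s unfolding X_def by (force dest: nth_mem)
  have Xcard: "card (X (s ! j)) \<le> D div 2 + 1" if j: "j < D" for j
  proof -
    have "X (s ! j) \<subseteq> (\<lambda>e. s ! ((j + D - e) mod D)) ` {..D div 2}"
    proof
      fix x assume "x \<in> X (s ! j)"
      then obtain i e j' where 1: "x = s ! i" "i < D" "e \<le> D div 2" "j' < D" "s ! j = s ! j'" "j' = (i + e) mod D"
        unfolding X_def by blast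
      then have jj: "j' = j" using s(1,2) j by (simp add: nth_eq_iff_index_eq)
      have eD: "e \<le> D" using 1(3) by linarith
      have "(j + D - e) mod D = i"
      proof (cases "i + e < D")
        case True
        then have "j = i + e" using 1(6) jj by simp
        then have "j + D - e = i + D" by linarith
        then show ?thesis using 1(2) by simp
      next
        case False
        have "i + e < D + D" using 1(2) eD D4 1(3) by linarith
        then have "j = i + e - D" using 1(6) jj False by (simp add: mod_if)
        then have "j + D - e = i" using False by linarith
        then show ?thesis using 1(2) by simp
      qed
      then show "x \<in> (\<lambda>e. s ! ((j + D - e) mod D)) ` {..D div 2}" using 1 by blast
    qed
    then have "card (X (s ! j)) \<le> card {..D div 2}" by (meson finite_atMost surj_card_le)
    then show ?thesis by simp
  qed
  have idx: "\<exists>j<D. c = s ! j" if "c \<in> set cs" for c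
  proof -
    have "c \<in> set s" using that cs(2) s(3) by blast
    then show ?thesis using s(1) by (metis in_set_conv_nth)
  qed
  have b: "b = D div 2 + 1" using D5 by (simp add: b_def)
  \<comment> \<open>the cyclic distance of two slots is at most \<open>D div 2\<close> in one of the directions\<close>
  have tour: "s ! i \<in> X (s ! j) \<or> s ! j \<in> X (s ! i)" if "i < D" "j < D" "i < j" for i j
  proof (cases "j - i \<le> D div 2")
    case True then show ?thesis using Xin[of i j "j - i"] that by simp
  next
    case False
    then have "D - (j - i) \<le> D div 2" by linarith
    moreover have "i = (j + (D - (j - i))) mod D" using that by simp
    ultimately show ?thesis using Xin[of j i "D - (j - i)"] that by blast
  qed
  have "ordering A O' cs fl os X"
    unfolding ordering_def s_def[symmetric]
  proof (intro conjI allI ballI impI)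
    fix c assume c: "c \<in> set cs"
    obtain j where j: "j < D" "c = s ! j" using idx[OF c] by blast
    show "c \<in> X c" using Xin[of j j 0] j by simp
    show "X c \<subseteq> {..<k}" using Xk .
    show "card (X c) \<le> b" using Xcard j b by simp
    fix c' assume c': "c' \<in> set cs" "c \<noteq> c'"
    obtain j' where j': "j' < D" "c' = s ! j'" using idx[OF c'(1)] by blast
    have "j \<noteq> j'" using j j' c'(2) by auto
    then show "c' \<in> X c \<or> c \<in> X c'" using tour[of j j'] tour[of j' j] j j' by (metis nat_neq_iff)
  next
    fix i j e assume "i < D" "j < D" "1 \<le> e" "e \<le> h" "j = (i + e) mod D"
    then show "s ! i \<in> X (s ! j)" using Xin[of i j e] hD(5) by simp
  next
    fix i assume "Suc i < length cs"
    then have "cs ! i \<in> set cs" "cs ! Suc i \<in> set cs" by auto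
    moreover have "card (X c) \<le> b" if "c \<in> set cs" for c using idx[OF that] Xcard b by auto
    ultimately show "card (X (cs ! i)) + card (X (cs ! Suc i)) < k" using hD(6) by (meson add_mono le_less_trans)
  qed (use os in auto)
  then show ?thesis by blast
qed

text \<open>With four slots and \<open>k = 6\<close>, two neighbouring leaves may block only five colours together, and blocking two slots each does
not cover the pair of opposite slots \<open>s\<close>, \<open>w3\<close>. This pair matters only if both are leaf colours. If some colour of \<open>O'\<close> is not on a leaf, it can
be placed in the last slot; if neither this nor \<open>s\<close> helps, the vertex has three leaves, and the middle one, with colour \<open>wk\<close>,
may block a third colour because it is not at an end of \<open>cs\<close>. In the other cases \<open>wk = \<alpha>\<close>, which is no leaf colour. The order of the two colours in \<open>O'\<close> is free and lets the middle leaf be one of the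
opposite pair.\<close>
lemma ordering_four:
  assumes v: "valid A O'" and cs: "distinct cs" "set cs \<subseteq> set A \<union> O' - {hd A}" "2 \<le> length cs" "length cs < D" and D: "D = 4"
  shows "\<exists>os X. ordering A O' cs fl os X"
proof -
  have h: "h = 1" and k: "k = 6" and b: "b = 2" using D unfolding h_def k_def b_def by simp_all
  obtain \<alpha> s where A: "A = [\<alpha>, s]" using v by (auto simp: valid_def h numeral_eq_Suc length_Suc_conv)
  obtain o1 o2 where O: "O' = {o1, o2}" "o1 \<noteq> o2" using v[unfolded valid_def] D by (auto simp: card_2_iff)
  have d: "\<alpha> \<noteq> s" "\<alpha> \<noteq> o1" "\<alpha> \<noteq> o2" "s \<noteq> o1" "s \<noteq> o2" "\<alpha> < 6" "s < 6" "o1 < 6" "o2 < 6"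
    using v by (auto simp: valid_def A O k)
  have sub: "set cs \<subseteq> {s, o1, o2}" using cs(2) d by (auto simp: A O)
  define X where "X w2 w3 wk c = (if c = s then {s, \<alpha>} \<union> (if wk = s then {w3} else {})
     else if c = w2 then {w2, s} else {w3, w2} \<union> (if wk = w3 then {s} else {}))" for w2 w3 wk c :: nat
  have key: "ordering A O' cs fl [w2, w3] (X w2 w3 wk)"
    if w: "{w2, w3} = {o1, o2}"
      and weak: "wk \<noteq> \<alpha> \<Longrightarrow> length cs = 3 \<and> wk = cs ! 1 \<and> (\<forall>c\<in>set cs. fl c) \<and> wk \<noteq> w2"
      and nw: "wk = \<alpha> \<Longrightarrow> \<not> (s \<in> set cs \<and> w3 \<in> set cs \<and> fl s \<and> fl w3)" for w2 w3 wk
  proof -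
    have w': "w2 \<noteq> w3" "s \<noteq> w2" "s \<noteq> w3" "\<alpha> \<noteq> w2" "\<alpha> \<noteq> w3" "w2 < 6" "w3 < 6"
      using w O(2) d by (auto simp: doubleton_eq_iff)
    have cs': "set cs \<subseteq> {s, w2, w3}" using sub w by auto
    have cardX: "card (X w2 w3 wk c) \<le> (if c = wk then 3 else 2)" if "c \<in> {s, w2, w3}" "wk \<noteq> w2" for c
      using that w' d by (auto simp: X_def card_insert_if)
    have wkw2: "wk \<noteq> w2" using weak w'(4) by metis
    \<comment> \<open>a leaf blocking three colours is neither first nor last\<close>
    have wkpos: "wk \<noteq> hd cs \<and> wk \<noteq> last cs" if "wk \<in> set cs"
    proof -
      have "wk \<noteq> \<alpha>" using that cs' d w' by auto
      then have "length cs = 3" "wk = cs ! 1" using weak by auto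
      then show ?thesis using cs(1) by (auto simp: numeral_eq_Suc length_Suc_conv)
    qed
    have slots: "(A @ [w2, w3]) ! 0 = \<alpha>" "(A @ [w2, w3]) ! 1 = s" "(A @ [w2, w3]) ! 2 = w2" "(A @ [w2, w3]) ! 3 = w3"
      by (simp_all add: A)
    show ?thesis
      unfolding ordering_def
    proof (intro conjI allI ballI impI)
      show "set [w2, w3] = O'" "distinct [w2, w3]" using w w' O by auto
    next
      fix c assume c: "c \<in> set cs" "fl c"
      then have c3: "c \<in> {s, w2, w3}" using cs' by blast
      show "c \<in> X w2 w3 wk c" using c3 w' by (auto simp: X_def)
      show "X w2 w3 wk c \<subseteq> {..<k}" using w' d by (auto simp: X_def k)
      show "card (X w2 w3 wk c) \<le> b" if "c = hd cs \<or> c = last cs \<or> (\<exists>c'\<in>set cs. \<not> fl c')"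
      proof -
        have "c \<noteq> wk"
        proof
          assume "c = wk"
          then have "wk \<noteq> \<alpha>" "c \<noteq> hd cs" "c \<noteq> last cs" using c3 w' d wkpos c by auto
          then show False using that weak by blast
        qed
        then show ?thesis using cardX[OF c3 wkw2] b by simp
      qed
      fix c' assume c': "c' \<in> set cs" "fl c'" "c \<noteq> c'"
      then have "c' \<in> {s, w2, w3}" using cs' by blast
      moreover have "wk = s \<or> wk = w3" if "s \<in> set cs" "w3 \<in> set cs" "fl s" "fl w3"
      proof -
        have "wk \<noteq> \<alpha>" using nw that by blast
        then have "wk \<in> set cs" "wk \<noteq> w2" using weak by auto
        then show ?thesis using cs' by auto
      qed
      ultimately show "c' \<in> X w2 w3 wk c \<or> c \<in> X w2 w3 wk c'" using c c' c3 w' by (auto simp: X_def)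
    next
      fix i j e assume ij: "i < D" "j < D" "1 \<le> e" "e \<le> h" "j = (i + e) mod D"
        and j: "(A @ [w2, w3]) ! j \<in> set cs" "fl ((A @ [w2, w3]) ! j)"
      have "(A @ [w2, w3]) ! 0 \<notin> set cs" using slots(1) cs' w' d by auto
      then have "j \<noteq> 0" using j(1) by metis
      moreover have "e = 1" "i = 0 \<or> i = 1 \<or> i = 2 \<or> i = 3" using ij(1,3,4) h D by linarith+
      ultimately have "i = 0 \<and> j = 1 \<or> i = 1 \<and> j = 2 \<or> i = 2 \<and> j = 3" using ij(5) D by auto
      then show "(A @ [w2, w3]) ! i \<in> X w2 w3 wk ((A @ [w2, w3]) ! j)"
        using slots w' by (elim disjE conjE) (simp_all add: X_def)
    next
      fix i assume i: "Suc i < length cs"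
      then have 1: "cs ! i \<in> set cs" "cs ! Suc i \<in> set cs" "cs ! i \<noteq> cs ! Suc i"
        using cs(1) by (auto simp: nth_eq_iff_index_eq)
      have 2: "cs ! i \<in> {s, w2, w3}" "cs ! Suc i \<in> {s, w2, w3}" using 1 cs' by blast+
      show "card (X w2 w3 wk (cs ! i)) + card (X w2 w3 wk (cs ! Suc i)) < k"
        using cardX[OF 2(1) wkw2] cardX[OF 2(2) wkw2] 1(3) k by (auto split: if_splits)
    qed
  qed
  have lens: "length cs = 2 \<or> length cs = 3" using cs(3,4) D by auto
  have full: "set cs = {s, o1, o2}" if "length cs = 3"
    using that sub cs(1) distinct_card[OF cs(1)] d O(2) by (intro card_subset_eq) auto
  consider "\<exists>w\<in>{o1, o2}. \<not> (w \<in> set cs \<and> fl w)" | "\<not> (s \<in> set cs \<and> fl s)"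
    | "o1 \<in> set cs" "o2 \<in> set cs" "s \<in> set cs" "fl o1" "fl o2" "fl s" by blast
  then show ?thesis
  proof cases
    case 1
    then consider "\<not> (o1 \<in> set cs \<and> fl o1)" | "\<not> (o2 \<in> set cs \<and> fl o2)" by blast
    then show ?thesis
    proof cases
      case 1 then show ?thesis using key[of o2 o1 \<alpha>] by (auto simp: insert_commute)
    next
      case 2 then show ?thesis using key[of o1 o2 \<alpha>] by auto
    qed
  next
    case 2 then show ?thesis using key[of o1 o2 \<alpha>] by auto
  next
    case 3
    have l3: "length cs = 3"
    proof -
      have "card {s, o1, o2} \<le> card (set cs)" using 3 by (intro card_mono) auto
      then show ?thesis using lens distinct_card[OF cs(1)] d O(2) by auto
    qed
    have "cs ! 1 \<in> set cs" using l3 by simp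
    then have m: "cs ! 1 \<in> {s, o1, o2}" using sub by blast
    have all: "\<forall>c\<in>set cs. fl c" using 3 full[OF l3] by simp
    show ?thesis
    proof (cases "cs ! 1 = o1")
      case True
      then show ?thesis using key[of o2 o1 o1] l3 all O(2) d by (auto simp: insert_commute)
    next
      case False
      then show ?thesis using key[of o1 o2 "cs ! 1"] l3 all O(2) d m by auto
    qed
  qed
qed

end

section \<open>Large degree: colouring the tree\<close>

text \<open>Dependent choice from left to right, where each choice may look at the one before.\<close>
lemma chain_choice:
  assumes "\<And>i z. i < m \<Longrightarrow> \<exists>d. Q i z d"
  shows "\<exists>ds. \<forall>i<m. Q i (case i of 0 \<Rightarrow> z0 | Suc j \<Rightarrow> g j (ds j)) (ds i)"
  using assms
proof (induction m)
  case (Suc m)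
  then obtain ds where ds: "\<forall>i<m. Q i (case i of 0 \<Rightarrow> z0 | Suc j \<Rightarrow> g j (ds j)) (ds i)" by fastforce
  obtain d where d: "Q m (case m of 0 \<Rightarrow> z0 | Suc j \<Rightarrow> g j (ds j)) d" using Suc(2) by blast
  have "Q i (case i of 0 \<Rightarrow> z0 | Suc j \<Rightarrow> g j ((ds(m := d)) j)) ((ds(m := d)) i)" if "i < Suc m" for i
  proof (cases "i = m")
    case True then show ?thesis using d by (cases m) auto
  next
    case False
    then have "Q i (case i of 0 \<Rightarrow> z0 | Suc j \<Rightarrow> g j (ds j)) (ds i)" using ds that by simp
    then show ?thesis using False that by (cases i) auto
  qed
  then show ?case by blast
qed simp

lemma distinct_concat_nth:
  "distinct (concat (map g ts)) \<Longrightarrow> i < length ts \<Longrightarrow> j < length ts \<Longrightarrow> x \<in> set (g (ts ! i)) \<Longrightarrow> x \<in> set (g (ts ! j)) \<Longrightarrow> i = j"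
proof (induction ts arbitrary: i j)
  case (Cons t ts)
  have "x \<notin> set (g (ts ! l))" if "x \<in> set (g t)" "l < length ts" for l
    using Cons(2) that by (auto dest: nth_mem)
  then show ?case using Cons by (cases i; cases j) auto
qed simp

lemma leaf_list_nonempty: "leaf_list t \<noteq> []"
  by (induction t) auto

lemma leaf_list_subset: "set (leaf_list t) \<subseteq> set (preorder t)"
  using set_leaf_list[of t] root_in_preorder by auto

context palette
begin

text \<open>The condition on neighbouring leaves, given their colours and numbers of blocked colours: the colours differ and the
rim edge between them has a colour below \<open>k\<close> left. The ends carry the tighter bound \<open>b\<close> because their outer neighbours
are not known.\<close>
definition line :: "nat option \<Rightarrow> nat option \<Rightarrow> (nat \<times> nat) list \<Rightarrow> bool" where
  "line L R ps \<longleftrightarrow> successively (\<lambda>p p'. fst p \<noteq> fst p' \<and> snd p + snd p' < k) ps \<and>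
     L \<noteq> Some (fst (hd ps)) \<and> R \<noteq> Some (fst (last ps)) \<and> snd (hd ps) \<le> b \<and> snd (last ps) \<le> b"

definition leaf_data :: "('a \<Rightarrow> nat) \<Rightarrow> ('a \<Rightarrow> nat set) \<Rightarrow> 'a plane_tree \<Rightarrow> (nat \<times> nat) list" where
  "leaf_data \<kappa> X t = map (\<lambda>x. (\<kappa> x, card (X x))) (leaf_list t)"

text \<open>A leaf \<open>x\<close> sees at most the colours in the complement of \<open>X x\<close> on its rim edges.\<close>
definition solves :: "nat list \<Rightarrow> nat set \<Rightarrow> nat option \<Rightarrow> nat option \<Rightarrow> 'a plane_tree \<Rightarrow> ('a \<Rightarrow> nat) \<Rightarrow> ('a \<Rightarrow> nat set) \<Rightarrow> bool" where
  "solves A O' L R t \<kappa> X \<longleftrightarrow> \<kappa> (rt t) = hd A \<and> tree_colors \<kappa> t \<subseteq> set A \<union> O' \<and>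
     (\<forall>P. P \<inter> O' = {} \<longrightarrow> star_colored \<kappa> (\<lambda>v. - X v) P t) \<and> (\<forall>x\<in>set (preorder t). \<kappa> x < k) \<and>
     (\<forall>x\<in>set (leaf_list t). X x \<subseteq> {..<k} \<and> \<kappa> x \<in> X x) \<and> line L R (leaf_data \<kappa> X t)"

lemma leaf_data_cong:
  "(\<And>x. x \<in> set (preorder t) \<Longrightarrow> \<kappa> x = \<kappa>' x \<and> X x = X' x) \<Longrightarrow> leaf_data \<kappa> X t = leaf_data \<kappa>' X' t"
  using leaf_list_subset[of t] by (auto simp: leaf_data_def)

lemma solves_cong:
  assumes c: "\<And>x. x \<in> set (preorder t) \<Longrightarrow> \<kappa> x = \<kappa>' x \<and> X x = X' x" and s: "solves A O' L R t \<kappa>' X'"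
  shows "solves A O' L R t \<kappa> X"
proof -
  have g: "star_colored \<kappa> (\<lambda>v. - X v) P t = star_colored \<kappa>' (\<lambda>v. - X' v) P t" for P
    using star_colored_cong[of t \<kappa> \<kappa>' "\<lambda>v. - X v" P] star_colored_cong_rim[of t "\<lambda>v. - X' v" "\<lambda>v. - X v" \<kappa>' P] c by auto
  have "rt t \<in> set (preorder t)" by (rule root_in_preorder[OF self_subtree])
  then show ?thesis
    using s tree_colors_cong[of t \<kappa> \<kappa>'] leaf_data_cong[OF c, of t] c leaf_list_subset[of t] unfolding solves_def g by (auto simp: subset_iff)
qed

text \<open>Two forward steps of length at most \<open>h\<close> do not go around a cycle of length \<open>D\<close>.\<close>
lemma shift_conflict:
  assumes "j < D" "j' < D" "j \<noteq> j'" "e \<le> h" "e' \<le> h" "j' = (j + e) mod D" "j = (j' + e') mod D"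
  shows False
proof -
  have "(j + e + e') mod D = j" using assms(6,7) mod_add_left_eq[of "j + e" D e'] by metis
  moreover have "e \<noteq> 0" using assms(1,3,6) by (cases e) auto
  moreover have "e + e' < D" using assms(4,5) hD(2) by linarith
  moreover have "(j + e + e') mod D = (if j + e + e' < D then j + e + e' else j + e + e' - D)"
    using assms(1) \<open>e + e' < D\<close> by (simp add: le_mod_geq)
  ultimately show False using assms(1) by (auto split: if_splits)
qed

text \<open>The child in slot \<open>j\<close> may use the slots \<open>j, ..., j + h\<close> and all \<open>k - D\<close> colours outside the list, which is
again a valid palette. Children are solved from left to right, each knowing the colour of the last leaf before it; on its right it needs to know
a colour only if the next child is a leaf or there is none.\<close>
lemma node_solution:
  fixes ts :: "'a plane_tree list"
  assumes IH: "\<And>s A O' L R. s \<in> set ts \<Longrightarrow> subs s \<noteq> [] \<Longrightarrow> valid A O' \<Longrightarrow> \<exists>\<kappa> X. solves A O' L R s \<kappa> X"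
    and v: "valid A O'" and m: "2 \<le> length ts" "length ts < D" and d: "distinct (preorder (Nd v ts))"
  shows "\<exists>\<kappa> X. solves A O' L R (Nd v ts) \<kappa> X"
proof -
  define m where "m = length ts"
  obtain cs where cs: "length cs = m" "distinct cs" "set cs \<subseteq> set A \<union> O' - {hd A}" "L \<noteq> Some (hd cs)" "R \<noteq> Some (last cs)"
    using choose_colors[OF v m] unfolding m_def by blast
  define fl where "fl c \<longleftrightarrow> (\<exists>i<m. cs ! i = c \<and> subs (ts ! i) = [])" for c
  have fl: "fl (cs ! i) \<longleftrightarrow> subs (ts ! i) = []" if "i < m" for i
    using that cs(1,2) unfolding fl_def by (auto simp: nth_eq_iff_index_eq)
  obtain os Xc where ord: "ordering A O' cs fl os Xc"
    using ordering_large[OF v cs(2,3)] ordering_four[OF v cs(2,3)] m cs(1) unfolding m_def by metis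
  note o1 = ord[unfolded ordering_def, THEN conjunct2, THEN conjunct2]
  note o2 = o1[THEN conjunct2]
  note o3 = o2[THEN conjunct2]
  note o4 = o3[THEN conjunct2]
  note member = o1[THEN conjunct1] and shifted = o2[THEN conjunct1] and apart = o3[THEN conjunct1]
    and small = o4[THEN conjunct1] and small2 = o4[THEN conjunct2]
  define s where "s = A @ os"
  have os: "set os = O'" "distinct os" using ord by (auto simp: ordering_def)
  have A0: "A \<noteq> []" "length A = h + 1" using v by (auto simp: valid_def)
  have s: "length s = D" "distinct s" "set s = set A \<union> O'" "set s \<subseteq> {..<k}" "s ! 0 = hd A"
    using v os distinct_card[OF os(2)] hD(1) A0 by (auto simp: s_def valid_def nth_append hd_conv_nth)
  have D0: "0 < D" using D4 by simp
  have "\<exists>j. 1 \<le> j \<and> j < D \<and> s ! j = cs ! i" if "i < m" for i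
  proof -
    have c: "cs ! i \<in> set cs" using that cs(1) by simp
    then have "cs ! i \<in> set s" using cs(3) s(3) by blast
    then obtain j where j: "j < D" "s ! j = cs ! i" using s(1) by (metis in_set_conv_nth)
    have "j \<noteq> 0" using j(2) c cs(3) s(5) by (metis DiffD2 insertI1 subsetD)
    then show ?thesis using j by (intro exI[of _ j]) simp
  qed
  then obtain sl where sl: "\<And>i. i < m \<Longrightarrow> 1 \<le> sl i" "\<And>i. i < m \<Longrightarrow> sl i < D" "\<And>i. i < m \<Longrightarrow> s ! sl i = cs ! i" by metis
  have slinj: "sl i \<noteq> sl j" if "i < m" "j < m" "i \<noteq> j" for i j
    using that sl(3)[of i] sl(3)[of j] cs(1,2) by (metis nth_eq_iff_index_eq)
  define Ai where "Ai i = map (\<lambda>e. s ! ((sl i + e) mod D)) [0..<h + 1]" for i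
  define Oi where "Oi = {..<k} - set s"
  have smem: "s ! (x mod D) \<in> set s" for x using s(1) D0 by simp
  have valid: "valid (Ai i) Oi" if i: "i < m" for i
  proof -
    have "(sl i + e) mod D \<noteq> (sl i + e') mod D" if "e < h + 1" "e' < h + 1" "e < e'" for e e'
    proof
      assume "(sl i + e) mod D = (sl i + e') mod D"
      then have "D dvd e' - e" using mod_eq_dvd_iff_nat[of "sl i + e" "sl i + e'" D] that(3) by simp
      then show False using that hD(2) hD(3) by (auto dest!: dvd_imp_le)
    qed
    then have "inj_on (\<lambda>e. s ! ((sl i + e) mod D)) (set [0..<h + 1])"
      using s(1,2) D0 by (intro inj_onI) (metis atLeastLessThan_iff mod_less_divisor nat_neq_iff nth_eq_iff_index_eq set_upt)
    moreover have "card Oi = D div 2"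
      using s(1,2,4) hD(4) distinct_card[OF s(2)] by (simp add: Oi_def card_Diff_subset)
    moreover have "set (Ai i) \<subseteq> set s" using smem by (auto simp: Ai_def)
    ultimately show ?thesis using s(4) by (auto simp: valid_def Ai_def distinct_map Oi_def)
  qed
  have hdA: "hd (Ai i) = cs ! i" if "i < m" for i
    using sl[OF that] by (simp add: Ai_def hd_map del: upt_Suc)
  define Ri where "Ri i = (if Suc i = m then R else if subs (ts ! Suc i) = [] then Some (cs ! Suc i) else None)" for i
  define Q where "Q i z d \<longleftrightarrow> (if subs (ts ! i) = []
     then fst d (rt (ts ! i)) = cs ! i \<and> snd d (rt (ts ! i)) = Xc (cs ! i)
     else solves (Ai i) Oi z (Ri i) (ts ! i) (fst d) (snd d))" for i z and d :: "('a \<Rightarrow> nat) \<times> ('a \<Rightarrow> nat set)"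
  have "\<exists>d. Q i z d" if i: "i < m" for i z
  proof (cases "subs (ts ! i) = []")
    case True
    then show ?thesis unfolding Q_def by (intro exI[of _ "(\<lambda>_. cs ! i, \<lambda>_. Xc (cs ! i))"]) simp
  next
    case False
    have "ts ! i \<in> set ts" using i m_def by simp
    from IH[OF this False valid[OF i], of z "Ri i"]
    obtain \<kappa> X where "solves (Ai i) Oi z (Ri i) (ts ! i) \<kappa> X" by blast
    then show ?thesis using False unfolding Q_def by (intro exI[of _ "(\<kappa>, X)"]) simp
  qed
  then obtain ds where ds: "\<And>i. i < m \<Longrightarrow> Q i (case i of 0 \<Rightarrow> L | Suc j \<Rightarrow> Some (fst (ds j) (last (leaf_list (ts ! j))))) (ds i)"
    using chain_choice[of m Q L "\<lambda>j d. Some (fst d (last (leaf_list (ts ! j))))"] by blast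
  define ix where "ix x = (THE i. i < m \<and> x \<in> set (preorder (ts ! i)))" for x
  have ix: "ix x = i" if "i < m" "x \<in> set (preorder (ts ! i))" for x i
    unfolding ix_def using that distinct_concat_nth[of preorder ts] d m_def by (intro the_equality) auto
  define \<kappa> where "\<kappa> x = (if x = v then hd A else fst (ds (ix x)) x)" for x
  define X where "X x = snd (ds (ix x)) x" for x
  have vv: "x \<noteq> v" if "i < m" "x \<in> set (preorder (ts ! i))" for i x
    using that d m_def by (auto dest!: nth_mem)
  have agree: "\<kappa> x = fst (ds i) x \<and> X x = snd (ds i) x" if "i < m" "x \<in> set (preorder (ts ! i))" for i x
    using that ix vv by (simp add: \<kappa>_def X_def)
  have rtv: "rt u \<in> set (preorder u)" for u :: "'a plane_tree" by (rule root_in_preorder[OF self_subtree])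
  have inner: "solves (Ai i) Oi (case i of 0 \<Rightarrow> L | Suc j \<Rightarrow> Some (\<kappa> (last (leaf_list (ts ! j))))) (Ri i) (ts ! i) \<kappa> X"
    if i: "i < m" "subs (ts ! i) \<noteq> []" for i
  proof -
    have "(case i of 0 \<Rightarrow> L | Suc j \<Rightarrow> Some (\<kappa> (last (leaf_list (ts ! j))))) =
        (case i of 0 \<Rightarrow> L | Suc j \<Rightarrow> Some (fst (ds j) (last (leaf_list (ts ! j)))))"
    proof (cases i)
      case (Suc j)
      have "last (leaf_list (ts ! j)) \<in> set (preorder (ts ! j))" by (rule subsetD[OF leaf_list_subset last_in_set[OF leaf_list_nonempty]])
      then show ?thesis using agree[of j] Suc i(1) by simp
    qed simp
    then have "solves (Ai i) Oi (case i of 0 \<Rightarrow> L | Suc j \<Rightarrow> Some (\<kappa> (last (leaf_list (ts ! j))))) (Ri i) (ts ! i) (fst (ds i)) (snd (ds i))"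
      using ds[OF i(1)] i(2) unfolding Q_def by simp
    then show ?thesis using solves_cong[of "ts ! i" \<kappa> "fst (ds i)" X "snd (ds i)"] agree[OF i(1)] by blast
  qed
  have leaf: "\<kappa> (rt (ts ! i)) = cs ! i \<and> X (rt (ts ! i)) = Xc (cs ! i)" if "i < m" "subs (ts ! i) = []" for i
    using ds[OF that(1)] that agree[OF that(1) rtv] unfolding Q_def by simp
  have root: "\<kappa> (rt (ts ! i)) = cs ! i" if "i < m" for i
    using leaf[OF that] inner[OF that] hdA[OF that] unfolding solves_def by (cases "subs (ts ! i) = []") auto
  have kv: "\<kappa> v = hd A" by (simp add: \<kappa>_def)
  have roots: "map (\<lambda>s. \<kappa> (rt s)) ts = cs"
    using root cs(1) by (intro nth_equalityI) (auto simp: m_def)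
  have roots': "(\<lambda>s. \<kappa> (rt s)) ` set ts = set cs" using roots by (metis set_map)
  have CTt: "tree_colors \<kappa> (Nd v ts) = insert (hd A) (set cs)" by (simp add: tree_colors_node kv roots')
  have CTs: "tree_colors \<kappa> (Nd v ts) \<subseteq> set s" using CTt cs(3) s(3) A0(1) by auto
  have CXinner: "\<exists>e\<le>h. j = (sl i + e) mod D" if i: "i < m" "subs (ts ! i) \<noteq> []" and j: "j < D" "s ! j \<in> all_colors \<kappa> (\<lambda>v. - X v) (ts ! i)" for i j
  proof -
    have "s ! j \<in> set (Ai i) \<union> Oi" using inner[OF i] j(2) i(2) by (auto simp: solves_def all_colors_def)
    moreover have "s ! j \<notin> Oi" using j(1) s(1) by (simp add: Oi_def)
    moreover have "set (Ai i) = (\<lambda>e. s ! ((sl i + e) mod D)) ` {..h}"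
      by (simp add: Ai_def atLeast0LessThan lessThan_Suc_atMost del: upt_Suc)
    ultimately obtain e where "e \<le> h" "s ! j = s ! ((sl i + e) mod D)" by blast
    then show ?thesis using s(1,2) j(1) D0 by (metis mod_less_divisor nth_eq_iff_index_eq)
  qed
  have CXleaf: "c \<notin> Xc (cs ! i)" if i: "i < m" "subs (ts ! i) = []" and c: "c \<in> all_colors \<kappa> (\<lambda>v. - X v) (ts ! i)" "c \<noteq> cs ! i" for i c
    using c leaf[OF i] i(2) by (auto simp: all_colors_def tree_colors_def)
  have x1: "s ! j \<in> Xc (cs ! i)" if "i < m" "subs (ts ! i) = []" "j < D" "1 \<le> e" "e \<le> h" "sl i = (j + e) mod D" for i j e
  proof -
    from shifted[folded s_def, rule_format, of j "sl i" e] show ?thesis using that sl[OF that(1)] fl[OF that(1)] cs(1) by simp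
  qed
  have star: "star_colored_at \<kappa> (\<lambda>v. - X v) P (Nd v ts)" if P: "P \<inter> O' = {}" for P
    unfolding star_colored_at_def
  proof (intro conjI ballI impI)
    have "map (\<kappa> \<circ> rt) ts = cs" using roots by (simp add: comp_def)
    then show "distinct (\<kappa> (rt (Nd v ts)) # map (\<kappa> \<circ> rt) (subs (Nd v ts)))" using cs(2,3) kv by auto
  next
    fix c assume "c \<in> set (subs (Nd v ts))"
    then obtain i where i: "i < m" "c = ts ! i" by (auto simp: in_set_conv_nth m_def)
    show "\<not> (\<kappa> (rt c) \<in> P \<and> \<kappa> (rt (Nd v ts)) \<in> all_colors \<kappa> (\<lambda>v. - X v) c)"
    proof
      assume a: "\<kappa> (rt c) \<in> P \<and> \<kappa> (rt (Nd v ts)) \<in> all_colors \<kappa> (\<lambda>v. - X v) c"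
      then have "s ! sl i \<in> P" "s ! 0 \<in> all_colors \<kappa> (\<lambda>v. - X v) (ts ! i)" using root[OF i(1)] i sl(3) kv s(5) by auto
      then have "s ! sl i \<notin> O'" using P by blast
      then have slh: "sl i \<le> h" using sl(2)[OF i(1)] os(1) s(1) A0(2) unfolding s_def
        by (metis add.commute length_append less_diff_conv2 not_less_eq_eq nth_append nth_mem plus_1_eq_Suc le_add_diff_inverse
            nat_add_left_cancel_less not_le Suc_eq_plus1)
      show False
      proof (cases "subs (ts ! i) = []")
        case True
        have "s ! 0 \<in> Xc (cs ! i)" using x1[OF i(1) True D0 sl(1)[OF i(1)] slh] sl(2)[OF i(1)] by simp
        moreover have "s ! 0 \<noteq> cs ! i" using sl[OF i(1)] s(1,2) D0 by (metis nth_eq_iff_index_eq not_one_le_zero)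
        ultimately show False using CXleaf[OF i(1) True] \<open>s ! 0 \<in> all_colors \<kappa> (\<lambda>v. - X v) (ts ! i)\<close> by blast
      next
        case False
        obtain e where "e \<le> h" "0 = (sl i + e) mod D"
          using CXinner[OF i(1) False D0 \<open>s ! 0 \<in> all_colors \<kappa> (\<lambda>v. - X v) (ts ! i)\<close>] by blast
        moreover have "sl i + e < D" using slh \<open>e \<le> h\<close> hD(2) by linarith
        ultimately show False using sl(1)[OF i(1)] by simp
      qed
    qed
    fix c' assume "c' \<in> set (subs (Nd v ts))" "c \<noteq> c'"
    then obtain i' where i': "i' < m" "c' = ts ! i'" "i \<noteq> i'" using i by (auto simp: in_set_conv_nth m_def)
    have ne: "sl i \<noteq> sl i'" "cs ! i \<noteq> cs ! i'"
      using slinj i i' cs(1,2) by (auto simp: nth_eq_iff_index_eq)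
    show "\<not> (\<kappa> (rt c') \<in> all_colors \<kappa> (\<lambda>v. - X v) c \<and> \<kappa> (rt c) \<in> all_colors \<kappa> (\<lambda>v. - X v) c')"
    proof
      assume "\<kappa> (rt c') \<in> all_colors \<kappa> (\<lambda>v. - X v) c \<and> \<kappa> (rt c) \<in> all_colors \<kappa> (\<lambda>v. - X v) c'"
      then have a: "s ! sl i' \<in> all_colors \<kappa> (\<lambda>v. - X v) (ts ! i)" "s ! sl i \<in> all_colors \<kappa> (\<lambda>v. - X v) (ts ! i')"
        using root i i' sl(3) by auto
      have mixed: False if mx: "j < m" "j' < m" "sl j \<noteq> sl j'" "subs (ts ! j) \<noteq> []" "subs (ts ! j') = []"
        "s ! sl j' \<in> all_colors \<kappa> (\<lambda>v. - X v) (ts ! j)" "s ! sl j \<in> all_colors \<kappa> (\<lambda>v. - X v) (ts ! j')" for j j'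
      proof -
        obtain e where e: "e \<le> h" "sl j' = (sl j + e) mod D" using CXinner[OF mx(1,4) sl(2)[OF mx(2)] mx(6)] by blast
        then have "e \<noteq> 0" using mx(3) sl(2)[OF mx(1)] by (cases e) auto
        then have "s ! sl j \<in> Xc (cs ! j')" using x1[OF mx(2,5) sl(2)[OF mx(1)] _ e] by simp
        moreover have "s ! sl j \<noteq> cs ! j'" using mx(1-3) sl s(1,2) by (metis nth_eq_iff_index_eq)
        ultimately show False using CXleaf[OF mx(2,5,7)] by blast
      qed
      show False
      proof (cases "subs (ts ! i) = []"; cases "subs (ts ! i') = []")
        assume l: "subs (ts ! i) = []" "subs (ts ! i') = []"
        have "cs ! i' \<notin> Xc (cs ! i)" "cs ! i \<notin> Xc (cs ! i')"
          using CXleaf[OF i(1) l(1)] CXleaf[OF i'(1) l(2)] a sl(3) i(1) i'(1) ne(2) by auto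
        moreover have "fl (cs ! i)" "fl (cs ! i')" "cs ! i \<in> set cs" "cs ! i' \<in> set cs" using fl l i i' cs(1) by auto
        ultimately show False using apart ne(2) by blast
      next
        assume l: "subs (ts ! i) \<noteq> []" "subs (ts ! i') \<noteq> []"
        obtain e e' where "e \<le> h" "sl i' = (sl i + e) mod D" "e' \<le> h" "sl i = (sl i' + e') mod D"
          using CXinner[OF i(1) l(1) sl(2)[OF i'(1)] a(1)] CXinner[OF i'(1) l(2) sl(2)[OF i(1)] a(2)] by blast
        then show False using shift_conflict[of "sl i" "sl i'" e e'] sl(2) i i' ne by blast
      qed (use mixed[of i i'] mixed[of i' i] i i' ne a in auto)
    qed
  qed
  have gst: "star_colored \<kappa> (\<lambda>v. - X v) P (Nd v ts)" if "P \<inter> O' = {}" for P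
  proof -
    have "star_colored \<kappa> (\<lambda>v. - X v) (all_colors \<kappa> (\<lambda>v. - X v) (Nd v ts)) c" if "c \<in> set ts" for c
    proof -
      obtain i where i: "i < m" "c = ts ! i" using \<open>c \<in> set ts\<close> by (auto simp: in_set_conv_nth m_def)
      show ?thesis
      proof (cases "subs c = []")
        case True then show ?thesis by (cases c) (simp add: star_colored_at_def)
      next
        case False
        have "all_colors \<kappa> (\<lambda>v. - X v) (Nd v ts) \<inter> Oi = {}" using CTs m by (auto simp: all_colors_def Oi_def)
        then show ?thesis using inner[of i] i False unfolding solves_def by blast
      qed
    qed
    then show ?thesis using star[OF that] by simp
  qed
  have bound: "\<kappa> x < k" if "x \<in> set (preorder (Nd v ts))" for x
  proof -
    have hk: "hd A < k" using v hd_in_set[OF A0(1)] by (auto simp: valid_def)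
    have "x = v \<or> (\<exists>s\<in>set ts. x \<in> set (preorder s))" using that by auto
    then consider "x = v" | i where "i < m" "x \<in> set (preorder (ts ! i))" unfolding m_def by (metis in_set_conv_nth)
    then show ?thesis
    proof cases
      case 2
      show ?thesis
      proof (cases "subs (ts ! i) = []")
        case True
        then have "x = rt (ts ! i)" using 2(2) by (cases "ts ! i") auto
        then have "\<kappa> x \<in> set s" using root[OF 2(1)] cs(1,3) 2(1) s(3) by (metis DiffD1 nth_mem subsetD)
        then show ?thesis using s(4) by blast
      next
        case False then show ?thesis using inner[OF 2(1)] 2(2) by (auto simp: solves_def)
      qed
    qed (use hk kv in simp)
  qed
  have leafX: "X x \<subseteq> {..<k} \<and> \<kappa> x \<in> X x" if "x \<in> set (leaf_list (Nd v ts))" for x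
  proof -
    have "ts \<noteq> []" using m by auto
    then have "\<exists>s\<in>set ts. x \<in> set (leaf_list s)" using that by auto
    then have "\<exists>i<m. x \<in> set (leaf_list (ts ! i))" unfolding m_def by (metis in_set_conv_nth)
    then obtain i where i: "i < m" "x \<in> set (leaf_list (ts ! i))" by blast
    show ?thesis
    proof (cases "subs (ts ! i) = []")
      case True
      then have "x = rt (ts ! i)" using i(2) by (cases "ts ! i") auto
      moreover have "cs ! i \<in> set cs" "fl (cs ! i)" using i(1) cs(1) fl True by auto
      ultimately show ?thesis using leaf[OF i(1) True] member by auto
    next
      case False then show ?thesis using inner[OF i(1)] i(2) by (auto simp: solves_def)
    qed
  qed
  have lineT: "line L R (leaf_data \<kappa> X (Nd v ts))"
  proof -
    define w where "w i = leaf_data \<kappa> X (ts ! i)" for i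
    have ld: "leaf_data \<kappa> X (Nd v ts) = concat (map w [0..<m])"
    proof -
      have "map (leaf_data \<kappa> X) ts = map w [0..<m]" by (intro nth_equalityI) (auto simp: w_def m_def)
      moreover have "leaf_data \<kappa> X (Nd v ts) = concat (map (leaf_data \<kappa> X) ts)"
        using m by (auto simp: leaf_data_def[abs_def] map_concat comp_def)
      ultimately show ?thesis by simp
    qed
    have wne: "w i \<noteq> []" for i using leaf_list_nonempty by (simp add: w_def leaf_data_def)
    have wleaf: "w i = [(cs ! i, card (Xc (cs ! i)))]" if "i < m" "subs (ts ! i) = []" for i
      using leaf[OF that] that(2) unfolding w_def leaf_data_def by (cases "ts ! i") auto
    have winner: "line (case i of 0 \<Rightarrow> L | Suc j \<Rightarrow> Some (fst (last (w j)))) (Ri i) (w i)" if "i < m" "subs (ts ! i) \<noteq> []" for i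
    proof -
      have "Some (fst (last (w j))) = Some (\<kappa> (last (leaf_list (ts ! j))))" for j
        using leaf_list_nonempty[of "ts ! j"] by (simp add: w_def leaf_data_def last_map)
      then have "(case i of 0 \<Rightarrow> L | Suc j \<Rightarrow> Some (fst (last (w j)))) = (case i of 0 \<Rightarrow> L | Suc j \<Rightarrow> Some (\<kappa> (last (leaf_list (ts ! j)))))"
        by (cases i) auto
      then show ?thesis using inner[OF that] unfolding solves_def w_def by simp
    qed
    have csi: "cs ! i \<in> set cs" if "i < m" for i using that cs(1) by simp
    have mixedb: "snd (hd (w i)) \<le> b \<and> snd (last (w i)) \<le> b" if "i < m" "i = 0 \<or> Suc i = m \<or> (\<exists>j<m. subs (ts ! j) \<noteq> [])" for i
    proof (cases "subs (ts ! i) = []")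
      case True
      have "cs ! i = hd cs \<or> cs ! i = last cs \<or> (\<exists>c'\<in>set cs. \<not> fl c')"
      proof -
        have "cs \<noteq> []" using cs(1) that(1) by auto
        then have "cs ! 0 = hd cs" "Suc i = m \<Longrightarrow> cs ! i = last cs"
          using cs(1) by (auto simp: hd_conv_nth last_conv_nth)
        moreover have "\<exists>c'\<in>set cs. \<not> fl c'" if j: "j < m" "subs (ts ! j) \<noteq> []" for j
          using csi[OF j(1)] fl[OF j(1)] j(2) by blast
        ultimately show ?thesis using that by auto
      qed
      then have "card (Xc (cs ! i)) \<le> b" using small fl[OF that(1)] True csi[OF that(1)] by blast
      then show ?thesis using wleaf[OF that(1) True] by simp
    next
      case False then show ?thesis using winner[OF that(1)] by (simp add: line_def)
    qed
    have bd: "fst (last (w i)) \<noteq> fst (hd (w (Suc i))) \<and> snd (last (w i)) + snd (hd (w (Suc i))) < k" if i: "Suc i < m" for i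
    proof (cases "subs (ts ! i) = [] \<and> subs (ts ! Suc i) = []")
      case True
      have "cs ! i \<noteq> cs ! Suc i" using i cs(1,2) by (simp add: nth_eq_iff_index_eq)
      moreover have "card (Xc (cs ! i)) + card (Xc (cs ! Suc i)) < k"
        using small2 fl[of i] fl[of "Suc i"] True i cs(1) by auto
      ultimately show ?thesis using wleaf[of i] wleaf[of "Suc i"] True i by simp
    next
      case False
      then have "\<exists>j<m. subs (ts ! j) \<noteq> []" using i by (metis Suc_lessD)
      then have "snd (last (w i)) \<le> b" "snd (hd (w (Suc i))) \<le> b" using mixedb[of i] mixedb[of "Suc i"] i by auto
      then have "snd (last (w i)) + snd (hd (w (Suc i))) < k" using hD(6) by linarith
      moreover have "fst (last (w i)) \<noteq> fst (hd (w (Suc i)))"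
      proof (cases "subs (ts ! Suc i) = []")
        case True
        then have "Ri i = Some (cs ! Suc i)" using i by (simp add: Ri_def)
        then have "Some (cs ! Suc i) \<noteq> Some (fst (last (w i)))" using winner[of i] False True i by (simp add: line_def)
        then show ?thesis using wleaf[OF i True] by simp
      next
        case F: False
        then show ?thesis using winner[OF i F] by (auto simp: line_def)
      qed
      ultimately show ?thesis by simp
    qed
    let ?P = "\<lambda>p p'. fst p \<noteq> fst p' \<and> snd p + snd p' < k"
    have "successively ?P (concat (map w [0..<m]))"
    proof (rule successively_concat)
      fix x assume "x \<in> set (map w [0..<m])"
      then obtain i where "i < m" "x = w i" by auto
      then show "x \<noteq> [] \<and> successively ?P x"
        using wne wleaf[of i] winner[of i] by (cases "subs (ts ! i) = []") (auto simp: line_def)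
    qed (use bd in \<open>auto simp: successively_conv_nth\<close>)
    moreover have m0: "0 < m" using m unfolding m_def by linarith
    then have hdl: "hd (concat (map w [0..<m])) = hd (w 0)" "last (concat (map w [0..<m])) = last (w (m - 1))"
    proof -
      have "[0..<m] = 0 # [1..<m]" using m0 by (simp add: upt_conv_Cons)
      then show "hd (concat (map w [0..<m])) = hd (w 0)" using wne by simp
      have "[0..<m] = [0..<m - 1] @ [m - 1]" using m0 by (metis Suc_diff_1 upt_Suc_append zero_le)
      then show "last (concat (map w [0..<m])) = last (w (m - 1))" using wne by simp
    qed
    moreover have "L \<noteq> Some (fst (hd (w 0)))"
    proof (cases "subs (ts ! 0) = []")
      case True then show ?thesis using wleaf[OF m0 True] cs(1,4) m0 by (metis fst_conv hd_conv_nth length_greater_0_conv list.sel(1))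
    next
      case False then show ?thesis using winner[OF m0 False] by (simp add: line_def)
    qed
    moreover have "R \<noteq> Some (fst (last (w (m - 1))))"
    proof (cases "subs (ts ! (m - 1)) = []")
      case True
      have "m - 1 < m" using m0 by simp
      then show ?thesis using wleaf[OF _ True] cs(1,5) m0 by (metis fst_conv last_conv_nth length_greater_0_conv last.simps)
    next
      case False
      have "m - 1 < m" "Suc (m - 1) = m" using m0 by simp_all
      then show ?thesis using winner[OF _ False] by (simp add: line_def Ri_def)
    qed
    moreover have "snd (hd (w 0)) \<le> b" "snd (last (w (m - 1))) \<le> b" using mixedb[of 0] mixedb[of "m - 1"] m0 by auto
    ultimately show ?thesis unfolding line_def ld by simp
  qed
  show ?thesis
  proof (intro exI)
    show "solves A O' L R (Nd v ts) \<kappa> X"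
      unfolding solves_def
      using kv CTs s(3) gst bound leafX lineT by (auto simp del: preorder.simps leaf_list.simps star_colored.simps)
  qed
qed

theorem tree_coloring:
  assumes "\<And>u. u \<in> subtrees t \<Longrightarrow> subs u \<noteq> [] \<Longrightarrow> 2 \<le> length (subs u) \<and> length (subs u) < D"
    and "distinct (preorder t)" "subs t \<noteq> []" "valid A O'"
  shows "\<exists>\<kappa> X. solves A O' L R t \<kappa> X"
  using assms
proof (induction t arbitrary: A O' L R)
  case (Nd v ts)
  show ?case
  proof (rule node_solution)
    show "2 \<le> length ts" "length ts < D" using Nd(2)[of "Nd v ts"] Nd(4) by auto
    show "\<exists>\<kappa> X. solves A O' L R s \<kappa> X" if s: "s \<in> set ts" "subs s \<noteq> []" "valid A O'" for s A O' L R
    proof (rule Nd(1)[OF s(1) _ distinct_preorder_child[OF Nd(3) s(1)] s(2,3)])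
      show "2 \<le> length (subs u) \<and> length (subs u) < D" if "u \<in> subtrees s" "subs u \<noteq> []" for u
        using Nd(2)[of u] that s(1) by auto
    qed
  qed (use Nd in auto)
qed

end

section \<open>Large degree: colouring the rim\<close>

context ring_tree
begin

text \<open>The leaf \<open>r\<close> has colour \<open>0\<close> and blocks \<open>0\<close> and the colours in \<open>Q\<close>, in accordance with its role as
the parent of the root. A rim edge with letter \<open>0\<close> gets a colour blocked at neither end, and the letters \<open>1, 2\<close> become \<open>k\<close> and
\<open>k + 1\<close>.\<close>
lemma large_colorable:
  assumes D4: "D \<ge> 4" and n5: "n \<noteq> 5"
  shows "star_edge_colorable G (3 * D div 2 + 2)"
proof -
  interpret palette D using D4 by unfold_locales
  define A where "A = [0..<h + 1]"
  define Q where "Q = {h + 1..<D}"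
  have hk: "h + 1 \<le> D" "D \<le> k" using hD(1,4) by linarith+
  have cQ: "card Q = D div 2" "finite Q" using hD(1) by (simp_all add: Q_def)
  have "set A \<inter> Q = {}" "set A \<union> Q \<subseteq> {..<k}" using hk by (auto simp: A_def Q_def)
  then have v: "valid A Q" using cQ by (simp add: valid_def A_def del: upt_Suc)
  have sub: "2 \<le> length (subs u) \<and> length (subs u) < D" if "u \<in> subtrees t" "subs u \<noteq> []" for u
    using rep that unfolding plane_rep_def by blast
  obtain \<kappa> X where sol: "solves A Q (Some 0) (Some 0) t \<kappa> X"
    using tree_coloring[OF sub dist(1,5) v] by blast
  have hdA: "hd A = 0" by (simp add: A_def hd_upt del: upt_Suc)
  have k0: "\<kappa> (rt t) = 0" using sol hdA by (simp add: solves_def)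
  have gs0: "star_colored \<kappa> (\<lambda>v. - X v) P t" if "P \<inter> Q = {}" for P using sol that by (simp add: solves_def)
  have kk: "\<kappa> x < k" if "x \<in> set (preorder t)" for x using sol that by (simp add: solves_def)
  have XX: "X x \<subseteq> {..<k} \<and> \<kappa> x \<in> X x" if "x \<in> set (leaf_list t)" for x using sol that by (simp add: solves_def)
  have ln: "line (Some 0) (Some 0) (leaf_data \<kappa> X t)" using sol by (simp add: solves_def)
  define Y where "Y v = (if v = r then insert 0 Q else X v)" for v
  define f where "f v = (if v = r then 0 else \<kappa> v)" for v
  have rlv: "x \<noteq> r" if "x \<in> set (leaf_list t)" for x using subsetD[OF leaf_list_subset that] dist(2) by auto
  have cY: "card (Y r) = D div 2 + 1" using cQ by (simp add: Y_def Q_def)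
  have lc: "leaf_color \<kappa> i = f (q ! i)" if "i < n" for i
    using leaf_color_eq[OF that] k0 by (simp add: f_def)
  have qlv: "q ! i = r \<or> q ! i \<in> set (leaf_list t)" if "i < n" for i
    using that nth_mem[of i q] by (auto simp: q_def n_def)
  have Yk: "Y (q ! i) \<subseteq> {..<k} \<and> f (q ! i) \<in> Y (q ! i)" if "i < n" for i
    using qlv[OF that] XX rlv hk hD(3) by (auto simp: Y_def f_def Q_def)
  have fk: "f (q ! i) < k" if "i < n" for i using Yk[OF that] by blast
  let ?P = "\<lambda>p p'. fst p \<noteq> fst p' \<and> snd p + snd p' < k"
  have near: "f (q ! i) \<noteq> f (q ! nx i) \<and> card (Y (q ! i)) + card (Y (q ! nx i)) < k" if i: "i < n" for i
  proof -
    define g where "g v = (f v, card (Y v))" for v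
    have ld: "leaf_data \<kappa> X t = map g (leaf_list t)" using rlv by (auto simp: leaf_data_def g_def f_def Y_def)
    have gr: "g r = (0, D div 2 + 1)" using cY by (simp add: g_def f_def)
    have ne: "map g (leaf_list t) \<noteq> []" using leaf_list_nonempty by simp
    have "?P (g r) (hd (map g (leaf_list t)))" "?P (last (map g (leaf_list t))) (g r)" "successively ?P (map g (leaf_list t))"
      using ln hD(7) unfolding line_def ld gr by auto
    then have "successively ?P (g r # map g (leaf_list t) @ [g r])"
      using ne by (simp add: successively_Cons successively_append_iff)
    then show ?thesis using successive_on_rim[of ?P g i] i by (simp add: g_def)
  qed
  have "\<exists>x. x < k \<and> x \<notin> Y (q ! i) \<union> Y (q ! nx i)" if i: "i < n" for i
  proof (rule ccontr)
    assume "\<not> ?thesis"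
    then have "{..<k} \<subseteq> Y (q ! i) \<union> Y (q ! nx i)" by blast
    moreover have "finite (Y (q ! i) \<union> Y (q ! nx i))"
      using Yk[OF i] Yk[OF nx_pv(1)[OF i]] by (meson finite_UnI finite_lessThan finite_subset)
    ultimately have "k \<le> card (Y (q ! i) \<union> Y (q ! nx i))" using card_mono[of "Y (q ! i) \<union> Y (q ! nx i)" "{..<k}"] by simp
    then show False using card_Un_le[of "Y (q ! i)" "Y (q ! nx i)"] near[OF i] by linarith
  qed
  then obtain x where x: "\<And>i. i < n \<Longrightarrow> x i < k \<and> x i \<notin> Y (q ! i) \<and> x i \<notin> Y (q ! nx i)" by (metis UnCI)
  define wd where "wd = rim_word n"
  note wd = rim_word[OF n5, folded wd_def]
  define \<epsilon> where "\<epsilon> i = (if wd i = 0 then x i else k + wd i - 1)" for i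
  have e0: "\<epsilon> i < k" if "i < n" "wd i = 0" for i using x[OF that(1)] that(2) by (simp add: \<epsilon>_def)
  have e1: "k \<le> \<epsilon> i" if "wd i \<noteq> 0" for i using that by (simp add: \<epsilon>_def)
  have eY: "\<epsilon> i \<notin> Y (q ! i) \<and> \<epsilon> i \<notin> Y (q ! nx i)" if i: "i < n" for i
  proof (cases "wd i = 0")
    case True then show ?thesis using x[OF i] by (simp add: \<epsilon>_def)
  next
    case False
    then show ?thesis using e1[of i] Yk[OF i] Yk[OF nx_pv(1)[OF i]] by auto
  qed
  have ene: "\<epsilon> i \<noteq> \<epsilon> j" if "i < n" "j < n" "wd i \<noteq> wd j" for i j
  proof (cases "wd i = 0 \<or> wd j = 0")
    case True
    then show ?thesis using e0[of i] e0[of j] e1[of i] e1[of j] that by fastforce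
  next
    case False
    then have "\<epsilon> i = k + wd i - 1" "\<epsilon> j = k + wd j - 1" "wd i \<ge> 1" by (simp_all add: \<epsilon>_def)
    then show ?thesis using that(3) False by arith
  qed
  have efe: "\<epsilon> i \<noteq> f (q ! j)" if "j < n" "wd i \<noteq> 0" for i j
    using e1[OF that(2)] fk[OF that(1)] by linarith
  have rimY: "rim \<epsilon> (q ! i) \<inter> Y (q ! i) = {}" if i: "i < n" for i
    using eY[OF i] eY[OF nx_pv(2)[OF i]] nx_pv(3)[OF i] rim_leaf[OF i] by auto
  have CTk: "c < k" if "u \<in> subtrees t" "c \<in> tree_colors \<kappa> u" for u c
    using that kk rt_in(1) child_subtree[OF that(1)] by (auto simp: tree_colors_def)
  \<comment> \<open>next to a reused tree colour the rim has only new colours\<close>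
  have next0: "wd (nx i) \<noteq> 0 \<and> wd (pv i) \<noteq> 0" if "i < n" "wd i = 0" for i
    using wd(1)[OF that(1)] wd(1)[OF nx_pv(2)[OF that(1)]] nx_pv(3)[OF that(1)] that(2) by metis
  have inCT: "wd i = 0" if i: "i < n" and u: "attached u v" "\<epsilon> i \<in> tree_colors \<kappa> u" for i u v
    using CTk[of u "\<epsilon> i"] u e1[of i] self_subtree[of t] unfolding attached_def by fastforce
  have star: "star_edge_coloring G (edge_color \<kappa> \<epsilon>)"
  proof (rule glue_star_edge_coloring)
    have "q ! 0 = r" "0 < n" using q0 by auto
    then have "rim \<epsilon> r \<inter> Q = {}" using rimY[of 0] by (auto simp: Y_def)
    moreover have "0 \<notin> Q" by (simp add: Q_def)
    ultimately have "star_colored \<kappa> (\<lambda>v. - X v) (insert 0 (rim \<epsilon> r)) t" using gs0 by simp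
    then have "star_colored \<kappa> (rim \<epsilon>) (insert 0 (rim \<epsilon> r)) t"
    proof (rule star_colored_mono)
      fix v assume v: "v \<in> set (preorder t)"
      then have vr: "v \<noteq> r" using dist(2) by blast
      show "rim \<epsilon> v \<subseteq> - X v"
      proof (cases "\<exists>i<n. v = q ! i")
        case True
        then obtain i where "i < n" "v = q ! i" by blast
        then show ?thesis using rimY[of i] vr by (auto simp: Y_def)
      next
        case False
        then have "rim \<epsilon> v = {}" unfolding rim_def using nx_pv(1) by auto
        then show ?thesis by simp
      qed
    qed
    then show "star_colored \<kappa> (rim \<epsilon>) (insert (\<kappa> (rt t)) (rim \<epsilon> r)) t" using k0 by simp
  next
    fix i assume i: "i < n"
    have j: "nx i < n" using nx_pv(1)[OF i] .
    show "\<epsilon> i \<noteq> leaf_color \<kappa> i \<and> \<epsilon> i \<noteq> leaf_color \<kappa> (nx i) \<and> \<epsilon> i \<noteq> \<epsilon> (nx i)"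
      using eY[OF i] Yk[OF i] Yk[OF j] ene[OF i j wd(1)[OF i]] by (auto simp: lc[OF i] lc[OF j])
  next
    fix i u assume i: "i < n" and u: "attached u (q ! i)" "\<epsilon> i \<in> tree_colors \<kappa> u"
    have "nx i < n" using nx_pv(1)[OF i] .
    then show "leaf_color \<kappa> i \<noteq> leaf_color \<kappa> (nx i) \<and> leaf_color \<kappa> i \<noteq> \<epsilon> (nx i)"
      using near[OF i] next0[OF i inCT[OF i u]] efe[OF i, of "nx i"] lc i by auto
  next
    fix i u assume i: "i < n" and u: "attached u (q ! nx i)" "\<epsilon> i \<in> tree_colors \<kappa> u"
    have "nx i < n" using nx_pv(1)[OF i] .
    then show "leaf_color \<kappa> (nx i) \<noteq> leaf_color \<kappa> i \<and> leaf_color \<kappa> (nx i) \<noteq> \<epsilon> (pv i)"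
      using near[OF i] next0[OF i inCT[OF i u]] efe[of "nx i" "pv i"] lc i by auto
  next
    fix i assume i: "i < n"
    have p: "pv i < n" "nx (pv i) = i" "nx i < n" "nx (nx i) < n" using nx_pv[OF i] nx_pv(1) by auto
    consider "wd i = 0" | "wd (nx i) = 0" | "wd i \<noteq> 0" "wd (nx i) \<noteq> 0" "wd (pv i) = 0"
      using wd(3)[OF p(1)] p(2) by auto
    then have "(\<epsilon> (nx i) \<noteq> f (q ! i) \<and> \<epsilon> (nx i) \<noteq> \<epsilon> (pv i)) \<or> (\<epsilon> i \<noteq> f (q ! nx (nx i)) \<and> \<epsilon> i \<noteq> \<epsilon> (nx (nx i)))"
    proof cases
      case 1
      then have "wd (pv i) \<noteq> wd (nx i)" using wd(2)[OF p(1)] p(2) by simp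
      then have "\<epsilon> (nx i) \<noteq> \<epsilon> (pv i)" using ene p by metis
      moreover have "\<epsilon> (nx i) \<noteq> f (q ! i)" using efe[OF i, of "nx i"] next0[OF i 1] by simp
      ultimately show ?thesis by simp
    next
      case 2
      then have "wd i \<noteq> wd (nx (nx i))" using wd(2)[OF i] by simp
      then have "\<epsilon> i \<noteq> \<epsilon> (nx (nx i))" using ene p(4) i by metis
      moreover have "\<epsilon> i \<noteq> f (q ! nx (nx i))" using efe[OF p(4), of i] wd(1)[OF i] 2 by metis
      ultimately show ?thesis by simp
    next
      case 3
      then have "\<epsilon> (nx i) \<noteq> \<epsilon> (pv i)" using ene[OF p(3,1)] by simp
      then show ?thesis using efe[OF i, of "nx i"] 3 by simp
    qed
    then show "\<not> ((\<epsilon> (nx i) = leaf_color \<kappa> i \<or> \<epsilon> (nx i) = \<epsilon> (pv i)) \<and>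
      (\<epsilon> i = leaf_color \<kappa> (nx (nx i)) \<or> \<epsilon> i = \<epsilon> (nx (nx i))))"
      using lc[OF i] lc[OF p(4)] by auto
  qed
  have "\<epsilon> i < k + 2" if "i < n" for i
    using x[OF that] wd(4)[OF that] by (auto simp: \<epsilon>_def)
  moreover have "\<kappa> v < k + 2" if "v \<in> set (preorder t)" for v using kk[OF that] by simp
  ultimately show ?thesis using colorableI[OF star, of "k + 2"] unfolding k_def by blast
qed

end

section \<open>Rims of length five\<close>

text \<open>Sufficient conditions on leaf colours \<open>f\<close> and rim colours \<open>e\<close> that do not mention the tree: those of
\<open>glue_star_edge_coloring\<close> with the conclusions of \<open>l2\<close> and \<open>l2'\<close> required unconditionally.\<close>
definition ring5 :: "nat list \<Rightarrow> nat list \<Rightarrow> bool" where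
  "ring5 f e \<longleftrightarrow> length f = 5 \<and> length e = 5 \<and>
     (\<forall>i\<in>{0, 1, 2, 3, 4}. let s = (i + 1) mod 5; p = (i + 4) mod 5; s2 = (s + 1) mod 5 in
       e ! i \<noteq> f ! i \<and> e ! i \<noteq> f ! s \<and> e ! i \<noteq> e ! s \<and>
       f ! i \<noteq> f ! s \<and> f ! i \<noteq> e ! s \<and> f ! s \<noteq> e ! p \<and>
       \<not> ((e ! s = f ! i \<or> e ! s = e ! p) \<and> (e ! i = f ! s2 \<or> e ! i = e ! s2)))"

text \<open>A leaf colour recurs on the rim only on the edge opposite to the leaf.\<close>
lemma ring5_concrete:
  "ring5 [1, 0, 1, 2, 0] [2, 3, 4, 5, 3]" "ring5 [0, 1, 2, 3, 4] [3, 4, 5, 6, 5]"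
  unfolding ring5_def Let_def by (simp_all only: ball_simps) (intro conjI; simp)+

context ring_tree
begin

lemma ex_labelling: "distinct xs \<Longrightarrow> length xs = length ks \<Longrightarrow> \<exists>\<kappa>. map \<kappa> xs = ks"
  by (intro exI[of _ "\<lambda>x. the (map_of (zip xs ks) x)"] nth_equalityI) (auto simp: map_of_zip_nth)

text \<open>The list \<open>ks\<close> contains the tree colours in preorder. For a concrete tree, \<open>gs\<close> is a finite
computation.\<close>
lemma five_colorable:
  assumes n5: "n = 5" and f: "ring5 f e" and k: "length (preorder t) = length ks" "\<forall>c\<in>set e \<union> set ks. c < K"
    and gs: "\<And>\<kappa> E. map \<kappa> (preorder t) = ks \<Longrightarrow> E (leaf_list t ! 0) = {e ! 1, e ! 0} \<Longrightarrow> E (leaf_list t ! 1) = {e ! 2, e ! 1} \<Longrightarrow>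
      E (leaf_list t ! 2) = {e ! 3, e ! 2} \<Longrightarrow> E (leaf_list t ! 3) = {e ! 4, e ! 3} \<Longrightarrow>
      \<kappa> (rt t) # map \<kappa> (leaf_list t) = f \<and> star_colored \<kappa> E {f ! 0, e ! 0, e ! 4} t"
  shows "star_edge_colorable G K"
proof -
  obtain \<kappa> where \<kappa>: "map \<kappa> (preorder t) = ks" using ex_labelling[OF dist(1) k(1)] by blast
  define \<epsilon> where "\<epsilon> i = e ! i" for i
  have len: "length f = 5" "length e = 5" using f by (simp_all add: ring5_def)
  have nxv: "nx i = Suc i mod 5" "pv i = (i + 4) mod 5" for i using n5 by (simp_all add: nx_def pv_def add.commute)
  have r: "rim \<epsilon> (q ! i) = {e ! i, e ! ((i + 4) mod 5)}" if "i < 5" for i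
    using rim_leaf[of i \<epsilon>] that n5 by (simp add: \<epsilon>_def nxv)
  have lq: "leaf_list t ! 0 = q ! 1" "leaf_list t ! 1 = q ! 2" "leaf_list t ! 2 = q ! 3" "leaf_list t ! 3 = q ! 4" by (simp_all add: q_def)
  have r1: "rim \<epsilon> (q ! 1) = {e ! 1, e ! 0}" "rim \<epsilon> (q ! 2) = {e ! 2, e ! 1}" "rim \<epsilon> (q ! 3) = {e ! 3, e ! 2}"
    "rim \<epsilon> (q ! 4) = {e ! 4, e ! 3}"
    using r[of 1] r[of 2] r[of 3] r[of 4] by simp_all
  have fl: "\<kappa> (rt t) # map \<kappa> (leaf_list t) = f" and g: "star_colored \<kappa> (rim \<epsilon>) {f ! 0, e ! 0, e ! 4} t"
    using gs[OF \<kappa>, of "rim \<epsilon>", unfolded lq, OF r1] by blast+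
  have lc: "leaf_color \<kappa> i = f ! i" if "i < n" for i
    using that by (cases i) (auto simp: leaf_color_def q_def n_def nth_append fl[symmetric])
  have m5: "j mod 5 < n" for j using n5 by simp
  have C: "\<epsilon> i \<noteq> f ! i" "\<epsilon> i \<noteq> f ! nx i" "\<epsilon> i \<noteq> \<epsilon> (nx i)" "f ! i \<noteq> f ! nx i" "f ! i \<noteq> \<epsilon> (nx i)"
    "f ! nx i \<noteq> \<epsilon> (pv i)"
    "\<not> ((\<epsilon> (nx i) = f ! i \<or> \<epsilon> (nx i) = \<epsilon> (pv i)) \<and> (\<epsilon> i = f ! nx (nx i) \<or> \<epsilon> i = \<epsilon> (nx (nx i))))"
    if "i < n" for i
  proof -
    have "i \<in> {0, 1, 2, 3, 4}" using that n5 by auto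
    then have "let s = (i + 1) mod 5; p = (i + 4) mod 5; s2 = (s + 1) mod 5 in
       e ! i \<noteq> f ! i \<and> e ! i \<noteq> f ! s \<and> e ! i \<noteq> e ! s \<and>
       f ! i \<noteq> f ! s \<and> f ! i \<noteq> e ! s \<and> f ! s \<noteq> e ! p \<and>
       \<not> ((e ! s = f ! i \<or> e ! s = e ! p) \<and> (e ! i = f ! s2 \<or> e ! i = e ! s2))"
      using f unfolding ring5_def by blast
    then show "\<epsilon> i \<noteq> f ! i" "\<epsilon> i \<noteq> f ! nx i" "\<epsilon> i \<noteq> \<epsilon> (nx i)" "f ! i \<noteq> f ! nx i" "f ! i \<noteq> \<epsilon> (nx i)"
      "f ! nx i \<noteq> \<epsilon> (pv i)"
      "\<not> ((\<epsilon> (nx i) = f ! i \<or> \<epsilon> (nx i) = \<epsilon> (pv i)) \<and> (\<epsilon> i = f ! nx (nx i) \<or> \<epsilon> i = \<epsilon> (nx (nx i))))"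
      unfolding \<epsilon>_def nxv Let_def Suc_eq_plus1 by blast+
  qed
  have star: "star_edge_coloring G (edge_color \<kappa> \<epsilon>)"
  proof (rule glue_star_edge_coloring)
    have "rim \<epsilon> r = {e ! 0, e ! 4}" using r[of 0] q0 by simp
    moreover have "\<kappa> (rt t) = f ! 0" by (simp add: fl[symmetric])
    ultimately show "star_colored \<kappa> (rim \<epsilon>) (insert (\<kappa> (rt t)) (rim \<epsilon> r)) t" using g by simp
  next
    fix i assume i: "i < n"
    have j: "nx i < n" "nx (nx i) < n" using nx_pv(1)[OF nx_pv(1)[OF i]] nx_pv(1)[OF i] by auto
    note lcs = lc[OF i] lc[OF j(1)] lc[OF j(2)]
    show "\<epsilon> i \<noteq> leaf_color \<kappa> i \<and> \<epsilon> i \<noteq> leaf_color \<kappa> (nx i) \<and> \<epsilon> i \<noteq> \<epsilon> (nx i)"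
      using C(1-3)[OF i] by (simp add: lcs)
    show "leaf_color \<kappa> i \<noteq> leaf_color \<kappa> (nx i) \<and> leaf_color \<kappa> i \<noteq> \<epsilon> (nx i)"
      using C(4,5)[OF i] by (simp add: lcs)
    show "leaf_color \<kappa> (nx i) \<noteq> leaf_color \<kappa> i \<and> leaf_color \<kappa> (nx i) \<noteq> \<epsilon> (pv i)"
      using C(4,6)[OF i] by (simp add: lcs)
    show "\<not> ((\<epsilon> (nx i) = leaf_color \<kappa> i \<or> \<epsilon> (nx i) = \<epsilon> (pv i)) \<and>
      (\<epsilon> i = leaf_color \<kappa> (nx (nx i)) \<or> \<epsilon> i = \<epsilon> (nx (nx i))))"
      using C(7)[OF i] by (simp add: lcs)
  qed
  have "\<kappa> x < K" if "x \<in> set (preorder t)" for x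
    using that k(2) unfolding \<kappa>[symmetric] by simp
  moreover have "\<epsilon> i < K" if "i < n" for i using k(2) len that n5 by (simp add: \<epsilon>_def)
  ultimately show ?thesis using colorableI[OF star] by blast
qed

end

definition wide :: "'a plane_tree \<Rightarrow> bool" where
  "wide t \<longleftrightarrow> (\<forall>u\<in>subtrees t. subs u \<noteq> [] \<longrightarrow> 2 \<le> length (subs u))"

lemma leaf_count_pos: "1 \<le> length (leaf_list t)"
  using leaf_list_nonempty[of t] by (simp add: Suc_leI)

lemma wide_cases:
  assumes "wide t" "length (leaf_list t) \<le> 4"
  obtains v where "t = Nd v []"
  | v s1 s2 where "t = Nd v [s1, s2]" "wide s1" "wide s2"
  | v s1 s2 s3 where "t = Nd v [s1, s2, s3]" "wide s1" "wide s2" "wide s3"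
  | v s1 s2 s3 s4 where "t = Nd v [s1, s2, s3, s4]" "wide s1" "wide s2" "wide s3" "wide s4"
proof -
  obtain v ts where t: "t = Nd v ts" by (cases t)
  show ?thesis
  proof (cases "ts = []")
    case True then show ?thesis using that(1) t by simp
  next
    case False
    then have "2 \<le> length ts" using assms(1) t by (auto simp: wide_def)
    moreover have "length ts \<le> length (concat (map leaf_list ts))"
    proof (induction ts)
      case (Cons s ts) then show ?case using leaf_count_pos[of s] by simp
    qed simp
    ultimately have "length ts = 2 \<or> length ts = 3 \<or> length ts = 4" using assms(2) t False by auto
    then show ?thesis
    proof (elim disjE)
      assume "length ts = 2"
      then obtain s1 s2 where "ts = [s1, s2]" by (auto simp: numeral_eq_Suc length_Suc_conv)
      then show ?thesis using that(2) t assms(1) by (auto simp: wide_def)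
    next
      assume "length ts = 3"
      then obtain s1 s2 s3 where "ts = [s1, s2, s3]" by (auto simp: numeral_eq_Suc length_Suc_conv)
      then show ?thesis using that(3) t assms(1) by (auto simp: wide_def)
    next
      assume "length ts = 4"
      then obtain s1 s2 s3 s4 where "ts = [s1, s2, s3, s4]" by (auto simp: numeral_eq_Suc length_Suc_conv)
      then show ?thesis using that(4) t assms(1) by (auto simp: wide_def)
    qed
  qed
qed

lemma one_leaf:
  assumes "wide t" "length (leaf_list t) = 1"
  shows "\<exists>a. t = Nd a []"
proof -
  have p: "leaf_list s \<noteq> []" for s :: "'a plane_tree" by (rule leaf_list_nonempty)
  have "length (leaf_list t) \<le> 4" using assms(2) by simp
  then show ?thesis by (rule wide_cases[OF assms(1)]) (use assms(2) p in \<open>auto simp: add_is_1\<close>)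
qed

lemma two_leaves:
  assumes "wide t" "length (leaf_list t) = 2"
  shows "\<exists>a b c. t = Nd a [Nd b [], Nd c []]"
proof -
  have p: "1 \<le> length (leaf_list s)" for s :: "'a plane_tree" by (rule leaf_count_pos)
  have "length (leaf_list t) \<le> 4" using assms(2) by simp
  then show ?thesis
  proof (rule wide_cases[OF assms(1)])
    fix v s1 s2 assume t: "t = Nd v [s1, s2]" "wide s1" "wide s2"
    then have "length (leaf_list s1) = 1" "length (leaf_list s2) = 1" using assms(2) p[of s1] p[of s2] by auto
    then show ?thesis using t one_leaf[of s1] one_leaf[of s2] by blast
  next
    fix v s1 s2 s3 assume "t = Nd v [s1, s2, s3]"
    then show ?thesis using assms(2) p[of s1] p[of s2] p[of s3] by simp
  next
    fix v s1 s2 s3 s4 assume "t = Nd v [s1, s2, s3, s4]"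
    then show ?thesis using assms(2) p[of s1] p[of s2] p[of s3] p[of s4] by simp
  qed (use assms in simp)
qed

lemma three_leaves:
  assumes "wide t" "length (leaf_list t) = 3"
  shows "(\<exists>a b c d e. t = Nd a [Nd b [], Nd c [Nd d [], Nd e []]]) \<or>
    (\<exists>a b c d e. t = Nd a [Nd b [Nd c [], Nd d []], Nd e []]) \<or>
    (\<exists>a b c d. t = Nd a [Nd b [], Nd c [], Nd d []])"
proof -
  have p: "1 \<le> length (leaf_list s)" for s :: "'a plane_tree" by (rule leaf_count_pos)
  have "length (leaf_list t) \<le> 4" using assms(2) by simp
  then show ?thesis
  proof (rule wide_cases[OF assms(1)])
    fix v s1 s2 assume t: "t = Nd v [s1, s2]" "wide s1" "wide s2"
    then have "length (leaf_list s1) = 1 \<and> length (leaf_list s2) = 2 \<or> length (leaf_list s1) = 2 \<and> length (leaf_list s2) = 1"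
      using assms(2) p[of s1] p[of s2] by auto
    then show ?thesis
    proof (elim disjE conjE)
      assume "length (leaf_list s1) = 1" "length (leaf_list s2) = 2"
      then show ?thesis using t one_leaf[of s1] two_leaves[of s2] by blast
    next
      assume "length (leaf_list s1) = 2" "length (leaf_list s2) = 1"
      then show ?thesis using t two_leaves[of s1] one_leaf[of s2] by blast
    qed
  next
    fix v s1 s2 s3 assume t: "t = Nd v [s1, s2, s3]" "wide s1" "wide s2" "wide s3"
    then have "length (leaf_list s1) = 1" "length (leaf_list s2) = 1" "length (leaf_list s3) = 1"
      using assms(2) p[of s1] p[of s2] p[of s3] by auto
    then show ?thesis using t one_leaf[of s1] one_leaf[of s2] one_leaf[of s3] by blast
  next
    fix v s1 s2 s3 s4 assume "t = Nd v [s1, s2, s3, s4]"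
    then show ?thesis using assms(2) p[of s1] p[of s2] p[of s3] p[of s4] by simp
  qed (use assms in simp)
qed

text \<open>The numbers of leaves below the children of the root form a composition of four into at least two parts.\<close>
lemma four_leaves:
  assumes "wide t" "length (leaf_list t) = 4"
  shows "(\<exists>a b c d e f g. t = Nd a [Nd b [Nd c [], Nd d []], Nd e [Nd f [], Nd g []]]) \<or>
    (\<exists>a b c d e f g. t = Nd a [Nd b [], Nd c [Nd d [], Nd e [Nd f [], Nd g []]]]) \<or>
    (\<exists>a b c d e f g. t = Nd a [Nd b [], Nd c [Nd d [Nd e [], Nd f []], Nd g []]]) \<or>
    (\<exists>a b c d e f g. t = Nd a [Nd b [Nd c [], Nd d [Nd e [], Nd f []]], Nd g []]) \<or>
    (\<exists>a b c d e f g. t = Nd a [Nd b [Nd c [Nd d [], Nd e []], Nd f []], Nd g []]) \<or>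
    (\<exists>a b c d e. t = Nd a [Nd b [], Nd c [], Nd d [], Nd e []]) \<or>
    (\<exists>a b c d e f. t = Nd a [Nd b [Nd c [], Nd d []], Nd e [], Nd f []]) \<or>
    (\<exists>a b c d e f. t = Nd a [Nd b [], Nd c [Nd d [], Nd e []], Nd f []]) \<or>
    (\<exists>a b c d e f. t = Nd a [Nd b [], Nd c [], Nd d [Nd e [], Nd f []]]) \<or>
    (\<exists>a b c d e f. t = Nd a [Nd b [Nd c [], Nd d [], Nd e []], Nd f []]) \<or>
    (\<exists>a b c d e f. t = Nd a [Nd b [], Nd c [Nd d [], Nd e [], Nd f []]])"
proof -
  have p: "1 \<le> length (leaf_list s)" for s :: "'a plane_tree" by (rule leaf_count_pos)
  have "length (leaf_list t) \<le> 4" using assms(2) by simp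
  then show ?thesis
  proof (rule wide_cases[OF assms(1)])
    fix v s1 s2 assume t: "t = Nd v [s1, s2]" "wide s1" "wide s2"
    then have "length (leaf_list s1) = 1 \<and> length (leaf_list s2) = 3 \<or> length (leaf_list s1) = 2 \<and> length (leaf_list s2) = 2 \<or>
        length (leaf_list s1) = 3 \<and> length (leaf_list s2) = 1"
      using assms(2) p[of s1] p[of s2] by auto
    then show ?thesis
    proof (elim disjE conjE)
      assume l: "length (leaf_list s1) = 1" "length (leaf_list s2) = 3"
      show ?thesis using one_leaf[OF t(2) l(1)] three_leaves[OF t(3) l(2)] unfolding t(1)
        by (elim disjE exE) simp_all
    next
      assume l: "length (leaf_list s1) = 2" "length (leaf_list s2) = 2"
      show ?thesis using two_leaves[OF t(2) l(1)] two_leaves[OF t(3) l(2)] unfolding t(1)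
        by (elim disjE exE) simp_all
    next
      assume l: "length (leaf_list s1) = 3" "length (leaf_list s2) = 1"
      show ?thesis using three_leaves[OF t(2) l(1)] one_leaf[OF t(3) l(2)] unfolding t(1)
        by (elim disjE exE) simp_all
    qed
  next
    fix v s1 s2 s3 assume t: "t = Nd v [s1, s2, s3]" "wide s1" "wide s2" "wide s3"
    then have "length (leaf_list s1) = 2 \<and> length (leaf_list s2) = 1 \<and> length (leaf_list s3) = 1 \<or>
        length (leaf_list s1) = 1 \<and> length (leaf_list s2) = 2 \<and> length (leaf_list s3) = 1 \<or>
        length (leaf_list s1) = 1 \<and> length (leaf_list s2) = 1 \<and> length (leaf_list s3) = 2"
      using assms(2) p[of s1] p[of s2] p[of s3] by auto
    then show ?thesis
    proof (elim disjE conjE)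
      assume l: "length (leaf_list s1) = 2" "length (leaf_list s2) = 1" "length (leaf_list s3) = 1"
      show ?thesis using two_leaves[OF t(2) l(1)] one_leaf[OF t(3) l(2)] one_leaf[OF t(4) l(3)] unfolding t(1)
        by (elim disjE exE) simp_all
    next
      assume l: "length (leaf_list s1) = 1" "length (leaf_list s2) = 2" "length (leaf_list s3) = 1"
      show ?thesis using one_leaf[OF t(2) l(1)] two_leaves[OF t(3) l(2)] one_leaf[OF t(4) l(3)] unfolding t(1)
        by (elim disjE exE) simp_all
    next
      assume l: "length (leaf_list s1) = 1" "length (leaf_list s2) = 1" "length (leaf_list s3) = 2"
      show ?thesis using one_leaf[OF t(2) l(1)] one_leaf[OF t(3) l(2)] two_leaves[OF t(4) l(3)] unfolding t(1)
        by (elim disjE exE) simp_all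
    qed
  next
    fix v s1 s2 s3 s4 assume t: "t = Nd v [s1, s2, s3, s4]" "wide s1" "wide s2" "wide s3" "wide s4"
    then have l: "length (leaf_list s1) = 1" "length (leaf_list s2) = 1" "length (leaf_list s3) = 1" "length (leaf_list s4) = 1"
      using assms(2) p[of s1] p[of s2] p[of s3] p[of s4] by auto
    show ?thesis using one_leaf[OF t(2) l(1)] one_leaf[OF t(3) l(2)] one_leaf[OF t(4) l(3)] one_leaf[OF t(5) l(4)]
      unfolding t(1) by (elim disjE exE) simp_all
  qed (use assms in simp)
qed

context ring_tree
begin

lemma small_ring_colorable:
  assumes n5: "n = 5"
  shows "star_edge_colorable G (if binary t then 6 else 7)"
proof -
  have "wide t" using rep unfolding plane_rep_def wide_def by blast
  moreover have "length (leaf_list t) = 4" using n5 by (simp add: n_def q_def)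
  ultimately have "(\<exists>a b c d e f g. t = Nd a [Nd b [Nd c [], Nd d []], Nd e [Nd f [], Nd g []]]) \<or>
    (\<exists>a b c d e f g. t = Nd a [Nd b [], Nd c [Nd d [], Nd e [Nd f [], Nd g []]]]) \<or>
    (\<exists>a b c d e f g. t = Nd a [Nd b [], Nd c [Nd d [Nd e [], Nd f []], Nd g []]]) \<or>
    (\<exists>a b c d e f g. t = Nd a [Nd b [Nd c [], Nd d [Nd e [], Nd f []]], Nd g []]) \<or>
    (\<exists>a b c d e f g. t = Nd a [Nd b [Nd c [Nd d [], Nd e []], Nd f []], Nd g []]) \<or>
    (\<exists>a b c d e. t = Nd a [Nd b [], Nd c [], Nd d [], Nd e []]) \<or>
    (\<exists>a b c d e f. t = Nd a [Nd b [Nd c [], Nd d []], Nd e [], Nd f []]) \<or>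
    (\<exists>a b c d e f. t = Nd a [Nd b [], Nd c [Nd d [], Nd e []], Nd f []]) \<or>
    (\<exists>a b c d e f. t = Nd a [Nd b [], Nd c [], Nd d [Nd e [], Nd f []]]) \<or>
    (\<exists>a b c d e f. t = Nd a [Nd b [Nd c [], Nd d [], Nd e []], Nd f []]) \<or>
    (\<exists>a b c d e f. t = Nd a [Nd b [], Nd c [Nd d [], Nd e [], Nd f []]])"
    by (rule four_leaves)
  then show ?thesis
  proof (elim disjE exE)
    fix a b c d e f g assume t: "t = Nd a [Nd b [Nd c [], Nd d []], Nd e [Nd f [], Nd g []]]"
    have "star_edge_colorable G 6"
      by (rule five_colorable[OF n5 ring5_concrete(1), of "[1, 5, 0, 1, 3, 2, 0]"])
        (auto simp: t star_colored_at_def all_colors_def tree_colors_def eval_nat_numeral)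
    then show ?thesis by (simp add: t)
  next
    fix a b c d e f g assume t: "t = Nd a [Nd b [], Nd c [Nd d [], Nd e [Nd f [], Nd g []]]]"
    have "star_edge_colorable G 6"
      by (rule five_colorable[OF n5 ring5_concrete(1), of "[1, 0, 5, 1, 3, 2, 0]"])
        (auto simp: t star_colored_at_def all_colors_def tree_colors_def eval_nat_numeral)
    then show ?thesis by (simp add: t)
  next
    fix a b c d e f g assume t: "t = Nd a [Nd b [], Nd c [Nd d [Nd e [], Nd f []], Nd g []]]"
    have "star_edge_colorable G 6"
      by (rule five_colorable[OF n5 ring5_concrete(1), of "[1, 0, 4, 3, 1, 2, 0]"])
        (auto simp: t star_colored_at_def all_colors_def tree_colors_def eval_nat_numeral)
    then show ?thesis by (simp add: t)
  next
    fix a b c d e f g assume t: "t = Nd a [Nd b [Nd c [], Nd d [Nd e [], Nd f []]], Nd g []]"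
    have "star_edge_colorable G 6"
      by (rule five_colorable[OF n5 ring5_concrete(1), of "[1, 4, 0, 3, 1, 2, 0]"])
        (auto simp: t star_colored_at_def all_colors_def tree_colors_def eval_nat_numeral)
    then show ?thesis by (simp add: t)
  next
    fix a b c d e f g assume t: "t = Nd a [Nd b [Nd c [Nd d [], Nd e []], Nd f []], Nd g []]"
    have "star_edge_colorable G 6"
      by (rule five_colorable[OF n5 ring5_concrete(1), of "[1, 3, 4, 0, 1, 2, 0]"])
        (auto simp: t star_colored_at_def all_colors_def tree_colors_def eval_nat_numeral)
    then show ?thesis by (simp add: t)
  next
    fix a b c d e assume t: "t = Nd a [Nd b [], Nd c [], Nd d [], Nd e []]"
    have "star_edge_colorable G 7"
      by (rule five_colorable[OF n5 ring5_concrete(2), of "[0, 1, 2, 3, 4]"])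
        (auto simp: t star_colored_at_def all_colors_def tree_colors_def eval_nat_numeral)
    then show ?thesis by (simp add: t)
  next
    fix a b c d e f assume t: "t = Nd a [Nd b [Nd c [], Nd d []], Nd e [], Nd f []]"
    have "star_edge_colorable G 7"
      by (rule five_colorable[OF n5 ring5_concrete(2), of "[0, 5, 1, 2, 3, 4]"])
        (auto simp: t star_colored_at_def all_colors_def tree_colors_def eval_nat_numeral)
    then show ?thesis by (simp add: t)
  next
    fix a b c d e f assume t: "t = Nd a [Nd b [], Nd c [Nd d [], Nd e []], Nd f []]"
    have "star_edge_colorable G 7"
      by (rule five_colorable[OF n5 ring5_concrete(2), of "[0, 1, 5, 2, 3, 4]"])
        (auto simp: t star_colored_at_def all_colors_def tree_colors_def eval_nat_numeral)
    then show ?thesis by (simp add: t)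
  next
    fix a b c d e f assume t: "t = Nd a [Nd b [], Nd c [], Nd d [Nd e [], Nd f []]]"
    have "star_edge_colorable G 7"
      by (rule five_colorable[OF n5 ring5_concrete(2), of "[0, 1, 2, 5, 3, 4]"])
        (auto simp: t star_colored_at_def all_colors_def tree_colors_def eval_nat_numeral)
    then show ?thesis by (simp add: t)
  next
    fix a b c d e f assume t: "t = Nd a [Nd b [Nd c [], Nd d [], Nd e []], Nd f []]"
    have "star_edge_colorable G 7"
      by (rule five_colorable[OF n5 ring5_concrete(2), of "[0, 5, 1, 2, 3, 4]"])
        (auto simp: t star_colored_at_def all_colors_def tree_colors_def eval_nat_numeral)
    then show ?thesis by (simp add: t)
  next
    fix a b c d e f assume t: "t = Nd a [Nd b [], Nd c [Nd d [], Nd e [], Nd f []]]"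
    have "star_edge_colorable G 7"
      by (rule five_colorable[OF n5 ring5_concrete(2), of "[0, 1, 5, 2, 3, 4]"])
        (auto simp: t star_colored_at_def all_colors_def tree_colors_def eval_nat_numeral)
    then show ?thesis by (simp add: t)
  qed
qed

end

section \<open>The bound for all Halin graphs\<close>

lemma star_edge_colorable_mono: "star_edge_colorable G k \<Longrightarrow> k \<le> l \<Longrightarrow> star_edge_colorable G l"
  unfolding star_edge_colorable_def by (meson lessThan_subset_iff subset_trans)

theorem theorem4:
  fixes G T C :: "'a sgraph"
    and pos :: "'a \<Rightarrow> complex" and curve :: "'a set \<Rightarrow> real \<Rightarrow> complex"
  assumes "halin_graph G T C pos curve"
  shows "int (star_chromatic_index G) \<le> \<lfloor>3 * real (max_degree G) / 2\<rfloor> + 2"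
proof -
  define D where "D = max_degree G"
  obtain r t where rep: "plane_rep G D r t" using halin_plane_rep[OF assms] unfolding D_def by blast
  interpret ring_tree G D r t using rep by unfold_locales
  have D3: "D \<ge> 3"
    using rep self_subtree[of t] dist(5) unfolding plane_rep_def by fastforce
  have "star_edge_colorable G (3 * D div 2 + 2)"
  proof (cases "D = 3")
    case True
    then have "binary t" using binary_if_cubic by simp
    then have "star_edge_colorable G 6"
      using cubic_colorable small_ring_colorable by (cases "n = 5") auto
    then show ?thesis using True by simp
  next
    case False
    then have D4: "D \<ge> 4" using D3 by simp
    show ?thesis
    proof (cases "n = 5")
      case True
      have "(if binary t then 6 else 7) \<le> 3 * D div 2 + 2" using D4 by auto
      then show ?thesis using star_edge_colorable_mono[OF small_ring_colorable[OF True]] by blast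
    qed (use large_colorable D4 in blast)
  qed
  then have "star_chromatic_index G \<le> 3 * D div 2 + 2"
    unfolding star_chromatic_index_def by (rule Least_le)
  moreover have "\<lfloor>3 * real D / 2\<rfloor> = int (3 * D div 2)"
    using floor_divide_of_nat_eq[of "3 * D" 2, where ?'a = real] by simp
  ultimately show ?thesis unfolding D_def by linarith
qed

end
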